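(* Assume the standing setting described in the context. Suppose that $L:=\{i\in I:C(A_i)=\infty\}$ consists of a single index $\ell$, that $\ell\in I^-$, and that $A_i\cap A_\ell=\varnothing$ for all $i\ne\ell$. For an admissible vector $\boldsymbol a$ (see context), let $\tilde{\boldsymbol\lambda}=(\tilde\lambda^i)_{i\in I}$ be any solution of the $(\boldsymbol A,\boldsymbol a,g,\chi,I\setminus\{\ell\})$-problem. Then the Gauss variational problem (the $(\boldsymbol A,\boldsymbol a,g,\chi,I)$-problem) is solvable if and only if $$a_\ell\le\int g\,d\tilde\lambda^\ell,$$ or, equivalently, $$a_\ell\le\int g\,d\Bigl[P_{A_\ell}\Bigl(\chi+\sum_{i\ne\ell}\alpha_i\tilde\lambda^i\Bigr)\Bigr].$$ In other words, the set $\mathcal S_\kappa(\boldsymbol A,g,\chi)$ of all admissible $\boldsymbol a$ for which the Gauss variational problem is solvable consists exactly of those $\boldsymbol a$ satisfying these inequalities.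
   Context: Standing setting. $\mathrm X$ is a noncompact locally compact Hausdorff space; $\mathfrak M$ the real Radon measures on $\mathrm X$ with the vague topology; $S(\nu)$ the support. Kernel $\kappa:\mathrm X\times\mathrm X\to[0,\infty]$, lower semicontinuous, symmetric; $\kappa(\nu,\nu_1)=\int\kappa\,d(\nu\otimes\nu_1)$, $\kappa(x,\nu)=\int\kappa(x,y)d\nu(y)$; $\mathcal E$ = measures with $\kappa(\nu,\nu)$ well defined and finite. Assumed: (a) strictly positive definite ($\|\nu\|:=\kappa(\nu,\nu)^{1/2}$ is a norm on the pre-Hilbert space $\mathcal E$; "strong" refers to it); (b) consistent: every strong Cauchy net in $\mathcal E^+=\{\nu\in\mathcal E:\nu\ge0\}$ converges strongly to each of its vague cluster points; (c) $\kappa(x,y)$ finite and continuous for $x\ne y$; (d) for each $\varepsilon>0$ and compact $K$ there is compact $K'$ with $\kappa(x,y)<\varepsilon$ for $x\in K,y\notin K'$; (e) generalized maximum principle with constant $h\ge1$ (for compactly supported $\nu\ge0$ with $M=\sup_{S(\nu)}\kappa(\cdot,\nu)<\infty$, $\kappa(\cdot,\nu)\le hM$ everywhere). $\mathcal E^+_E$: elements of $\mathcal E^+$ concentrated on $E$. Interior capacity $C(E)=1/\inf\{\kappa(\nu,\nu):\nu\in\mathcal E^+_E,\nu(E)=1\}$; "n.e." = outside a set of interior capacity zero. For closed $F$ with $C(F)>0$ and $\nu\in\mathcal E$, $P_F\nu$ is the unique $\omega\in\mathcal E^+_F$ minimizing $\|\nu-\omega\|$ (orthogonal projection onto the convex cone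 $\mathcal E^+_F$). Condenser: disjoint countable index sets $I^+,I^-$, $I=I^+\cup I^-$; nonempty closed $A_i$, locally finite family, $A_i\cap A_j=\varnothing$ for $i\in I^+,j\in I^-$; $\alpha_i=\pm1$ for $i\in I^\pm$; $A^\pm=\bigcup_{I^\pm}A_i$, $A=\bigcup_IA_i$; $\sup_{A^+\times A^-}\kappa<\infty$. Vector measures $\boldsymbol\mu=(\mu^i)$, $\mu^i\ge0$ concentrated on $A_i$; $R\boldsymbol\mu=\sum\alpha_i\mu^i$; $\mathcal E^+(\boldsymbol A)$ those with finite energy $\sum_{i,j}\alpha_i\alpha_j\kappa(\mu^i,\mu^j)$. External field: bounded signed $\chi\in\mathcal E$ with $S(\chi^+)\cap A^-=\varnothing$, $S(\chi^-)\cap A^+=\varnothing$; $G_\chi(\boldsymbol\mu)=\|R\boldsymbol\mu\|^2+2\kappa(\chi,R\boldsymbol\mu)$. $g$ continuous on $A$ with $\inf_Ag>0$, and for each $i$ either $g|_{A_i}$ bounded or $g^{r_i}\le\kappa(\cdot,\nu_i)$ n.e. on $A_i$ for some $r_i>1$, $\nu_i\in\mathcal E$. An admissible vector is $\boldsymbol a=(a_i)_{i\in I}$ with $a_i>0$, $\sum_ia_i<\infty$ and $G_\chi(\boldsymbol A,\boldsymbol a,g)<\infty$. For $I^+\subseteq J\subseteq I$: $\mathcal E^+(\boldsymbol A,\boldsymbol a,g,J)=\{\boldsymbol\mu\in\mathcal E^+(\boldsymbol A):\int g\,d\mu^i=a_i\ \forall i\in J\}$, $G_\chi(\boldsymbol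 A,\boldsymbol a,g,J)$ = infimum of $G_\chi$ over it; the $(\boldsymbol A,\boldsymbol a,g,\chi,J)$-problem asks for a minimizer in this class; for $J=I$ it is the Gauss variational problem and $J$ is dropped from notation. *)

theory Defs
  imports "HOL-Analysis.Analysis"
begin

text \<open>Positive Radon measures, represented as Borel measures in the sense of
  the Riesz representation theorem: locally finite, outer regular on Borel sets,
  inner regular (by compact sets) on open sets.\<close>

definition radon :: "'a::topological_space measure \<Rightarrow> bool" where
  "radon \<nu> \<longleftrightarrow> sets \<nu> = sets borel
     \<and> (\<forall>K. compact K \<longrightarrow> emeasure \<nu> K < \<infinity>)
     \<and> (\<forall>B\<in>sets borel. emeasure \<nu> B = (INF U\<in>{U. open U \<and> B \<subseteq> U}. emeasure \<nu> U))
     \<and> (\<forall>U. open U \<longrightarrow> emeasure \<nu> U = (SUP K\<in>{K. compact K \<and> K \<subseteq> U}. emeasure \<nu> K))"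

definition supp :: "'a::topological_space measure \<Rightarrow> 'a set" where
  "supp \<nu> = UNIV - \<Union>{U. open U \<and> emeasure \<nu> U = 0}"

text \<open>A (positive) measure concentrated on a set E (E need not be Borel).\<close>
definition conc :: "'a::topological_space measure \<Rightarrow> 'a set \<Rightarrow> bool" where
  "conc \<nu> E \<longleftrightarrow> (\<exists>B\<in>sets borel. B \<subseteq> E \<and> emeasure \<nu> (UNIV - B) = 0)"

definition msingular :: "'a::topological_space measure \<Rightarrow> 'a measure \<Rightarrow> bool" where
  "msingular p n \<longleftrightarrow> (\<exists>B\<in>sets borel. emeasure p (UNIV - B) = 0 \<and> emeasure n B = 0)"

definition msum :: "'i set \<Rightarrow> ('i \<Rightarrow> 'a::topological_space measure) \<Rightarrow> 'a measure" where
  "msum I \<mu> = measure_of UNIV (sets borel) (\<lambda>B. \<Sum>\<^sub>\<infinity> i\<in>I. emeasure (\<mu> i) B)"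

definition madd :: "'a::topological_space measure \<Rightarrow> 'a measure \<Rightarrow> 'a measure" where
  "madd M N = measure_of UNIV (sets borel) (\<lambda>B. emeasure M B + emeasure N B)"

definition Cc :: "('a::topological_space \<Rightarrow> real) set" where
  "Cc = {\<phi>. continuous_on UNIV \<phi> \<and> compact (closure {x. \<phi> x \<noteq> 0})}"

type_synonym 'a kernel = "'a \<Rightarrow> 'a \<Rightarrow> ennreal"

definition pot :: "'a kernel \<Rightarrow> 'a::topological_space measure \<Rightarrow> 'a \<Rightarrow> ennreal" where
  "pot \<kappa> \<nu> x = (\<integral>\<^sup>+ y. \<kappa> x y \<partial>\<nu>)"

definition kint :: "'a kernel \<Rightarrow> 'a::topological_space measure \<Rightarrow> 'a measure \<Rightarrow> ennreal" where
  "kint \<kappa> \<mu> \<nu> = (\<integral>\<^sup>+ x. pot \<kappa> \<nu> x \<partial>\<mu>)"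

text \<open>Signed measures are represented by pairs \<open>(p, n)\<close> standing for \<open>p - n\<close>.
  For signed measures proper we use Jordan pairs (radon, mutually singular).\<close>
type_synonym 'a smeasure = "'a measure \<times> 'a measure"

definition finen :: "'a kernel \<Rightarrow> 'a::topological_space smeasure \<Rightarrow> bool" where
  "finen \<kappa> \<nu> \<longleftrightarrow> kint \<kappa> (fst \<nu>) (fst \<nu>) < \<infinity> \<and> kint \<kappa> (snd \<nu>) (snd \<nu>) < \<infinity>
      \<and> kint \<kappa> (fst \<nu>) (snd \<nu>) < \<infinity> \<and> kint \<kappa> (snd \<nu>) (fst \<nu>) < \<infinity>"

definition ip :: "'a kernel \<Rightarrow> 'a::topological_space smeasure \<Rightarrow> 'a smeasure \<Rightarrow> real" where
  "ip \<kappa> \<nu> \<nu>' = enn2real (kint \<kappa> (fst \<nu>) (fst \<nu>')) - enn2real (kint \<kappa> (fst \<nu>) (snd \<nu>'))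
      - enn2real (kint \<kappa> (snd \<nu>) (fst \<nu>')) + enn2real (kint \<kappa> (snd \<nu>) (snd \<nu>'))"

definition nrm :: "'a kernel \<Rightarrow> 'a::topological_space smeasure \<Rightarrow> real" where
  "nrm \<kappa> \<nu> = sqrt (ip \<kappa> \<nu> \<nu>)"

definition inE :: "'a kernel \<Rightarrow> 'a::topological_space smeasure \<Rightarrow> bool" where
  "inE \<kappa> \<nu> \<longleftrightarrow> radon (fst \<nu>) \<and> radon (snd \<nu>) \<and> msingular (fst \<nu>) (snd \<nu>) \<and> finen \<kappa> \<nu>"

definition inEp :: "'a kernel \<Rightarrow> 'a::topological_space measure \<Rightarrow> bool" where
  "inEp \<kappa> \<nu> \<longleftrightarrow> radon \<nu> \<and> kint \<kappa> \<nu> \<nu> < \<infinity>"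

definition cap :: "'a kernel \<Rightarrow> 'a::topological_space set \<Rightarrow> ennreal" where
  "cap \<kappa> E = inverse (INF \<nu>\<in>{\<nu>. inEp \<kappa> \<nu> \<and> conc \<nu> E \<and> emeasure \<nu> UNIV = 1}. kint \<kappa> \<nu> \<nu>)"

definition nearly_everywhere :: "'a kernel \<Rightarrow> 'a::topological_space set \<Rightarrow> ('a \<Rightarrow> bool) \<Rightarrow> bool" where
  "nearly_everywhere \<kappa> E P \<longleftrightarrow> (\<exists>N. cap \<kappa> N = 0 \<and> (\<forall>x\<in>E - N. P x))"

text \<open>Orthogonal projection \<open>P\<^sub>F \<nu>\<close> onto the cone \<open>\<E>\<^sup>+\<^sub>F\<close>:
  \<open>\<nu> - \<omega>\<close> is represented by the pair \<open>(\<nu>\<^sup>+, \<nu>\<^sup>- + \<omega>)\<close>.\<close>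
definition proj :: "'a kernel \<Rightarrow> 'a::topological_space set \<Rightarrow> 'a smeasure \<Rightarrow> 'a measure" where
  "proj \<kappa> F \<nu> = (THE \<omega>. inEp \<kappa> \<omega> \<and> conc \<omega> F \<and>
      (\<forall>\<omega>'. inEp \<kappa> \<omega>' \<and> conc \<omega>' F \<longrightarrow>
          nrm \<kappa> (fst \<nu>, madd (snd \<nu>) \<omega>) \<le> nrm \<kappa> (fst \<nu>, madd (snd \<nu>) \<omega>')))"

definition kernel_basic :: "'a::topological_space kernel \<Rightarrow> bool" where
  "kernel_basic \<kappa> \<longleftrightarrow> (\<forall>x y. \<kappa> x y = \<kappa> y x)
     \<and> (\<forall>c. open {z. c < \<kappa> (fst z) (snd z)})"

definition kernel_spd :: "'a::topological_space kernel \<Rightarrow> bool" where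
  "kernel_spd \<kappa> \<longleftrightarrow> (\<forall>\<nu>. inE \<kappa> \<nu> \<longrightarrow> 0 \<le> ip \<kappa> \<nu> \<nu>
       \<and> (ip \<kappa> \<nu> \<nu> = 0 \<longrightarrow> emeasure (fst \<nu>) UNIV = 0 \<and> emeasure (snd \<nu>) UNIV = 0))"

text \<open>Vague cluster points of a net, the net being encoded by its image filter.\<close>
definition vague_cluster :: "'a::topological_space measure filter \<Rightarrow> 'a measure \<Rightarrow> bool" where
  "vague_cluster G \<nu> \<longleftrightarrow> (\<forall>\<Phi> e. finite \<Phi> \<and> \<Phi> \<subseteq> Cc \<and> e > 0 \<longrightarrow>
      (\<exists>\<^sub>F \<mu> in G. \<forall>\<phi>\<in>\<Phi>. \<bar>integral\<^sup>L \<mu> \<phi> - integral\<^sup>L \<nu> \<phi>\<bar> < e))"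

definition kernel_consistent :: "'a::topological_space kernel \<Rightarrow> bool" where
  "kernel_consistent \<kappa> \<longleftrightarrow> (\<forall>G::'a measure filter.
      (\<forall>\<^sub>F \<mu> in G. inEp \<kappa> \<mu>) \<and>
      (\<forall>e>0. \<forall>\<^sub>F z in G \<times>\<^sub>F G. nrm \<kappa> (fst z, snd z) < e) \<longrightarrow>
      (\<forall>\<nu>. radon \<nu> \<and> vague_cluster G \<nu> \<longrightarrow>
          inEp \<kappa> \<nu> \<and> (\<forall>e>0. \<forall>\<^sub>F \<mu> in G. nrm \<kappa> (\<mu>, \<nu>) < e)))"

definition kernel_offdiag :: "'a::topological_space kernel \<Rightarrow> bool" where
  "kernel_offdiag \<kappa> \<longleftrightarrow> (\<forall>x y. x \<noteq> y \<longrightarrow> \<kappa> x y < \<infinity>)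
     \<and> continuous_on {z. fst z \<noteq> snd z} (\<lambda>z. \<kappa> (fst z) (snd z))"

definition kernel_vanishing :: "'a::topological_space kernel \<Rightarrow> bool" where
  "kernel_vanishing \<kappa> \<longleftrightarrow> (\<forall>e::real. e > 0 \<longrightarrow> (\<forall>K. compact K \<longrightarrow>
      (\<exists>K'. compact K' \<and> (\<forall>x\<in>K. \<forall>y. y \<notin> K' \<longrightarrow> \<kappa> x y < ennreal e))))"

definition kernel_gmp :: "'a::topological_space kernel \<Rightarrow> real \<Rightarrow> bool" where
  "kernel_gmp \<kappa> h \<longleftrightarrow> (\<forall>\<nu>. radon \<nu> \<and> compact (supp \<nu>)
      \<and> (SUP x\<in>supp \<nu>. pot \<kappa> \<nu> x) < \<infinity> \<longrightarrow>
      (\<forall>x. pot \<kappa> \<nu> x \<le> ennreal h * (SUP x\<in>supp \<nu>. pot \<kappa> \<nu> x)))"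

definition condenser :: "'a::topological_space kernel \<Rightarrow> 'i set \<Rightarrow> 'i set \<Rightarrow> ('i \<Rightarrow> 'a set) \<Rightarrow> bool" where
  "condenser \<kappa> Ip In A \<longleftrightarrow> countable Ip \<and> countable In \<and> Ip \<inter> In = {}
     \<and> (\<forall>i\<in>Ip \<union> In. A i \<noteq> {} \<and> closed (A i))
     \<and> (\<forall>x. \<exists>U. open U \<and> x \<in> U \<and> finite {i\<in>Ip \<union> In. A i \<inter> U \<noteq> {}})
     \<and> (\<forall>i\<in>Ip. \<forall>j\<in>In. A i \<inter> A j = {})
     \<and> (\<exists>M::real. \<forall>x\<in>(\<Union>i\<in>Ip. A i). \<forall>y\<in>(\<Union>j\<in>In. A j). \<kappa> x y \<le> ennreal M)"

text \<open>\<open>R\<mu> = \<Sum>\<^sub>i \<alpha>\<^sub>i \<mu>\<^sup>i\<close>, as the pair (positive part, negative part).\<close>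
definition Rm :: "'i set \<Rightarrow> 'i set \<Rightarrow> ('i \<Rightarrow> 'a::topological_space measure) \<Rightarrow> 'a smeasure" where
  "Rm Ip In \<mu> = (msum Ip \<mu>, msum In \<mu>)"

definition EA :: "'a::topological_space kernel \<Rightarrow> 'i set \<Rightarrow> 'i set \<Rightarrow> ('i \<Rightarrow> 'a set)
     \<Rightarrow> ('i \<Rightarrow> 'a measure) \<Rightarrow> bool" where
  "EA \<kappa> Ip In A \<mu> \<longleftrightarrow> (\<forall>i\<in>Ip \<union> In. radon (\<mu> i) \<and> conc (\<mu> i) (A i)) \<and> inE \<kappa> (Rm Ip In \<mu>)"

definition ext_field :: "'a::topological_space kernel \<Rightarrow> 'i set \<Rightarrow> 'i set \<Rightarrow> ('i \<Rightarrow> 'a set)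
     \<Rightarrow> 'a smeasure \<Rightarrow> bool" where
  "ext_field \<kappa> Ip In A ch \<longleftrightarrow> inE \<kappa> ch
     \<and> emeasure (fst ch) UNIV < \<infinity> \<and> emeasure (snd ch) UNIV < \<infinity>
     \<and> supp (fst ch) \<inter> (\<Union>j\<in>In. A j) = {} \<and> supp (snd ch) \<inter> (\<Union>i\<in>Ip. A i) = {}"

definition Gchi :: "'a::topological_space kernel \<Rightarrow> 'i set \<Rightarrow> 'i set \<Rightarrow> 'a smeasure
     \<Rightarrow> ('i \<Rightarrow> 'a measure) \<Rightarrow> real" where
  "Gchi \<kappa> Ip In ch \<mu> = (nrm \<kappa> (Rm Ip In \<mu>))\<^sup>2 + 2 * ip \<kappa> ch (Rm Ip In \<mu>)"

definition g_ok :: "'a::topological_space kernel \<Rightarrow> 'i set \<Rightarrow> ('i \<Rightarrow> 'a set) \<Rightarrow> ('a \<Rightarrow> real) \<Rightarrow> bool" where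
  "g_ok \<kappa> I A g \<longleftrightarrow> continuous_on (\<Union>i\<in>I. A i) g
     \<and> (\<exists>c>0. \<forall>x\<in>(\<Union>i\<in>I. A i). c \<le> g x)
     \<and> (\<forall>i\<in>I. (\<exists>B. \<forall>x\<in>A i. g x \<le> B)
           \<or> (\<exists>r>1. \<exists>\<nu>. inE \<kappa> \<nu> \<and> nearly_everywhere \<kappa> (A i)
                (\<lambda>x. pot \<kappa> (snd \<nu>) x < \<infinity> \<and>
                     ennreal (g x powr r) + pot \<kappa> (snd \<nu>) x \<le> pot \<kappa> (fst \<nu>) x)))"

definition EAag :: "'a::topological_space kernel \<Rightarrow> 'i set \<Rightarrow> 'i set \<Rightarrow> ('i \<Rightarrow> 'a set)
     \<Rightarrow> ('i \<Rightarrow> real) \<Rightarrow> ('a \<Rightarrow> real) \<Rightarrow> 'i set \<Rightarrow> ('i \<Rightarrow> 'a measure) \<Rightarrow> bool" where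
  "EAag \<kappa> Ip In A a g J \<mu> \<longleftrightarrow> EA \<kappa> Ip In A \<mu>
     \<and> (\<forall>i\<in>J. (\<integral>\<^sup>+ x. ennreal (g x) * indicator (A i) x \<partial>(\<mu> i)) = ennreal (a i))"

definition Ginf :: "'a::topological_space kernel \<Rightarrow> 'i set \<Rightarrow> 'i set \<Rightarrow> ('i \<Rightarrow> 'a set)
     \<Rightarrow> ('i \<Rightarrow> real) \<Rightarrow> ('a \<Rightarrow> real) \<Rightarrow> 'a smeasure \<Rightarrow> 'i set \<Rightarrow> ereal" where
  "Ginf \<kappa> Ip In A a g ch J = (INF \<mu>\<in>{\<mu>. EAag \<kappa> Ip In A a g J \<mu>}. ereal (Gchi \<kappa> Ip In ch \<mu>))"

definition solves :: "'a::topological_space kernel \<Rightarrow> 'i set \<Rightarrow> 'i set \<Rightarrow> ('i \<Rightarrow> 'a set)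
     \<Rightarrow> ('i \<Rightarrow> real) \<Rightarrow> ('a \<Rightarrow> real) \<Rightarrow> 'a smeasure \<Rightarrow> 'i set \<Rightarrow> ('i \<Rightarrow> 'a measure) \<Rightarrow> bool" where
  "solves \<kappa> Ip In A a g ch J lam \<longleftrightarrow> EAag \<kappa> Ip In A a g J lam
     \<and> ereal (Gchi \<kappa> Ip In ch lam) = Ginf \<kappa> Ip In A a g ch J"

definition admissible :: "'a::topological_space kernel \<Rightarrow> 'i set \<Rightarrow> 'i set \<Rightarrow> ('i \<Rightarrow> 'a set)
     \<Rightarrow> ('a \<Rightarrow> real) \<Rightarrow> 'a smeasure \<Rightarrow> ('i \<Rightarrow> real) \<Rightarrow> bool" where
  "admissible \<kappa> Ip In A g ch a \<longleftrightarrow> (\<forall>i\<in>Ip \<union> In. a i > 0) \<and> a summable_on (Ip \<union> In)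
     \<and> Ginf \<kappa> Ip In A a g ch (Ip \<union> In) < \<infinity>"

end

theory Submission
  imports Defs "HOL-Probability.Giry_Monad"
begin

text \<open>
  Write \<open>G(\<mu>) = \<parallel>R\<mu> + \<chi>\<parallel>\<^sup>2 - \<parallel>\<chi>\<parallel>\<^sup>2\<close>; this is strictly convex in \<open>R\<mu>\<close>, so all minimizers over a given
  class have the same \<open>R\<mu>\<close>, and hence the same component on \<open>A\<^sub>l\<close>, because \<open>A\<^sub>l\<close> is disjoint from the
  other plates. Since \<open>A\<^sub>l\<close> has infinite capacity, weight can be added on it at arbitrarily small cost in
  energy; therefore the infima under \<open>\<integral>g d\<mu>\<^sup>l = a\<^sub>l\<close> and under \<open>\<integral>g d\<mu>\<^sup>l \<le> a\<^sub>l\<close> coincide. The relaxed problem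
  has a minimizer \<open>\<mu>\<close>: a vague cluster point of a minimizing sequence is also a strong limit by
  consistency, and plates of finite capacity lose no weight at infinity. If \<open>\<integral>g d\<mu>\<^sup>l < a\<^sub>l\<close>, the constraint is
  inactive, so by convexity \<open>\<mu>\<close> solves the problem without a constraint on \<open>A\<^sub>l\<close>, and then
  \<open>\<mu>\<^sup>l = \<lambda>\<^sup>l\<close> has weight below \<open>a\<^sub>l\<close>. Finally, fixing the other components, minimality of \<open>\<lambda>\<close> says
  exactly that \<open>\<lambda>\<^sup>l\<close> is the projection in the second inequality.
\<close>

subsection \<open>Integrals of lower semicontinuous functions\<close>

definition dyadic_levels :: "nat \<Rightarrow> ennreal \<Rightarrow> nat set" where
  "dyadic_levels n y = {k \<in> {1..n * 2 ^ n}. ennreal (real k / 2 ^ n) < y}"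

definition dyadic_layers :: "nat \<Rightarrow> ennreal \<Rightarrow> ennreal" where
  "dyadic_layers n y = (\<Sum>k\<in>{1..n * 2 ^ n}. ennreal (1 / 2 ^ n) * indicator {ennreal (real k / 2 ^ n)<..} y)"

lemma finite_dyadic_levels: "finite (dyadic_levels n y)"
  by (simp add: dyadic_levels_def)

lemma dyadic_layers_eq_card: "dyadic_layers n y = ennreal (real (card (dyadic_levels n y)) / 2 ^ n)"
proof -
  have "dyadic_layers n y = (\<Sum>k\<in>dyadic_levels n y. ennreal (1 / 2 ^ n))"
    unfolding dyadic_layers_def dyadic_levels_def
    by (intro sum.mono_neutral_cong_right) (auto simp: indicator_def)
  also have "\<dots> = ennreal (real (card (dyadic_levels n y)) / 2 ^ n)"
    by (simp add: ennreal_of_nat_eq_real_of_nat ennreal_mult[symmetric])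
  finally show ?thesis .
qed

lemma dyadic_layers_le: "dyadic_layers n y \<le> y"
proof (cases "dyadic_levels n y = {}")
  case False
  let ?S = "dyadic_levels n y"
  have max_in: "Max ?S \<in> ?S" using finite_dyadic_levels False by (rule Max_in)
  have "?S \<subseteq> {1..Max ?S}" using finite_dyadic_levels by (auto simp: dyadic_levels_def)
  then have "card ?S \<le> Max ?S" using card_mono[of "{1..Max ?S}" ?S] by simp
  then have "dyadic_layers n y \<le> ennreal (real (Max ?S) / 2 ^ n)"
    unfolding dyadic_layers_eq_card by (intro ennreal_leI divide_right_mono) auto
  also have "\<dots> \<le> y" using max_in by (auto simp: dyadic_levels_def)
  finally show ?thesis .
qed (simp add: dyadic_layers_eq_card)

lemma min_le_dyadic_layers: "min y (ennreal (real n)) \<le> dyadic_layers n y + ennreal (1 / 2 ^ n)"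
proof (rule ccontr)
  define m where "m = Suc (card (dyadic_levels n y))"
  have layers: "dyadic_layers n y + ennreal (1 / 2 ^ n) = ennreal (real m / 2 ^ n)"
    unfolding dyadic_layers_eq_card m_def
    by (subst ennreal_plus[symmetric]) (auto simp: add_divide_distrib)
  assume "\<not> ?thesis"
  then have below_y: "ennreal (real m / 2 ^ n) < y"
    and below_n: "ennreal (real m / 2 ^ n) < ennreal (real n)"
    unfolding layers by (auto simp: not_le)
  from below_n have "real m / 2 ^ n < real n" by (simp add: ennreal_less_iff)
  then have "real m < real (n * 2 ^ n)" by (simp add: field_simps)
  then have m_le: "m \<le> n * 2 ^ n" using of_nat_less_iff less_imp_le by blast
  have "{1..m} \<subseteq> dyadic_levels n y"
  proof
    fix k assume k: "k \<in> {1..m}"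
    then have "real k / 2 ^ n \<le> real m / 2 ^ n" by (intro divide_right_mono) auto
    then have "ennreal (real k / 2 ^ n) < y"
      using below_y by (meson ennreal_leI le_less_trans)
    then show "k \<in> dyadic_levels n y" using k m_le by (auto simp: dyadic_levels_def)
  qed
  from card_mono[OF finite_dyadic_levels this] show False by (simp add: m_def)
qed

lemma le_liminf_dyadic_layers: "y \<le> liminf (\<lambda>n. dyadic_layers n y)"
proof (subst le_Liminf_iff, intro allI impI)
  fix c assume "c < y"
  then obtain c' where c': "c < c'" "c' < y" using dense by blast
  then have "c < top" "c' < top" using le_less_trans top_greatest by (auto simp: less_top[symmetric])
  then obtain r r' where r: "c = ennreal r" "0 \<le> r" and r': "c' = ennreal r'" "0 \<le> r'"
    by (cases c; cases c') auto
  have "r < r'" using c' r r' by (simp add: ennreal_less_iff)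
  have "(\<lambda>n. 1 / 2 ^ n :: real) \<longlonglongrightarrow> 0"
    using LIMSEQ_realpow_zero[of "1/2::real"] by (simp add: power_divide)
  then have "\<forall>\<^sub>F n in sequentially. 1 / 2 ^ n < r' - r"
    by (rule order_tendstoD) (use \<open>r < r'\<close> in simp)
  moreover have "\<forall>\<^sub>F n in sequentially. r' \<le> real n"
    using real_arch_simple[of r'] by (meson eventually_sequentiallyI of_nat_le_iff order_trans)
  ultimately show "\<forall>\<^sub>F n in sequentially. c < dyadic_layers n y"
  proof eventually_elim
    case (elim n)
    have "c + ennreal (1 / 2 ^ n) < c'"
      unfolding r(1) r'(1) using elim r(2) \<open>r < r'\<close>
      by (subst ennreal_plus[symmetric]) (auto simp del: ennreal_plus intro!: ennreal_lessI)
    also have "c' \<le> min y (ennreal (real n))"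
      using c' elim r' by (auto intro: ennreal_leI)
    also have "\<dots> \<le> dyadic_layers n y + ennreal (1 / 2 ^ n)"
      by (rule min_le_dyadic_layers)
    finally show ?case
      by (meson add_right_mono leD leI)
  qed
qed

lemma dyadic_layers_measurable[measurable]: "dyadic_layers n \<in> borel_measurable borel"
  unfolding dyadic_layers_def by measurable

lemma nn_integral_dyadic_layers:
  assumes [measurable]: "f \<in> borel_measurable M"
  shows "(\<integral>\<^sup>+ x. dyadic_layers n (f x) \<partial>M) =
    (\<Sum>k\<in>{1..n * 2 ^ n}. ennreal (1 / 2 ^ n) * emeasure M {x\<in>space M. ennreal (real k / 2 ^ n) < f x})"
proof -
  have "(\<integral>\<^sup>+ x. dyadic_layers n (f x) \<partial>M) = (\<integral>\<^sup>+ x. (\<Sum>k\<in>{1..n * 2 ^ n}. ennreal (1 / 2 ^ n) *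
      indicator {x\<in>space M. ennreal (real k / 2 ^ n) < f x} x) \<partial>M)"
    unfolding dyadic_layers_def by (intro nn_integral_cong sum.cong) (auto simp: indicator_def)
  also have "\<dots>
      = (\<Sum>k\<in>{1..n * 2 ^ n}. ennreal (1 / 2 ^ n) * emeasure M {x\<in>space M. ennreal (real k / 2 ^ n) < f x})"
    by (subst nn_integral_sum) (auto intro!: sum.cong nn_integral_cmult_indicator)
  finally show ?thesis .
qed

lemma sum_SUP_directed_ennreal:
  fixes w :: "'i \<Rightarrow> 'k \<Rightarrow> ennreal"
  assumes "finite F" and D: "D \<noteq> {}"
    and directed: "\<And>i j. i \<in> D \<Longrightarrow> j \<in> D \<Longrightarrow> \<exists>k\<in>D. \<forall>x\<in>F. w i x \<le> w k x \<and> w j x \<le> w k x"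
  shows "(\<Sum>x\<in>F. SUP i\<in>D. w i x) = (SUP i\<in>D. \<Sum>x\<in>F. w i x)"
  using assms(1) directed
proof (induction F)
  case empty
  then show ?case using D by simp
next
  case (insert a F)
  have "(SUP i\<in>D. w i a + (\<Sum>x\<in>F. w i x)) = (SUP i\<in>D. w i a) + (SUP i\<in>D. \<Sum>x\<in>F. w i x)"
  proof (rule SUP_add_directed_ennreal)
    fix i j assume "i \<in> D" "j \<in> D"
    then obtain k where "k \<in> D" "\<forall>x\<in>insert a F. w i x \<le> w k x \<and> w j x \<le> w k x"
      using insert.prems by blast
    then show "\<exists>k\<in>D. w i a + (\<Sum>x\<in>F. w j x) \<le> w k a + (\<Sum>x\<in>F. w k x)"
      by (intro bexI[of _ k] add_mono sum_mono) auto
  qed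
  moreover have "(\<Sum>x\<in>F. SUP i\<in>D. w i x) = (SUP i\<in>D. \<Sum>x\<in>F. w i x)"
    using insert.prems by (intro insert.IH) blast
  ultimately show ?case using insert.hyps by simp
qed

lemma nn_integral_le_SUP_superlevel:
  fixes f :: "'a \<Rightarrow> ennreal" and h :: "'i \<Rightarrow> 'a \<Rightarrow> ennreal"
  assumes f[measurable]: "f \<in> borel_measurable M" and h: "\<And>i. i \<in> D \<Longrightarrow> h i \<in> borel_measurable M"
    and D: "D \<noteq> {}"
    and directed: "\<And>i j. i \<in> D \<Longrightarrow> j \<in> D \<Longrightarrow> \<exists>k\<in>D. h i \<le> h k \<and> h j \<le> h k"
    and superlevel: "\<And>c. c < top \<Longrightarrow>
      emeasure M {x\<in>space M. c < f x} \<le> (SUP i\<in>D. emeasure M {x\<in>space M. c < h i x})"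
  shows "(\<integral>\<^sup>+ x. f x \<partial>M) \<le> (SUP i\<in>D. \<integral>\<^sup>+ x. h i x \<partial>M)"
proof -
  have layers_le: "(\<integral>\<^sup>+ x. dyadic_layers n (f x) \<partial>M) \<le> (SUP i\<in>D. \<integral>\<^sup>+ x. h i x \<partial>M)" for n
  proof -
    let ?F = "{1..n * 2 ^ n}"
    let ?w = "\<lambda>i k. ennreal (1 / 2 ^ n) * emeasure M {x\<in>space M. ennreal (real k / 2 ^ n) < h i x}"
    have "(\<integral>\<^sup>+ x. dyadic_layers n (f x) \<partial>M) \<le> (\<Sum>k\<in>?F. SUP i\<in>D. ?w i k)"
      unfolding nn_integral_dyadic_layers[OF f]
      by (intro sum_mono) (auto simp: SUP_mult_left_ennreal[symmetric] intro!: mult_left_mono superlevel)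
    also have "\<dots> = (SUP i\<in>D. \<Sum>k\<in>?F. ?w i k)"
    proof (rule sum_SUP_directed_ennreal)
      fix i j assume "i \<in> D" "j \<in> D"
      then obtain k where k: "k \<in> D" "h i \<le> h k" "h j \<le> h k" using directed by blast
      have "?w i' x \<le> ?w k x" if "h i' \<le> h k" for i' x
        using that h[OF k(1)]
        by (intro mult_left_mono emeasure_mono) (auto simp: le_fun_def intro: less_le_trans)
      with k show "\<exists>k\<in>D. \<forall>x\<in>?F. ?w i x \<le> ?w k x \<and> ?w j x \<le> ?w k x" by blast
    qed (use D in auto)
    also have "\<dots> = (SUP i\<in>D. \<integral>\<^sup>+ x. dyadic_layers n (h i x) \<partial>M)"
      by (intro SUP_cong refl) (simp only: nn_integral_dyadic_layers h)
    also have "\<dots> \<le> (SUP i\<in>D. \<integral>\<^sup>+ x. h i x \<partial>M)"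
      by (intro SUP_mono) (auto intro!: nn_integral_mono dyadic_layers_le)
    finally show ?thesis .
  qed
  have "(\<integral>\<^sup>+ x. f x \<partial>M) \<le> (\<integral>\<^sup>+ x. liminf (\<lambda>n. dyadic_layers n (f x)) \<partial>M)"
    by (intro nn_integral_mono le_liminf_dyadic_layers)
  also have "\<dots> \<le> liminf (\<lambda>n. \<integral>\<^sup>+ x. dyadic_layers n (f x) \<partial>M)"
    by (intro nn_integral_liminf) measurable
  also have "\<dots> \<le> liminf (\<lambda>n. SUP i\<in>D. \<integral>\<^sup>+ x. h i x \<partial>M)"
    by (intro Liminf_mono always_eventually allI layers_le)
  also have "\<dots> = (SUP i\<in>D. \<integral>\<^sup>+ x. h i x \<partial>M)"
    by (simp add: Liminf_const)
  finally show ?thesis .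
qed

definition lsc :: "('a::topological_space \<Rightarrow> ennreal) \<Rightarrow> bool" where
  "lsc f \<longleftrightarrow> (\<forall>c. open {x. c < f x})"

lemma lsc_open: "lsc f \<Longrightarrow> open {x. c < f x}"
  by (simp add: lsc_def)

lemma borel_measurable_lsc: "lsc f \<Longrightarrow> f \<in> borel_measurable borel"
  unfolding lsc_def by (intro borel_measurableI_greater) auto

lemma lsc_SUP:
  assumes "\<And>i. i \<in> D \<Longrightarrow> lsc (f i)" shows "lsc (\<lambda>x. SUP i\<in>D. f i x)"
  unfolding lsc_def
proof
  fix c
  have "{x. c < (SUP i\<in>D. f i x)} = (\<Union>i\<in>D. {x. c < f i x})" by (auto simp: less_SUP_iff)
  then show "open {x. c < (SUP i\<in>D. f i x)}" using assms by (auto simp: lsc_def)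
qed

lemma lsc_cmult_indicator:
  assumes "open V" shows "lsc (\<lambda>y. c * indicator V y)"
  unfolding lsc_def
proof
  fix e
  have "{y. e < c * indicator V y} = (if e < c then V else {})"
    by (auto simp: indicator_def)
  then show "open {y. e < c * indicator V y}" using assms by simp
qed

lemma sets_radon: "radon \<nu> \<Longrightarrow> sets \<nu> = sets borel"
  by (simp add: radon_def)

lemma space_radon: "radon \<nu> \<Longrightarrow> space \<nu> = UNIV"
  using sets_eq_imp_space_eq[OF sets_radon] by simp

lemma borel_measurable_cong_sets:
  "sets M = sets borel \<Longrightarrow> f \<in> borel_measurable borel \<Longrightarrow> f \<in> borel_measurable M"
  using measurable_cong_sets by blast

lemma borel_measurable_radon: "radon \<nu> \<Longrightarrow> f \<in> borel_measurable borel \<Longrightarrow> f \<in> borel_measurable \<nu>"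
  by (rule borel_measurable_cong_sets[OF sets_radon])

lemma emeasure_radon_compact: "radon \<nu> \<Longrightarrow> compact K \<Longrightarrow> emeasure \<nu> K < \<infinity>"
  by (simp add: radon_def)

lemma radon_outer_regular: "radon \<nu> \<Longrightarrow> B \<in> sets borel \<Longrightarrow>
    emeasure \<nu> B = (INF U\<in>{U. open U \<and> B \<subseteq> U}. emeasure \<nu> U)"
  unfolding radon_def by blast

lemma radon_inner_regular: "radon \<nu> \<Longrightarrow> open U \<Longrightarrow>
    emeasure \<nu> U = (SUP K\<in>{K. compact K \<and> K \<subseteq> U}. emeasure \<nu> K)"
  unfolding radon_def by blast

lemma nn_integral_lsc_le_SUP:
  fixes f :: "'a::t2_space \<Rightarrow> ennreal"
  assumes \<nu>: "radon \<nu>" and f: "lsc f" and D: "D \<noteq> {}"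
    and h: "\<And>i. i \<in> D \<Longrightarrow> h i \<in> borel_measurable borel"
    and directed: "\<And>i j. i \<in> D \<Longrightarrow> j \<in> D \<Longrightarrow> \<exists>k\<in>D. h i \<le> h k \<and> h j \<le> h k"
    and exhausts: "\<And>c K. c < top \<Longrightarrow> compact K \<Longrightarrow> K \<subseteq> {x. c < f x} \<Longrightarrow> \<exists>i\<in>D. K \<subseteq> {x. c < h i x}"
  shows "(\<integral>\<^sup>+ x. f x \<partial>\<nu>) \<le> (SUP i\<in>D. \<integral>\<^sup>+ x. h i x \<partial>\<nu>)"
proof (rule nn_integral_le_SUP_superlevel[OF _ _ D directed])
  show "f \<in> borel_measurable \<nu>" by (intro borel_measurable_radon[OF \<nu>] borel_measurable_lsc f)
  show "h i \<in> borel_measurable \<nu>" if "i \<in> D" for i by (intro borel_measurable_radon[OF \<nu>] h that)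
  fix c :: ennreal assume "c < top"
  have "emeasure \<nu> K \<le> (SUP i\<in>D. emeasure \<nu> {x. c < h i x})"
    if K: "compact K" "K \<subseteq> {x. c < f x}" for K
  proof -
    obtain i where i: "i \<in> D" "K \<subseteq> {x. c < h i x}" using exhausts[OF \<open>c < top\<close> K] by blast
    have "{x\<in>space borel. c < h i x} \<in> sets borel" using h[OF i(1)] by measurable
    then have "emeasure \<nu> K \<le> emeasure \<nu> {x. c < h i x}"
      using i(2) by (intro emeasure_mono) (auto simp: sets_radon[OF \<nu>])
    then show ?thesis using i(1) by (rule SUP_upper2[rotated])
  qed
  then have "emeasure \<nu> {x. c < f x} \<le> (SUP i\<in>D. emeasure \<nu> {x. c < h i x})"
    by (subst radon_inner_regular[OF \<nu> lsc_open[OF f]]) (auto intro: SUP_least)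
  then show "emeasure \<nu> {x\<in>space \<nu>. c < f x} \<le> (SUP i\<in>D. emeasure \<nu> {x\<in>space \<nu>. c < h i x})"
    by (simp add: space_radon[OF \<nu>])
qed

lemma compact_subset_directed_Union:
  assumes "compact K" "K \<subseteq> (\<Union>i\<in>D. U i)" "D \<noteq> {}" and "\<And>i. i \<in> D \<Longrightarrow> open (U i)"
    and directed: "\<And>i j. i \<in> D \<Longrightarrow> j \<in> D \<Longrightarrow> \<exists>k\<in>D. U i \<subseteq> U k \<and> U j \<subseteq> U k"
  shows "\<exists>k\<in>D. K \<subseteq> U k"
proof -
  obtain C where C: "C \<subseteq> D" "finite C" "K \<subseteq> (\<Union>i\<in>C. U i)"
    using compactE_image[OF assms(1) assms(4) assms(2)] by blast
  have "\<exists>k\<in>D. (\<Union>i\<in>C. U i) \<subseteq> U k"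
    using C(2,1)
  proof (induction C)
    case (insert i C)
    then obtain j where "j \<in> D" "(\<Union>i\<in>C. U i) \<subseteq> U j" by auto
    moreover obtain k where "k \<in> D" "U i \<subseteq> U k" "U j \<subseteq> U k"
      using directed[of i j] insert.prems \<open>j \<in> D\<close> by auto
    ultimately show ?case by (intro bexI[of _ k]) auto
  qed (use \<open>D \<noteq> {}\<close> in auto)
  then show ?thesis using C(3) by blast
qed

lemma nn_integral_SUP_lsc_directed:
  fixes f :: "'i \<Rightarrow> 'a::t2_space \<Rightarrow> ennreal"
  assumes \<nu>: "radon \<nu>" and D: "D \<noteq> {}" and lsc: "\<And>i. i \<in> D \<Longrightarrow> lsc (f i)"
    and directed: "\<And>i j. i \<in> D \<Longrightarrow> j \<in> D \<Longrightarrow> \<exists>k\<in>D. f i \<le> f k \<and> f j \<le> f k"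
  shows "(\<integral>\<^sup>+ x. (SUP i\<in>D. f i x) \<partial>\<nu>) = (SUP i\<in>D. \<integral>\<^sup>+ x. f i x \<partial>\<nu>)"
proof (rule antisym)
  show "(\<integral>\<^sup>+ x. (SUP i\<in>D. f i x) \<partial>\<nu>) \<le> (SUP i\<in>D. \<integral>\<^sup>+ x. f i x \<partial>\<nu>)"
  proof (rule nn_integral_lsc_le_SUP[OF \<nu> lsc_SUP[OF lsc] D borel_measurable_lsc[OF lsc] directed])
    fix c K assume K: "compact K" "K \<subseteq> {x. c < (SUP i\<in>D. f i x)}"
    show "\<exists>i\<in>D. K \<subseteq> {x. c < f i x}"
    proof (rule compact_subset_directed_Union[OF K(1) _ D lsc_open[OF lsc]])
      show "K \<subseteq> (\<Union>i\<in>D. {x. c < f i x})" using K(2) by (auto simp: less_SUP_iff)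
      fix i j assume "i \<in> D" "j \<in> D"
      then obtain k where "k \<in> D" "f i \<le> f k" "f j \<le> f k" using directed by blast
      then show "\<exists>k\<in>D. {x. c < f i x} \<subseteq> {x. c < f k x} \<and> {x. c < f j x} \<subseteq> {x. c < f k x}"
        by (intro bexI[of _ k]) (auto simp: le_fun_def intro: less_le_trans)
    qed
  qed
  show "(SUP i\<in>D. \<integral>\<^sup>+ x. f i x \<partial>\<nu>) \<le> (\<integral>\<^sup>+ x. (SUP i\<in>D. f i x) \<partial>\<nu>)"
    by (intro SUP_least nn_integral_mono SUP_upper)
qed

lemma nn_integral_lsc_compact_exhaustion:
  fixes f :: "'a::t2_space \<Rightarrow> ennreal"
  assumes \<nu>: "radon \<nu>" and f: "lsc f"
  shows "(\<integral>\<^sup>+ x. f x \<partial>\<nu>) = (SUP K\<in>{K. compact K}. \<integral>\<^sup>+ x. indicator K x * f x \<partial>\<nu>)"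
proof (rule antisym)
  show "(\<integral>\<^sup>+ x. f x \<partial>\<nu>) \<le> (SUP K\<in>{K. compact K}. \<integral>\<^sup>+ x. indicator K x * f x \<partial>\<nu>)"
  proof (rule nn_integral_lsc_le_SUP[OF \<nu> f])
    show "(\<lambda>x. indicator K x * f x) \<in> borel_measurable borel" if "K \<in> {K. compact K}" for K
      using that
      by (intro borel_measurable_times_ennreal borel_measurable_lsc[OF f])
        (auto intro: borel_measurable_indicator borel_compact)
    fix K L :: "'a set" assume "K \<in> {K. compact K}" "L \<in> {K. compact K}"
    then show "\<exists>M\<in>{K. compact K}. (\<lambda>x. indicator K x * f x) \<le> (\<lambda>x. indicator M x * f x) \<and>
        (\<lambda>x. indicator L x * f x) \<le> (\<lambda>x. indicator M x * f x)"
      by (intro bexI[of _ "K \<union> L"]) (auto simp: le_fun_def indicator_def compact_Un)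
  next
    fix c and K :: "'a set" assume "compact K" "K \<subseteq> {x. c < f x}"
    then show "\<exists>L\<in>{K. compact K}. K \<subseteq> {x. c < indicator L x * f x}"
      by (intro bexI[of _ K]) auto
  qed auto
  show "(SUP K\<in>{K. compact K}. \<integral>\<^sup>+ x. indicator K x * f x \<partial>\<nu>) \<le> (\<integral>\<^sup>+ x. f x \<partial>\<nu>)"
    by (intro SUP_least nn_integral_mono) (auto simp: indicator_def)
qed

subsection \<open>Sums, multiples and restrictions of Radon measures\<close>

lemma infsum_ennreal_SUP:
  fixes f :: "'i \<Rightarrow> ennreal" shows "infsum f I = (SUP F\<in>{F. finite F \<and> F \<subseteq> I}. sum f F)"
  by (rule nonneg_infsum_complete) simp

lemma infsum_cmult_ennreal: "(\<Sum>\<^sub>\<infinity>i\<in>I. (c::ennreal) * f i) = c * (\<Sum>\<^sub>\<infinity>i\<in>I. f i)"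
  unfolding infsum_ennreal_SUP by (simp add: SUP_mult_left_ennreal sum_distrib_left)

lemma infsum_SUP_ennreal:
  fixes f :: "nat \<Rightarrow> 'i \<Rightarrow> ennreal"
  assumes "\<And>i. i \<in> I \<Longrightarrow> incseq (\<lambda>n. f n i)"
  shows "(\<Sum>\<^sub>\<infinity>i\<in>I. SUP n. f n i) = (SUP n. \<Sum>\<^sub>\<infinity>i\<in>I. f n i)"
proof -
  have "(\<Sum>\<^sub>\<infinity>i\<in>I. SUP n. f n i) = (SUP F\<in>{F. finite F \<and> F \<subseteq> I}. SUP n. \<Sum>i\<in>F. f n i)"
    unfolding infsum_ennreal_SUP
  proof (intro SUP_cong refl sum_SUP_directed_ennreal)
    fix F m n assume "F \<in> {F. finite F \<and> F \<subseteq> I}"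
    then show "\<exists>k\<in>UNIV. \<forall>i\<in>F. f m i \<le> f k i \<and> f n i \<le> f k i"
      using assms by (intro bexI[of _ "max m n"]) (auto simp: mono_def)
  qed auto
  also have "\<dots> = (SUP n. \<Sum>\<^sub>\<infinity>i\<in>I. f n i)"
    unfolding infsum_ennreal_SUP by (rule SUP_commute)
  finally show ?thesis .
qed

lemma infsum_finite_support:
  fixes f :: "'i \<Rightarrow> ennreal"
  assumes "finite F" "F \<subseteq> I" "\<And>i. i \<in> I - F \<Longrightarrow> f i = 0"
  shows "infsum f I = sum f F"
proof -
  have "infsum f I = infsum f F" using assms by (intro infsum_cong_neutral) auto
  then show ?thesis using assms(1) by simp
qed

lemma suminf_half_powers: "e \<ge> 0 \<Longrightarrow> (\<Sum>n. ennreal (e * (1/2) ^ Suc n)) = ennreal e"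
  using sums_mult[OF power_half_series, of e] by (intro suminf_ennreal_eq) auto

lemma countable_positive_weights:
  assumes I: "countable I" and e: "e > 0"
  obtains w :: "'i \<Rightarrow> real" where "\<And>i. w i > 0" "(\<Sum>\<^sub>\<infinity>i\<in>I. ennreal (w i)) \<le> ennreal e"
proof
  let ?w = "\<lambda>i. e * (1/2) ^ Suc (to_nat_on I i)"
  show "?w i > 0" for i using e by simp
  show "(\<Sum>\<^sub>\<infinity>i\<in>I. ennreal (?w i)) \<le> ennreal e"
    unfolding infsum_ennreal_SUP
  proof (rule SUP_least, clarify)
    fix F assume F: "finite F" "F \<subseteq> I"
    have "inj_on (to_nat_on I) F" using I F inj_on_to_nat_on inj_on_subset by blast
    then have "(\<Sum>i\<in>F. ennreal (?w i)) = (\<Sum>n\<in>to_nat_on I ` F. ennreal (e * (1/2) ^ Suc n))"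
      by (simp only: sum.reindex o_def)
    also have "\<dots> \<le> (\<Sum>n. ennreal (e * (1/2) ^ Suc n))" using F by (intro sum_le_suminf) auto
    also have "\<dots> = ennreal e" using e by (intro suminf_half_powers) simp
    finally show "(\<Sum>i\<in>F. ennreal (?w i)) \<le> ennreal e" .
  qed
qed

lemma sets_msum[simp]: "sets (msum I \<mu>) = sets borel"
  unfolding msum_def using sets.sigma_sets_eq[of borel] by (simp add: sets_measure_of_conv)

lemma emeasure_msum:
  fixes \<mu> :: "'i \<Rightarrow> 'a::topological_space measure"
  assumes "\<And>i. i \<in> I \<Longrightarrow> sets (\<mu> i) = sets borel"
  shows "emeasure (msum I \<mu>) B = (\<Sum>\<^sub>\<infinity>i\<in>I. emeasure (\<mu> i) B)"
proof (cases "B \<in> sets borel")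
  case True
  have "countably_additive (sets borel) (\<lambda>B. \<Sum>\<^sub>\<infinity>i\<in>I. emeasure (\<mu> i) B)"
  proof (rule countably_additiveI)
    fix A :: "nat \<Rightarrow> 'a set" assume A: "range A \<subseteq> sets borel" "disjoint_family A"
    have "(\<Sum>n. \<Sum>\<^sub>\<infinity>i\<in>I. emeasure (\<mu> i) (A n))
        = (SUP F\<in>{F. finite F \<and> F \<subseteq> I}. \<Sum>n. \<Sum>i\<in>F. emeasure (\<mu> i) (A n))"
      unfolding infsum_ennreal_SUP
    proof (rule ennreal_suminf_SUP_eq_directed)
      fix F G assume "F \<in> {F. finite F \<and> F \<subseteq> I}" "G \<in> {F. finite F \<and> F \<subseteq> I}"
      then show "\<exists>H\<in>{F. finite F \<and> F \<subseteq> I}. \<forall>n\<in>N. (\<Sum>i\<in>F. emeasure (\<mu> i) (A n))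
          \<le> (\<Sum>i\<in>H. emeasure (\<mu> i) (A n)) \<and>
          (\<Sum>i\<in>G. emeasure (\<mu> i) (A n)) \<le> (\<Sum>i\<in>H. emeasure (\<mu> i) (A n))" for N
        by (intro bexI[of _ "F \<union> G"]) (auto intro!: sum_mono2)
    qed
    also have "\<dots> = (SUP F\<in>{F. finite F \<and> F \<subseteq> I}. \<Sum>i\<in>F. emeasure (\<mu> i) (\<Union> (range A)))"
    proof (intro SUP_cong refl)
      fix F assume F: "F \<in> {F. finite F \<and> F \<subseteq> I}"
      have "(\<Sum>n. \<Sum>i\<in>F. emeasure (\<mu> i) (A n)) = (\<Sum>i\<in>F. \<Sum>n. emeasure (\<mu> i) (A n))"
        by (rule suminf_sum) simp
      also have "\<dots> = (\<Sum>i\<in>F. emeasure (\<mu> i) (\<Union> (range A)))"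
        using F A assms by (intro sum.cong refl suminf_emeasure) auto
      finally show "(\<Sum>n. \<Sum>i\<in>F. emeasure (\<mu> i) (A n)) = (\<Sum>i\<in>F. emeasure (\<mu> i) (\<Union> (range A)))" .
    qed
    finally show "(\<Sum>n. \<Sum>\<^sub>\<infinity>i\<in>I. emeasure (\<mu> i) (A n)) = (\<Sum>\<^sub>\<infinity>i\<in>I. emeasure (\<mu> i) (\<Union> (range A)))"
      unfolding infsum_ennreal_SUP .
  qed
  then show ?thesis
    unfolding msum_def using True sets.sigma_algebra_axioms[of borel]
    by (subst emeasure_measure_of_sigma) (auto simp: positive_def)
next
  case False
  then show ?thesis using assms by (simp add: emeasure_notin_sets cong: infsum_cong)
qed

lemma nn_integral_msum:
  assumes sets: "\<And>i. i \<in> I \<Longrightarrow> sets (\<mu> i) = sets borel" and f: "f \<in> borel_measurable borel"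
  shows "(\<integral>\<^sup>+ x. f x \<partial>msum I \<mu>) = (\<Sum>\<^sub>\<infinity>i\<in>I. \<integral>\<^sup>+ x. f x \<partial>(\<mu> i))"
  using f
proof (induction rule: borel_measurable_induct)
  case (cong f g)
  then have "f = g" by auto
  then show ?case using cong by simp
next
  case (set B)
  then show ?case using sets by (simp add: emeasure_msum cong: infsum_cong)
next
  case (mult u c)
  have "i \<in> I \<Longrightarrow> u \<in> borel_measurable (\<mu> i)" "u \<in> borel_measurable (msum I \<mu>)" for i
    using sets mult.hyps by (auto intro: borel_measurable_cong_sets)
  then show ?case using mult by (simp add: nn_integral_cmult infsum_cmult_ennreal cong: infsum_cong)
next
  case (add u v)
  have "i \<in> I \<Longrightarrow> w \<in> borel_measurable (\<mu> i)" "w \<in> borel_measurable (msum I \<mu>)"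
    if "w \<in> {u, v}" for w i
    using that sets add.hyps by (auto intro: borel_measurable_cong_sets)
  then show ?case
    using add.IH by (simp add: nn_integral_add infsum_add nonneg_summable_on_complete cong: infsum_cong)
next
  case (seq U)
  have meas: "j \<in> I \<Longrightarrow> U n \<in> borel_measurable (\<mu> j)" "U n \<in> borel_measurable (msum I \<mu>)" for n j
    using sets seq.hyps(1)[of n] by (auto intro: borel_measurable_cong_sets)
  have "(\<integral>\<^sup>+ x. (SUP n. U n x) \<partial>msum I \<mu>) = (SUP n. \<Sum>\<^sub>\<infinity>i\<in>I. \<integral>\<^sup>+ x. U n x \<partial>(\<mu> i))"
    using meas seq by (simp add: nn_integral_monotone_convergence_SUP)
  also have "\<dots> = (\<Sum>\<^sub>\<infinity>i\<in>I. SUP n. \<integral>\<^sup>+ x. U n x \<partial>(\<mu> i))"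
    using seq.hyps
    by (intro infsum_SUP_ennreal[symmetric]) (auto simp: mono_def le_fun_def intro!: nn_integral_mono)
  also have "\<dots> = (\<Sum>\<^sub>\<infinity>i\<in>I. \<integral>\<^sup>+ x. (SUP n. U n x) \<partial>(\<mu> i))"
    using meas seq.hyps by (intro infsum_cong) (simp add: nn_integral_monotone_convergence_SUP)
  finally show ?case by (simp add: image_comp)
qed

lemma madd_eq_msum: "madd M N = msum UNIV (\<lambda>b. if b then M else N)"
  unfolding madd_def msum_def by (simp add: UNIV_bool add.commute)

lemma sets_madd[simp]: "sets (madd M N) = sets borel"
  by (simp add: madd_eq_msum)

lemma emeasure_madd:
  assumes "sets M = sets borel" "sets N = sets borel"
  shows "emeasure (madd M N) B = emeasure M B + emeasure N B"
  unfolding madd_eq_msum using assms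
  by (subst emeasure_msum) (auto simp: UNIV_bool add.commute)

lemma nn_integral_madd:
  assumes "sets M = sets borel" "sets N = sets borel" "f \<in> borel_measurable borel"
  shows "(\<integral>\<^sup>+ x. f x \<partial>madd M N) = (\<integral>\<^sup>+ x. f x \<partial>M) + (\<integral>\<^sup>+ x. f x \<partial>N)"
  unfolding madd_eq_msum using assms
  by (subst nn_integral_msum) (auto simp: UNIV_bool add.commute)

lemma madd_commute: "madd M N = madd N M"
  by (simp add: madd_def add.commute)

lemma madd_assoc:
  assumes "sets M = sets borel" "sets N = sets borel" "sets L = sets borel"
  shows "madd (madd M N) L = madd M (madd N L)"
  using assms by (intro measure_eqI) (auto simp: emeasure_madd add.assoc)

lemma msum_cong: "(\<And>i. i \<in> S \<Longrightarrow> \<mu> i = \<nu> i) \<Longrightarrow> msum S \<mu> = msum S \<nu>"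
  unfolding msum_def by (simp cong: infsum_cong)

lemma msum_remove:
  assumes i: "i \<in> S" and sets: "\<And>j. j \<in> S \<Longrightarrow> sets (\<mu> j) = sets borel"
  shows "msum S \<mu> = madd (msum (S - {i}) \<mu>) (\<mu> i)"
proof (rule measure_eqI)
  fix B
  have "(\<Sum>\<^sub>\<infinity>j\<in>insert i (S - {i}). emeasure (\<mu> j) B) = emeasure (\<mu> i) B + (\<Sum>\<^sub>\<infinity>j\<in>S - {i}. emeasure (\<mu> j) B)"
    by (intro infsum_insert nonneg_summable_on_complete) auto
  then show "emeasure (msum S \<mu>) B = emeasure (madd (msum (S - {i}) \<mu>) (\<mu> i)) B"
    using i sets emeasure_msum[of "S - {i}" \<mu> B]
    by (simp add: emeasure_msum emeasure_madd insert_absorb add.commute)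
qed simp

lemma msum_update:
  assumes "i \<in> S" "\<And>j. j \<in> S \<Longrightarrow> sets (\<mu> j) = sets borel" "sets \<omega> = sets borel"
  shows "msum S (\<mu>(i := \<omega>)) = madd (msum (S - {i}) \<mu>) \<omega>"
proof -
  have "msum S (\<mu>(i := \<omega>)) = madd (msum (S - {i}) (\<mu>(i := \<omega>))) ((\<mu>(i := \<omega>)) i)"
    using assms by (intro msum_remove) auto
  also have "msum (S - {i}) (\<mu>(i := \<omega>)) = msum (S - {i}) \<mu>" by (rule msum_cong) auto
  finally show ?thesis by (simp add: fun_upd_def)
qed

abbreviation restr :: "'a::topological_space set \<Rightarrow> 'a measure \<Rightarrow> 'a measure" where
  "restr B \<nu> \<equiv> density \<nu> (indicator B)"

lemma emeasure_restr:
  assumes "sets \<nu> = sets borel" "B \<in> sets borel" "E \<in> sets borel"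
  shows "emeasure (restr B \<nu>) E = emeasure \<nu> (B \<inter> E)"
  using assms by (simp add: emeasure_density indicator_inter_arith[symmetric])

lemma emeasure_restr_le:
  assumes "sets \<nu> = sets borel" "B \<in> sets borel" "E \<in> sets borel"
  shows "emeasure (restr B \<nu>) E \<le> emeasure \<nu> E"
  using assms by (simp add: emeasure_restr emeasure_mono)

lemma nn_integral_restr:
  assumes "sets \<nu> = sets borel" "B \<in> sets borel" "f \<in> borel_measurable borel"
  shows "(\<integral>\<^sup>+ x. f x \<partial>restr B \<nu>) = (\<integral>\<^sup>+ x. indicator B x * f x \<partial>\<nu>)"
  using assms by (subst nn_integral_density) (auto intro: borel_measurable_cong_sets)

lemma restr_Un:
  assumes "sets \<nu> = sets borel" "B \<in> sets borel" "C \<in> sets borel" "B \<inter> C = {}"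
  shows "restr (B \<union> C) \<nu> = madd (restr B \<nu>) (restr C \<nu>)"
proof (rule measure_eqI)
  fix E assume "E \<in> sets (restr (B \<union> C) \<nu>)"
  then have E: "E \<in> sets borel" using assms(1) by simp
  have "emeasure \<nu> ((B \<union> C) \<inter> E) = emeasure \<nu> (B \<inter> E) + emeasure \<nu> (C \<inter> E)"
    using assms E by (subst plus_emeasure) (auto simp: Int_Un_distrib2)
  then show "emeasure (restr (B \<union> C) \<nu>) E = emeasure (madd (restr B \<nu>) (restr C \<nu>)) E"
    using assms E by (simp add: emeasure_madd emeasure_restr)
qed (use assms in simp)

lemma radonI:
  assumes sets: "sets \<nu> = sets borel" and compact: "\<And>K. compact K \<Longrightarrow> emeasure \<nu> K < \<infinity>"
    and outer: "\<And>B e. B \<in> sets borel \<Longrightarrow> emeasure \<nu> B < \<infinity> \<Longrightarrow> e > 0 \<Longrightarrow>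
      \<exists>U. open U \<and> B \<subseteq> U \<and> emeasure \<nu> U \<le> emeasure \<nu> B + ennreal e"
    and inner: "\<And>U. open U \<Longrightarrow> emeasure \<nu> U \<le> (SUP K\<in>{K. compact K \<and> K \<subseteq> U}. emeasure \<nu> K)"
  shows "radon \<nu>"
  unfolding radon_def
proof (intro conjI ballI allI impI sets compact)
  fix B :: "'a set" assume B: "B \<in> sets borel"
  show "emeasure \<nu> B = (INF U\<in>{U. open U \<and> B \<subseteq> U}. emeasure \<nu> U)"
  proof (rule antisym)
    show "emeasure \<nu> B \<le> (INF U\<in>{U. open U \<and> B \<subseteq> U}. emeasure \<nu> U)"
      using sets by (intro INF_greatest emeasure_mono) auto
    show "(INF U\<in>{U. open U \<and> B \<subseteq> U}. emeasure \<nu> U) \<le> emeasure \<nu> B"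
    proof (rule ennreal_le_epsilon)
      fix e :: real assume "emeasure \<nu> B < top" "0 < e"
      then obtain U where "open U \<and> B \<subseteq> U \<and> emeasure \<nu> U \<le> emeasure \<nu> B + ennreal e"
        using outer[OF B] by auto
      then show "(INF U\<in>{U. open U \<and> B \<subseteq> U}. emeasure \<nu> U) \<le> emeasure \<nu> B + ennreal e"
        by (intro INF_lower2[of U]) auto
    qed
  qed
next
  fix U :: "'a set" assume U: "open U"
  show "emeasure \<nu> U = (SUP K\<in>{K. compact K \<and> K \<subseteq> U}. emeasure \<nu> K)"
    using inner[OF U] U sets by (intro antisym SUP_least emeasure_mono) auto
qed

lemma radon_outer_approx:
  assumes "radon \<nu>" "B \<in> sets borel" "emeasure \<nu> B < \<infinity>" "e > 0"
  obtains U where "open U" "B \<subseteq> U" "emeasure \<nu> U \<le> emeasure \<nu> B + ennreal e"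
  using INF_approx_ennreal[OF assms(4) radon_outer_regular[OF assms(1,2)]] assms(3) that
  by (auto simp: less_top intro: less_imp_le)

lemma radon_outer_approx_Diff:
  assumes \<nu>: "radon \<nu>" and B: "B \<in> sets borel" "emeasure \<nu> B < \<infinity>" and "e > 0"
  obtains U where "open U" "B \<subseteq> U" "emeasure \<nu> (U - B) \<le> ennreal e"
proof -
  obtain U where U: "open U" "B \<subseteq> U" "emeasure \<nu> U \<le> emeasure \<nu> B + ennreal e"
    by (rule radon_outer_approx[OF assms])
  have "emeasure \<nu> (U - B) = emeasure \<nu> U - emeasure \<nu> B"
    using U B by (intro emeasure_Diff) (auto simp: sets_radon[OF \<nu>])
  also have "\<dots> \<le> ennreal e"
    using U(3) B(2) by (auto simp: ennreal_minus_le_iff less_top)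
  finally show ?thesis using that U(1,2) by blast
qed

lemma radon_null_measure: "radon (null_measure (borel :: 'a::t2_space measure))"
  by (rule radonI) (auto intro!: exI[of _ UNIV])

lemma radon_scale:
  fixes \<nu> :: "'a::t2_space measure"
  assumes \<nu>: "radon \<nu>" and t: "t \<ge> 0" shows "radon (scale_measure (ennreal t) \<nu>)"
proof (rule radonI)
  show "emeasure (scale_measure (ennreal t) \<nu>) K < \<infinity>" if "compact K" for K
    using emeasure_radon_compact[OF \<nu> that] by (simp add: ennreal_mult_less_top)
  fix B :: "'a set" and e :: real
  assume B: "B \<in> sets borel" "emeasure (scale_measure (ennreal t) \<nu>) B < \<infinity>" and "e > 0"
  show "\<exists>U. open U \<and> B \<subseteq> U \<and> emeasure (scale_measure (ennreal t) \<nu>) U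
      \<le> emeasure (scale_measure (ennreal t) \<nu>) B + ennreal e"
  proof (cases "t = 0")
    case True then show ?thesis by (intro exI[of _ UNIV]) auto
  next
    case False
    then have "emeasure \<nu> B < \<infinity>" using B t by (auto simp: ennreal_mult_less_top)
    then obtain U where U: "open U" "B \<subseteq> U" "emeasure \<nu> U \<le> emeasure \<nu> B + ennreal (e/t)"
      using radon_outer_approx[OF \<nu> B(1), of "e/t"] \<open>e > 0\<close> False t by (metis divide_pos_pos less_le)
    have "ennreal t * emeasure \<nu> U \<le> ennreal t * (emeasure \<nu> B + ennreal (e/t))"
      using U by (intro mult_left_mono) auto
    also have "\<dots> = ennreal t * emeasure \<nu> B + ennreal e"
      using False t by (simp add: distrib_left ennreal_mult'[symmetric])
    finally show ?thesis using U by auto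
  qed
next
  fix U :: "'a set" assume U: "open U"
  show "emeasure (scale_measure (ennreal t) \<nu>) U
      \<le> (SUP K\<in>{K. compact K \<and> K \<subseteq> U}. emeasure (scale_measure (ennreal t) \<nu>) K)"
    using radon_inner_regular[OF \<nu> U] by (simp add: SUP_mult_left_ennreal)
qed (use sets_radon[OF \<nu>] in simp)

text \<open>A Borel measure dominated by a Radon measure need not be Radon: outside \<open>\<sigma>\<close>-compact sets, outer
  regularity allows Borel sets of infinite measure all of whose compact subsets are null.\<close>

definition moderated :: "'a::topological_space measure \<Rightarrow> bool" where
  "moderated \<nu> \<longleftrightarrow> (\<exists>K::nat \<Rightarrow> 'a set. (\<forall>n. compact (K n)) \<and> closed (\<Union>n. K n)
      \<and> emeasure \<nu> (UNIV - (\<Union>n. K n)) = 0)"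

lemma moderatedE:
  fixes \<nu> :: "'a::t2_space measure"
  assumes "moderated \<nu>"
  obtains K :: "nat \<Rightarrow> 'a set" where "\<And>n. compact (K n)" "\<And>n. K n \<in> sets borel"
    "closed (\<Union>n. K n)" "emeasure \<nu> (UNIV - (\<Union>n. K n)) = 0"
  using assms unfolding moderated_def by (metis borel_compact)

lemma radon_inner_compact:
  fixes \<nu> :: "'a::t2_space measure"
  assumes \<nu>: "radon \<nu>" and K: "compact K" and B: "B \<in> sets borel" "B \<subseteq> K" and e: "e > 0"
  obtains C where "compact C" "C \<subseteq> B" "emeasure \<nu> (B - C) \<le> ennreal e"
proof -
  note [simp] = sets_radon[OF \<nu>] and [measurable] = borel_compact[OF K] B(1)
  have "K - B \<in> sets borel" by measurable
  moreover have "emeasure \<nu> (K - B) \<le> emeasure \<nu> K" by (intro emeasure_mono) auto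
  then have "emeasure \<nu> (K - B) < \<infinity>" using emeasure_radon_compact[OF \<nu> K] by (rule le_less_trans)
  ultimately obtain W where W: "open W" "K - B \<subseteq> W" "emeasure \<nu> (W - (K - B)) \<le> ennreal e"
    using radon_outer_approx_Diff[OF \<nu> _ _ e] by metis
  have "emeasure \<nu> (B - (K - W)) \<le> emeasure \<nu> (W - (K - B))"
    using W B by (intro emeasure_mono) auto
  also note W(3)
  finally show ?thesis
    using that[of "K - W"] W(1,2) K B(2) by (auto simp: compact_diff)
qed

lemma radon_inner_sigma_compact:
  fixes \<nu> :: "'a::t2_space measure" and K :: "nat \<Rightarrow> 'a set"
  assumes \<nu>: "radon \<nu>" and K: "\<And>n. compact (K n)" and B: "B \<in> sets borel"
  shows "\<exists>C :: nat \<Rightarrow> 'a set. (\<forall>n. compact (C n)) \<and> incseq C \<and> (\<forall>n. C n \<subseteq> B) \<and>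
    emeasure \<nu> (B \<inter> (\<Union>n. K n) - (\<Union>n. C n)) = 0"
proof -
  note [simp] = sets_radon[OF \<nu>] and [measurable] = borel_compact[OF K] B
  have "\<exists>C. compact C \<and> C \<subseteq> B \<inter> K n \<and> emeasure \<nu> (B \<inter> K n - C) \<le> ennreal (1 / real (Suc k))" for n k
  proof -
    have "B \<inter> K n \<in> sets borel" by measurable
    moreover have "1 / real (Suc k) > 0" by simp
    ultimately show ?thesis using radon_inner_compact[OF \<nu> K] by (metis Int_lower2)
  qed
  then obtain C where C: "\<And>n k. compact (C n k)" "\<And>n k. C n k \<subseteq> B \<inter> K n"
      "\<And>n k. emeasure \<nu> (B \<inter> K n - C n k) \<le> ennreal (1 / real (Suc k))"
    by metis
  define D where "D j = (\<Union>n\<le>j. \<Union>k\<le>j. C n k)" for j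
  have compact_D: "compact (D j)" for j unfolding D_def using C by (intro compact_UN) auto
  note [measurable] = borel_compact[OF C(1)] borel_compact[OF compact_D]
  have C_subset: "C n k \<subseteq> (\<Union>j. D j)" for n k
    unfolding D_def using max.cobounded1[of n k] max.cobounded2[of k n] by blast
  have "emeasure \<nu> (B \<inter> K n - (\<Union>j. D j)) = 0" for n
  proof -
    have "emeasure \<nu> (B \<inter> K n - (\<Union>j. D j)) \<le> 0 + ennreal e" if "e > 0" for e
    proof -
      obtain k where k: "1 / real (Suc k) < e" using nat_approx_posE[OF \<open>e > 0\<close>] .
      have "emeasure \<nu> (B \<inter> K n - (\<Union>j. D j)) \<le> emeasure \<nu> (B \<inter> K n - C n k)"
        using C_subset[of n k] by (intro emeasure_mono) auto
      also have "\<dots> \<le> ennreal e" using C(3)[of n k] k by (meson ennreal_leI less_imp_le order_trans)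
      finally show ?thesis by simp
    qed
    then show ?thesis by (metis ennreal_le_epsilon le_zero_eq)
  qed
  then have "emeasure \<nu> (\<Union>n. B \<inter> K n - (\<Union>j. D j)) = 0"
    by (intro emeasure_UN_eq_0) auto
  then have "emeasure \<nu> (B \<inter> (\<Union>n. K n) - (\<Union>j. D j)) = 0"
    by (simp add: Int_UN_distrib UN_simps(6)[symmetric] del: UN_simps)
  moreover have "incseq D" unfolding D_def by (auto simp: mono_def intro: order_trans)
  moreover have "D j \<subseteq> B" for j unfolding D_def using C by blast
  ultimately show ?thesis using compact_D by blast
qed

lemma moderated_inner:
  fixes p \<nu> :: "'a::t2_space measure"
  assumes \<nu>: "radon \<nu>" and p: "moderated p" "sets p = sets borel"
    and dominated: "\<And>B. B \<in> sets borel \<Longrightarrow> emeasure p B \<le> emeasure \<nu> B" and B: "B \<in> sets borel"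
  obtains C :: "nat \<Rightarrow> 'a set" where "\<And>n. compact (C n)" "incseq C" "\<And>n. C n \<subseteq> B"
      "emeasure p (B - (\<Union>n. C n)) = 0"
proof -
  obtain K :: "nat \<Rightarrow> 'a set" where K: "\<And>n. compact (K n)" "emeasure p (UNIV - (\<Union>n. K n)) = 0"
    using p(1) by (auto simp: moderated_def)
  obtain C :: "nat \<Rightarrow> 'a set" where C: "\<And>n. compact (C n)" "incseq C" "\<And>n. C n \<subseteq> B"
    "emeasure \<nu> (B \<inter> (\<Union>n. K n) - (\<Union>n. C n)) = 0"
    using radon_inner_sigma_compact[where K = K, OF \<nu> K(1) B] by blast
  note [simp] = p(2) and [measurable] = borel_compact[OF K(1)] borel_compact[OF C(1)] B
  have "emeasure p (B \<inter> (\<Union>n. K n) - (\<Union>n. C n)) = 0"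
    using dominated[of "B \<inter> (\<Union>n. K n) - (\<Union>n. C n)"] C(4) by simp
  moreover have "emeasure p (B - (\<Union>n. K n)) = 0" using K(2) by (rule emeasure_eq_0[rotated]) auto
  ultimately have "emeasure p ((B \<inter> (\<Union>n. K n) - (\<Union>n. C n)) \<union> (B - (\<Union>n. K n))) = 0"
    by (subst emeasure_Un_null_set) (auto simp: null_sets_def)
  then have "emeasure p (B - (\<Union>n. C n)) = 0" by (rule emeasure_eq_0[rotated]) auto
  then show ?thesis using that C by blast
qed

lemma moderated_mono:
  fixes p \<nu> :: "'a::t2_space measure"
  assumes "moderated \<nu>" "\<And>B. B \<in> sets borel \<Longrightarrow> emeasure p B \<le> emeasure \<nu> B"
  shows "moderated p"
proof -
  obtain K :: "nat \<Rightarrow> 'a set" where K: "\<And>n. compact (K n)" "closed (\<Union>n. K n)"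
      "emeasure \<nu> (UNIV - (\<Union>n. K n)) = 0"
    using moderatedE[OF assms(1)] by metis
  have "UNIV - (\<Union>n. K n) \<in> sets borel" using K(2) by auto
  then have "emeasure p (UNIV - (\<Union>n. K n)) = 0" using assms(2) K(3) by (metis le_zero_eq)
  then show ?thesis using K unfolding moderated_def by blast
qed

lemma moderated_madd:
  fixes \<mu> \<nu> :: "'a::t2_space measure"
  assumes sets: "sets \<mu> = sets borel" "sets \<nu> = sets borel" and moderated: "moderated \<mu>" "moderated \<nu>"
  shows "moderated (madd \<mu> \<nu>)"
proof -
  obtain K :: "nat \<Rightarrow> 'a set" where K: "\<And>n. compact (K n)" "closed (\<Union>n. K n)"
      "emeasure \<mu> (UNIV - (\<Union>n. K n)) = 0"
    using moderatedE[OF moderated(1)] by metis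
  obtain L :: "nat \<Rightarrow> 'a set" where L: "\<And>n. compact (L n)" "closed (\<Union>n. L n)"
      "emeasure \<nu> (UNIV - (\<Union>n. L n)) = 0"
    using moderatedE[OF moderated(2)] by metis
  have Union_Un: "(\<Union>n. K n \<union> L n) = (\<Union>n. K n) \<union> (\<Union>n. L n)" by auto
  have "emeasure \<mu> (UNIV - (\<Union>n. K n \<union> L n)) = 0"
    using K(2) sets by (intro emeasure_eq_0[OF _ K(3)]) auto
  moreover have "emeasure \<nu> (UNIV - (\<Union>n. K n \<union> L n)) = 0"
    using L(2) sets by (intro emeasure_eq_0[OF _ L(3)]) auto
  ultimately have "emeasure (madd \<mu> \<nu>) (UNIV - (\<Union>n. K n \<union> L n)) = 0"
    by (simp add: emeasure_madd sets)
  then show ?thesis unfolding moderated_def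
    using K L by (intro exI[of _ "\<lambda>n. K n \<union> L n"]) (auto simp: Union_Un compact_Un)
qed

lemma moderated_dominated_outer:
  fixes p \<nu> :: "'a::t2_space measure"
  assumes \<nu>: "radon \<nu>" and p: "moderated p" "sets p = sets borel"
    and dominated: "\<And>B. B \<in> sets borel \<Longrightarrow> emeasure p B \<le> emeasure \<nu> B"
    and B: "B \<in> sets borel" and e: "e > 0"
  shows "\<exists>U. open U \<and> B \<subseteq> U \<and> emeasure p U \<le> emeasure p B + ennreal e"
proof -
  obtain K :: "nat \<Rightarrow> 'a set" where K: "\<And>n. compact (K n)" "closed (\<Union>n. K n)"
      "emeasure p (UNIV - (\<Union>n. K n)) = 0"
    using moderatedE[OF p(1)] by metis
  note [simp] = p(2) sets_radon[OF \<nu>] and [measurable] = borel_compact[OF K(1)] B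
  have "\<exists>U. open U \<and> B \<inter> K n \<subseteq> U \<and> emeasure \<nu> (U - B \<inter> K n) \<le> ennreal (e * (1/2) ^ Suc n)" for n
  proof -
    have "B \<inter> K n \<in> sets borel" by measurable
    moreover have "emeasure \<nu> (B \<inter> K n) < \<infinity>"
      using emeasure_radon_compact[OF \<nu> K(1)[of n]] emeasure_mono[of "B \<inter> K n" "K n" \<nu>]
      by (auto intro: le_less_trans)
    moreover have "e * (1/2) ^ Suc n > 0" using e by simp
    ultimately show ?thesis by (metis radon_outer_approx_Diff[OF \<nu>])
  qed
  then obtain U where U: "\<And>n. open (U n)" "\<And>n. B \<inter> K n \<subseteq> U n"
      "\<And>n. emeasure \<nu> (U n - B \<inter> K n) \<le> ennreal (e * (1/2) ^ Suc n)" by metis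
  note [measurable] = borel_open[OF U(1)]
  define V where "V = (\<Union>n. U n) \<union> (UNIV - (\<Union>n. K n))"
  have V: "open V" "B \<subseteq> V" using U(1,2) K(2) by (auto simp: V_def)
  have "emeasure p V \<le> emeasure p (B \<union> (UNIV - (\<Union>n. K n)) \<union> (\<Union>n. U n - B \<inter> K n))"
    by (intro emeasure_mono) (auto simp: V_def)
  also have "\<dots> \<le> emeasure p B + emeasure p (UNIV - (\<Union>n. K n)) + emeasure p (\<Union>n. U n - B \<inter> K n)"
    by (intro order_trans[OF emeasure_subadditive] add_right_mono emeasure_subadditive) auto
  also have "emeasure p (UNIV - (\<Union>n. K n)) = 0" by (rule K(3))
  also have "emeasure p (\<Union>n. U n - B \<inter> K n) \<le> (\<Sum>n. emeasure p (U n - B \<inter> K n))"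
    by (intro emeasure_subadditive_countably) auto
  also have "\<dots> \<le> (\<Sum>n. ennreal (e * (1/2) ^ Suc n))"
    by (intro suminf_le order_trans[OF dominated U(3)]) auto
  also have "\<dots> = ennreal e" using e by (simp only: suminf_half_powers less_imp_le)
  finally have "emeasure p V \<le> emeasure p B + ennreal e" by simp
  then show ?thesis using V by blast
qed

lemma radon_dominated:
  fixes p \<nu> :: "'a::t2_space measure"
  assumes \<nu>: "radon \<nu>" and p: "moderated p" "sets p = sets borel"
    and dominated: "\<And>B. B \<in> sets borel \<Longrightarrow> emeasure p B \<le> emeasure \<nu> B"
  shows "radon p"
proof (rule radonI[OF p(2)])
  show "emeasure p K < \<infinity>" if "compact K" for K
    using emeasure_radon_compact[OF \<nu> that] dominated[OF borel_compact[OF that]]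
    by (rule le_less_trans[rotated])
  show "\<exists>U. open U \<and> B \<subseteq> U \<and> emeasure p U \<le> emeasure p B + ennreal e"
    if "B \<in> sets borel" "e > 0" for B e
    using moderated_dominated_outer[OF assms that] .
  fix U :: "'a set" assume U: "open U"
  then obtain C :: "nat \<Rightarrow> 'a set" where C: "\<And>n. compact (C n)" "incseq C" "\<And>n. C n \<subseteq> U"
      "emeasure p (U - (\<Union>n. C n)) = 0"
    using moderated_inner[OF assms borel_open] by metis
  note [simp] = p(2) and [measurable] = borel_compact[OF C(1)] borel_open[OF U]
  have "emeasure p U = emeasure p ((\<Union>n. C n) \<union> (U - (\<Union>n. C n)))"
    using C(3) by (intro arg_cong[where f = "emeasure p"]) blast
  also have "\<dots> = emeasure p (\<Union>n. C n)"
    using C(4) by (intro emeasure_Un_null_set) (auto simp: null_sets_def)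
  also have "\<dots> = (SUP n. emeasure p (C n))"
    using C(2) by (intro SUP_emeasure_incseq[symmetric]) auto
  also have "\<dots> \<le> (SUP K\<in>{K. compact K \<and> K \<subseteq> U}. emeasure p K)"
    using C by (intro SUP_mono) auto
  finally show "emeasure p U \<le> (SUP K\<in>{K. compact K \<and> K \<subseteq> U}. emeasure p K)" .
qed

lemma moderated_restr:
  fixes \<nu> :: "'a::t2_space measure"
  assumes "sets \<nu> = sets borel" "moderated \<nu>" "B \<in> sets borel"
  shows "moderated (restr B \<nu>)"
  using moderated_mono[OF assms(2) emeasure_restr_le[OF assms(1,3)]] .

lemma radon_restr:
  fixes \<nu> :: "'a::t2_space measure"
  assumes \<nu>: "radon \<nu>" "moderated \<nu>" and B: "B \<in> sets borel"
  shows "radon (restr B \<nu>)"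
  using sets_radon[OF \<nu>(1)] B
  by (intro radon_dominated[OF \<nu>(1)] moderated_restr \<nu>(2) emeasure_restr_le) auto

lemma radon_restr_compact:
  fixes \<nu> :: "'a::t2_space measure"
  assumes \<nu>: "radon \<nu>" and K: "compact K"
  shows "radon (restr K \<nu>)"
proof (rule radon_dominated[OF \<nu>])
  note [simp] = sets_radon[OF \<nu>] and [measurable] = borel_compact[OF K]
  have "emeasure (restr K \<nu>) (UNIV - K) = 0" by (simp add: emeasure_restr)
  then show "moderated (restr K \<nu>)"
    unfolding moderated_def using K by (intro exI[of _ "\<lambda>_. K"]) (auto intro: compact_imp_closed)
  show "emeasure (restr K \<nu>) B \<le> emeasure \<nu> B" if "B \<in> sets borel" for B
    using that by (intro emeasure_restr_le) auto
qed (simp add: sets_radon[OF \<nu>])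

lemma conc_closed_iff:
  assumes "closed A" "sets \<nu> = sets borel"
  shows "conc \<nu> A \<longleftrightarrow> emeasure \<nu> (UNIV - A) = 0"
proof
  assume "conc \<nu> A"
  then obtain B where B: "B \<in> sets borel" "B \<subseteq> A" and null: "emeasure \<nu> (UNIV - B) = 0"
    unfolding conc_def by blast
  show "emeasure \<nu> (UNIV - A) = 0" using assms B by (intro emeasure_eq_0[OF _ null]) auto
qed (use assms in \<open>auto simp: conc_def\<close>)

lemma emeasure_Int_carrier:
  assumes "emeasure \<nu> (UNIV - A) = 0" "closed A" "sets \<nu> = sets borel" "B \<in> sets borel"
  shows "emeasure \<nu> (B \<inter> A) = emeasure \<nu> B"
proof -
  have "emeasure \<nu> (B - A) = 0" using assms by (intro emeasure_eq_0[OF _ assms(1)]) auto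
  then have "emeasure \<nu> ((B \<inter> A) \<union> (B - A)) = emeasure \<nu> (B \<inter> A)"
    using assms by (intro emeasure_Un_null_set) (auto simp: null_sets_def)
  then show ?thesis by (simp add: Un_Diff_Int sup_commute)
qed

lemma AE_carrier:
  assumes "emeasure \<nu> (UNIV - A) = 0" "closed A" "sets \<nu> = sets borel"
  shows "AE x in \<nu>. x \<in> A"
  using assms by (intro AE_I'[of "UNIV - A"]) (auto simp: null_sets_def)

subsection \<open>Locally finite families of Radon measures\<close>

definition loc_finite :: "'i set \<Rightarrow> ('i \<Rightarrow> 'a::topological_space set) \<Rightarrow> bool" where
  "loc_finite I A \<longleftrightarrow> (\<forall>x. \<exists>U. open U \<and> x \<in> U \<and> finite {i\<in>I. A i \<inter> U \<noteq> {}})"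

lemma loc_finite_subset:
  assumes "loc_finite I A" "J \<subseteq> I" "\<And>i. i \<in> J \<Longrightarrow> B i \<subseteq> A i" shows "loc_finite J B"
  unfolding loc_finite_def
proof
  fix x
  obtain U where U: "open U" "x \<in> U" "finite {i\<in>I. A i \<inter> U \<noteq> {}}"
    using assms(1) by (auto simp: loc_finite_def)
  have "{i\<in>J. B i \<inter> U \<noteq> {}} \<subseteq> {i\<in>I. A i \<inter> U \<noteq> {}}" using assms(2,3) by blast
  then show "\<exists>U. open U \<and> x \<in> U \<and> finite {i\<in>J. B i \<inter> U \<noteq> {}}" using U finite_subset by blast
qed

lemma loc_finite_closed_UN:
  assumes "loc_finite I A" "\<And>i. i \<in> I \<Longrightarrow> closed (A i)" shows "closed (\<Union>i\<in>I. A i)"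
proof -
  have "\<exists>T. open T \<and> x \<in> T \<and> T \<subseteq> - (\<Union>i\<in>I. A i)" if x: "x \<in> - (\<Union>i\<in>I. A i)" for x
  proof -
    obtain U where U: "open U" "x \<in> U" "finite {i\<in>I. A i \<inter> U \<noteq> {}}"
      using assms(1) by (auto simp: loc_finite_def)
    let ?T = "U - (\<Union>i\<in>{i\<in>I. A i \<inter> U \<noteq> {}}. A i)"
    have "open ?T" using U assms(2) by (intro open_Diff closed_UN) auto
    moreover have "x \<in> ?T" "?T \<subseteq> - (\<Union>i\<in>I. A i)" using x U by auto
    ultimately show ?thesis by blast
  qed
  then have "open (- (\<Union>i\<in>I. A i))" by (rule Topological_Spaces.openI)
  then show ?thesis by (simp add: closed_def)
qed

lemma loc_finite_compact:
  assumes "loc_finite I A" "compact K" shows "finite {i\<in>I. A i \<inter> K \<noteq> {}}"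
proof -
  have "\<exists>U. \<forall>x. open (U x) \<and> x \<in> U x \<and> finite {i\<in>I. A i \<inter> U x \<noteq> {}}"
    using assms(1) unfolding loc_finite_def by (rule choice)
  then obtain U where U: "\<And>x. open (U x)" "\<And>x. x \<in> U x" "\<And>x. finite {i\<in>I. A i \<inter> U x \<noteq> {}}"
    by blast
  obtain C where C: "C \<subseteq> K" "finite C" "K \<subseteq> (\<Union>x\<in>C. U x)"
    using compactE_image[OF assms(2), of K U] U by blast
  have "{i\<in>I. A i \<inter> K \<noteq> {}} \<subseteq> (\<Union>x\<in>C. {i\<in>I. A i \<inter> U x \<noteq> {}})" using C by blast
  then show ?thesis by (rule finite_subset) (use C U in auto)
qed

locale loc_finite_radon_family =
  fixes I :: "'i set" and A :: "'i \<Rightarrow> 'a::t2_space set" and \<mu> :: "'i \<Rightarrow> 'a measure"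
  assumes countable: "countable I" and loc_finite: "loc_finite I A"
    and closed: "\<And>i. i \<in> I \<Longrightarrow> closed (A i)" and radon: "\<And>i. i \<in> I \<Longrightarrow> radon (\<mu> i)"
    and carrier: "\<And>i. i \<in> I \<Longrightarrow> emeasure (\<mu> i) (UNIV - A i) = 0"
begin

lemma sets_family: "i \<in> I \<Longrightarrow> sets (\<mu> i) = sets borel"
  by (intro sets_radon radon)

lemma emeasure_msum_family: "emeasure (msum I \<mu>) B = (\<Sum>\<^sub>\<infinity>i\<in>I. emeasure (\<mu> i) B)"
  by (rule emeasure_msum[OF sets_family])

lemma emeasure_off_carrier:
  assumes "i \<in> I" "B \<inter> A i = {}" shows "emeasure (\<mu> i) B = 0"
  using assms closed[of i] sets_family[of i] by (intro emeasure_eq_0[OF _ carrier]) auto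

lemma emeasure_msum_carrier: "emeasure (msum I \<mu>) (UNIV - (\<Union>i\<in>I. A i)) = 0"
proof -
  have "emeasure (\<mu> i) (UNIV - (\<Union>i\<in>I. A i)) = 0" if "i \<in> I" for i
    using that by (intro emeasure_off_carrier) auto
  then show ?thesis by (simp add: emeasure_msum_family cong: infsum_cong)
qed

lemma emeasure_msum_disjoint:
  assumes "\<And>i. i \<in> I \<Longrightarrow> B \<inter> A i = {}" shows "emeasure (msum I \<mu>) B = 0"
  using assms by (simp add: emeasure_msum_family emeasure_off_carrier cong: infsum_cong)

lemma emeasure_msum_compact:
  assumes K: "compact K" shows "emeasure (msum I \<mu>) K < \<infinity>"
proof -
  let ?F = "{i\<in>I. A i \<inter> K \<noteq> {}}"
  have "emeasure (\<mu> i) K = 0" if "i \<in> I - ?F" for i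
    using that by (intro emeasure_off_carrier) auto
  then have "emeasure (msum I \<mu>) K = (\<Sum>i\<in>?F. emeasure (\<mu> i) K)"
    unfolding emeasure_msum_family by (intro infsum_finite_support loc_finite_compact[OF loc_finite K]) auto
  also have "\<dots> < \<infinity>"
    using emeasure_radon_compact[OF radon K] loc_finite_compact[OF loc_finite K]
    by (auto simp: less_top)
  finally show ?thesis .
qed

lemma emeasure_member_le: "i \<in> I \<Longrightarrow> emeasure (\<mu> i) B \<le> emeasure (msum I \<mu>) B"
  unfolding emeasure_msum_family infsum_ennreal_SUP by (intro SUP_upper2[of "{i}"]) auto

lemma msum_outer_approx:
  assumes B: "B \<in> sets borel" "emeasure (msum I \<mu>) B < \<infinity>" and e: "e > 0"
  shows "\<exists>V. open V \<and> B \<subseteq> V \<and> emeasure (msum I \<mu>) V \<le> emeasure (msum I \<mu>) B + ennreal e"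
proof -
  obtain w where w: "\<And>i. w i > 0" "(\<Sum>\<^sub>\<infinity>i\<in>I. ennreal (w i)) \<le> ennreal e"
    using countable_positive_weights[OF countable e] by metis
  have "\<exists>U. open U \<and> B \<subseteq> U \<and> emeasure (\<mu> i) U \<le> emeasure (\<mu> i) B + ennreal (w i)" if "i \<in> I" for i
    using radon_outer_approx[OF radon[OF that] B(1) _ w(1)] emeasure_member_le[OF that, of B] B(2)
    by (metis le_less_trans)
  then obtain U where U: "\<And>i. i \<in> I \<Longrightarrow> open (U i)" "\<And>i. i \<in> I \<Longrightarrow> B \<subseteq> U i"
     "\<And>i. i \<in> I \<Longrightarrow> emeasure (\<mu> i) (U i) \<le> emeasure (\<mu> i) B + ennreal (w i)" by metis
  define V where "V = UNIV - (\<Union>i\<in>I. A i - U i)"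
  have "closed (\<Union>i\<in>I. A i - U i)"
    using U closed by (intro loc_finite_closed_UN[OF loc_finite_subset[OF loc_finite]] closed_Diff) auto
  then have V: "open V" "B \<subseteq> V" using U by (auto simp: V_def)
  have V_le: "emeasure (\<mu> i) V \<le> emeasure (\<mu> i) B + ennreal (w i)" if "i \<in> I" for i
  proof -
    have "emeasure (\<mu> i) V = emeasure (\<mu> i) (V \<inter> A i)"
      using V closed sets_family carrier that by (intro emeasure_Int_carrier[symmetric]) auto
    also have "\<dots> \<le> emeasure (\<mu> i) (U i)"
      using that U sets_family by (intro emeasure_mono) (auto simp: V_def)
    finally show ?thesis using U(3)[OF that] by auto
  qed
  have "emeasure (msum I \<mu>) V \<le> (\<Sum>\<^sub>\<infinity>i\<in>I. emeasure (\<mu> i) B + ennreal (w i))"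
    unfolding emeasure_msum_family using V_le by (intro infsum_mono nonneg_summable_on_complete) auto
  also have "\<dots> = emeasure (msum I \<mu>) B + (\<Sum>\<^sub>\<infinity>i\<in>I. ennreal (w i))"
    by (simp add: emeasure_msum_family infsum_add nonneg_summable_on_complete)
  also have "\<dots> \<le> emeasure (msum I \<mu>) B + ennreal e" by (intro add_left_mono w)
  finally show ?thesis using V by blast
qed

lemma msum_inner_regular:
  assumes U: "open U"
  shows "emeasure (msum I \<mu>) U = (SUP K\<in>{K. compact K \<and> K \<subseteq> U}. emeasure (msum I \<mu>) K)"
proof -
  let ?D = "{K. compact K \<and> K \<subseteq> U}"
  have "emeasure (msum I \<mu>) U = (SUP F\<in>{F. finite F \<and> F \<subseteq> I}. \<Sum>i\<in>F. SUP K\<in>?D. emeasure (\<mu> i) K)"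
    using radon_inner_regular[OF radon U]
    by (auto simp: emeasure_msum_family infsum_ennreal_SUP intro!: SUP_cong sum.cong)
  also have "\<dots> = (SUP F\<in>{F. finite F \<and> F \<subseteq> I}. SUP K\<in>?D. \<Sum>i\<in>F. emeasure (\<mu> i) K)"
  proof (intro SUP_cong refl sum_SUP_directed_ennreal)
    fix F K L assume "F \<in> {F. finite F \<and> F \<subseteq> I}" "K \<in> ?D" "L \<in> ?D"
    then show "\<exists>M\<in>?D. \<forall>i\<in>F. emeasure (\<mu> i) K \<le> emeasure (\<mu> i) M \<and> emeasure (\<mu> i) L \<le> emeasure (\<mu> i) M"
      using sets_family
      by (intro bexI[of _ "K \<union> L"] ballI conjI emeasure_mono) (auto simp: compact_Un borel_compact)
  qed auto
  also have "\<dots> = (SUP K\<in>?D. emeasure (msum I \<mu>) K)"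
    by (subst SUP_commute) (simp add: emeasure_msum_family infsum_ennreal_SUP)
  finally show ?thesis .
qed

lemma radon_msum: "radon (msum I \<mu>)"
  using emeasure_msum_compact msum_outer_approx msum_inner_regular by (intro radonI) auto

end

lemma radon_madd:
  fixes \<mu> \<nu> :: "'a::t2_space measure"
  assumes "radon \<mu>" "radon \<nu>" shows "radon (madd \<mu> \<nu>)"
proof -
  interpret loc_finite_radon_family UNIV "\<lambda>_. UNIV" "\<lambda>b. if b then \<mu> else \<nu>"
    using assms by unfold_locales (auto simp: loc_finite_def intro: exI[of _ UNIV])
  show ?thesis using radon_msum by (simp add: madd_eq_msum)
qed

subsection \<open>Potentials and mutual energies\<close>

text \<open>Radon measures need not be \<open>\<sigma>\<close>-finite and \<open>\<kappa>\<close> need not be measurable for the product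
  \<open>\<sigma>\<close>-algebra, so Tonelli's theorem for \<open>\<kappa>\<close> is obtained by writing \<open>\<kappa>\<close> as the directed supremum of
  the finite maxima \<open>step_kernel D\<close> of multiples of indicators of open rectangles.\<close>

definition step_kernel :: "('a set \<times> 'a set \<times> ennreal) set \<Rightarrow> 'a \<Rightarrow> 'a \<Rightarrow> ennreal" where
  "step_kernel D x y = (SUP (U, V, c)\<in>D. c * indicator U x * indicator V y)"

definition minorants :: "'a::topological_space kernel \<Rightarrow> ('a set \<times> 'a set \<times> ennreal) set set" where
  "minorants \<kappa> = {D. finite D \<and> (\<forall>(U, V, c)\<in>D. open U \<and> open V \<and> (\<forall>x\<in>U. \<forall>y\<in>V. c \<le> \<kappa> x y))}"

definition transpose_rectangles :: "('a set \<times> 'a set \<times> ennreal) set \<Rightarrow> ('a set \<times> 'a set \<times> ennreal) set" where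
  "transpose_rectangles D = (\<lambda>(U, V, c). (V, U, c)) ` D"

lemma minorants_nonempty: "minorants \<kappa> \<noteq> {}"
  by (auto simp: minorants_def intro!: exI[of _ "{}"])

lemma minorants_Un: "D \<in> minorants \<kappa> \<Longrightarrow> E \<in> minorants \<kappa> \<Longrightarrow> D \<union> E \<in> minorants \<kappa>"
  by (auto simp: minorants_def)

lemma step_kernel_mono: "D \<subseteq> E \<Longrightarrow> step_kernel D x y \<le> step_kernel E x y"
  unfolding step_kernel_def by (rule SUP_subset_mono) auto

lemma step_kernel_le: "D \<in> minorants \<kappa> \<Longrightarrow> step_kernel D x y \<le> \<kappa> x y"
  unfolding step_kernel_def by (rule SUP_least) (force simp: minorants_def indicator_def)

lemma lsc_step_kernel: "D \<in> minorants \<kappa> \<Longrightarrow> lsc (step_kernel D x)"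
  unfolding step_kernel_def[abs_def]
  by (intro lsc_SUP) (auto simp: minorants_def split: prod.splits intro!: lsc_cmult_indicator)

lemma step_kernel_transpose: "step_kernel (transpose_rectangles D) y x = step_kernel D x y"
  unfolding step_kernel_def transpose_rectangles_def by (simp add: image_comp o_def split_beta ac_simps)

lemma transpose_rectangles_image_minorants:
  assumes "\<And>x y. \<kappa> x y = \<kappa> y x"
  shows "transpose_rectangles ` minorants \<kappa> = minorants \<kappa>"
proof -
  have "transpose_rectangles D \<in> minorants \<kappa>" if "D \<in> minorants \<kappa>" for D
    using that unfolding minorants_def transpose_rectangles_def by (fastforce simp: assms)
  moreover have "transpose_rectangles (transpose_rectangles D) = D"
    for D :: "('a set \<times> 'a set \<times> ennreal) set"
    by (force simp: transpose_rectangles_def image_comp o_def split_beta)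
  ultimately show ?thesis by (metis (no_types, lifting) image_subset_iff subset_antisym image_eqI subsetI)
qed

definition membership_cell :: "('t \<Rightarrow> 'a set) \<Rightarrow> 't set \<Rightarrow> 't set \<Rightarrow> 'a set" where
  "membership_cell S D P = {x. \<forall>t\<in>D. x \<in> S t \<longleftrightarrow> t \<in> P}"

lemma borel_membership_cell:
  assumes "finite D" "\<And>t. t \<in> D \<Longrightarrow> open (S t)"
  shows "membership_cell S D P \<in> sets borel"
proof (cases "D = {}")
  case False
  have "(if t \<in> P then S t else - S t) \<in> sets borel" if "t \<in> D" for t
    using assms(2)[OF that] by auto
  then have "(\<Inter>t\<in>D. if t \<in> P then S t else - S t) \<in> sets borel"
    using assms(1) False by (intro sets.finite_INT)
  also have "(\<Inter>t\<in>D. if t \<in> P then S t else - S t) = membership_cell S D P"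
    by (auto simp: membership_cell_def split: if_splits)
  finally show ?thesis .
qed (simp add: membership_cell_def)

lemma step_kernel_eq_sum:
  assumes "finite D"
  shows "step_kernel D x y = (\<Sum>P\<in>Pow D. \<Sum>Q\<in>Pow D. (SUP t\<in>P \<inter> Q. snd (snd t)) *
    indicator (membership_cell fst D P) x * indicator (membership_cell (fst \<circ> snd) D Q) y)"
proof -
  let ?P = "{t\<in>D. x \<in> fst t}" and ?Q = "{t\<in>D. y \<in> fst (snd t)}"
  let ?c = "\<lambda>P Q. SUP t\<in>P \<inter> Q. snd (snd t)"
  have cell_indicator: "indicator (membership_cell fst D P) x = (if P = ?P then 1 else 0 :: ennreal)"
    "indicator (membership_cell (fst \<circ> snd) D P) y = (if P = ?Q then 1 else 0 :: ennreal)"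
      if "P \<in> Pow D" for P
    using that by (auto simp: membership_cell_def indicator_def)
  have "(\<Sum>P\<in>Pow D. \<Sum>Q\<in>Pow D.
      ?c P Q * indicator (membership_cell fst D P) x * indicator (membership_cell (fst \<circ> snd) D Q) y)
      = (\<Sum>P\<in>Pow D. \<Sum>Q\<in>Pow D. if Q = ?Q then (if P = ?P then ?c P Q else 0) else 0)"
    by (intro sum.cong refl) (simp add: cell_indicator)
  also have "\<dots> = ?c ?P ?Q" using assms by simp
  also have "\<dots> = step_kernel D x y"
  proof (rule antisym)
    show "?c ?P ?Q \<le> step_kernel D x y"
      unfolding step_kernel_def split_beta by (intro SUP_mono) force
    show "step_kernel D x y \<le> ?c ?P ?Q"
      unfolding step_kernel_def split_beta by (intro SUP_least) (auto simp: indicator_def intro: SUP_upper)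
  qed
  finally show ?thesis by simp
qed

lemma nn_integral_step_kernel_commute:
  assumes D: "D \<in> minorants \<kappa>" and sets: "sets \<mu> = sets borel" "sets \<nu> = sets borel"
  shows "(\<integral>\<^sup>+ x. \<integral>\<^sup>+ y. step_kernel D x y \<partial>\<nu> \<partial>\<mu>) = (\<integral>\<^sup>+ y. \<integral>\<^sup>+ x. step_kernel D x y \<partial>\<mu> \<partial>\<nu>)"
proof -
  have "finite D" "\<And>t. t \<in> D \<Longrightarrow> open (fst t)" "\<And>t. t \<in> D \<Longrightarrow> open ((fst \<circ> snd) t)"
    using D by (auto simp: minorants_def)
  then have [measurable]: "membership_cell fst D P \<in> sets \<mu>"
      "membership_cell (fst \<circ> snd) D P \<in> sets \<nu>" for P
    unfolding sets by (intro borel_membership_cell; blast)+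
  show ?thesis
    unfolding step_kernel_eq_sum[OF \<open>finite D\<close>]
    by (simp add: nn_integral_sum nn_integral_cmult nn_integral_multc)
qed

lemma lsc_nn_integral_step_kernel:
  assumes D: "D \<in> minorants \<kappa>"
  shows "lsc (\<lambda>x. \<integral>\<^sup>+ y. step_kernel D x y \<partial>\<nu>)"
  unfolding lsc_def
proof (intro allI Topological_Spaces.openI)
  fix e x\<^sub>0
  let ?S = "{x. e < (\<integral>\<^sup>+ y. step_kernel D x y \<partial>\<nu>)}" and ?W = "\<Inter>t\<in>{t\<in>D. x\<^sub>0 \<in> fst t}. fst t"
  assume x\<^sub>0: "x\<^sub>0 \<in> ?S"
  have "?W \<subseteq> ?S"
  proof
    fix x assume x: "x \<in> ?W"
    have "step_kernel D x\<^sub>0 y \<le> step_kernel D x y" for y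
      unfolding step_kernel_def split_beta
    proof (rule SUP_mono)
      fix t assume "t \<in> D"
      with x have "x\<^sub>0 \<in> fst t \<Longrightarrow> x \<in> fst t" by blast
      then have "indicator (fst t) x\<^sub>0 \<le> (indicator (fst t) x :: ennreal)" by (auto simp: indicator_def)
      then show "\<exists>s\<in>D. snd (snd t) * indicator (fst t) x\<^sub>0 * indicator (fst (snd t)) y
          \<le> snd (snd s) * indicator (fst s) x * indicator (fst (snd s)) y"
        using \<open>t \<in> D\<close> by (intro bexI[of _ t] mult_right_mono mult_left_mono) auto
    qed
    then have "(\<integral>\<^sup>+ y. step_kernel D x\<^sub>0 y \<partial>\<nu>) \<le> (\<integral>\<^sup>+ y. step_kernel D x y \<partial>\<nu>)"
      by (intro nn_integral_mono)
    then show "x \<in> ?S" using x\<^sub>0 by auto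
  qed
  moreover have "open ?W" using D by (intro open_INT) (auto simp: minorants_def)
  ultimately show "\<exists>T. open T \<and> x\<^sub>0 \<in> T \<and> T \<subseteq> ?S" by (intro exI[of _ ?W]) auto
qed

lemma nn_integral_SUP_minorants:
  fixes f :: "('a set \<times> 'a set \<times> ennreal) set \<Rightarrow> 'a::t2_space \<Rightarrow> ennreal"
  assumes "radon \<mu>" and lsc: "\<And>D. D \<in> minorants \<kappa> \<Longrightarrow> lsc (f D)"
    and mono: "\<And>D E x. D \<subseteq> E \<Longrightarrow> f D x \<le> f E x"
  shows "(\<integral>\<^sup>+ x. (SUP D\<in>minorants \<kappa>. f D x) \<partial>\<mu>) = (SUP D\<in>minorants \<kappa>. \<integral>\<^sup>+ x. f D x \<partial>\<mu>)"
proof (rule nn_integral_SUP_lsc_directed[OF assms(1) minorants_nonempty lsc])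
  fix D E assume "D \<in> minorants \<kappa>" "E \<in> minorants \<kappa>"
  then show "\<exists>F\<in>minorants \<kappa>. f D \<le> f F \<and> f E \<le> f F"
    by (intro bexI[of _ "D \<union> E"] conjI le_funI mono minorants_Un) auto
qed

locale lsc_kernel =
  fixes \<kappa> :: "'a::t2_space kernel"
  assumes basic: "kernel_basic \<kappa>"
begin

lemma kernel_sym: "\<kappa> x y = \<kappa> y x"
  using basic unfolding kernel_basic_def by blast

lemma kernel_open: "open {z. c < \<kappa> (fst z) (snd z)}"
  using basic unfolding kernel_basic_def by blast

lemma kernel_superlevel_rectangle:
  assumes "c < \<kappa> x y"
  obtains U V where "open U" "open V" "x \<in> U" "y \<in> V" "\<forall>u\<in>U. \<forall>v\<in>V. c < \<kappa> u v"
proof -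
  have "(x, y) \<in> {z. c < \<kappa> (fst z) (snd z)}" using assms by simp
  with kernel_open obtain U V where UV: "open U" "open V" "(x, y) \<in> U \<times> V"
      "U \<times> V \<subseteq> {z. c < \<kappa> (fst z) (snd z)}"
    by (rule open_prod_elim)
  show ?thesis by (rule that[OF UV(1,2)]) (use UV(3,4) in auto)
qed

lemma kernel_eq_SUP: "\<kappa> x y = (SUP D\<in>minorants \<kappa>. step_kernel D x y)"
proof (rule antisym)
  show "\<kappa> x y \<le> (SUP D\<in>minorants \<kappa>. step_kernel D x y)"
  proof (rule dense_le)
    fix c assume "c < \<kappa> x y"
    then obtain U V where UV: "open U" "open V" "x \<in> U" "y \<in> V" "\<forall>u\<in>U. \<forall>v\<in>V. c < \<kappa> u v"
      by (rule kernel_superlevel_rectangle)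
    then have "{(U, V, c)} \<in> minorants \<kappa>" by (auto simp: minorants_def less_imp_le)
    moreover have "c \<le> step_kernel {(U, V, c)} x y" using UV by (simp add: step_kernel_def)
    ultimately show "c \<le> (SUP D\<in>minorants \<kappa>. step_kernel D x y)" by (meson SUP_upper2)
  qed
  show "(SUP D\<in>minorants \<kappa>. step_kernel D x y) \<le> \<kappa> x y"
    by (intro SUP_least step_kernel_le)
qed

lemma lsc_kernel: "lsc (\<kappa> x)"
proof -
  have "lsc (\<lambda>y. SUP D\<in>minorants \<kappa>. step_kernel D x y)" by (intro lsc_SUP lsc_step_kernel)
  then show ?thesis by (simp add: kernel_eq_SUP[symmetric])
qed

lemma kernel_borel[measurable]: "\<kappa> x \<in> borel_measurable borel"
  by (intro borel_measurable_lsc lsc_kernel)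

lemma pot_eq_SUP:
  assumes "radon \<nu>"
  shows "pot \<kappa> \<nu> x = (SUP D\<in>minorants \<kappa>. \<integral>\<^sup>+ y. step_kernel D x y \<partial>\<nu>)"
proof -
  have "pot \<kappa> \<nu> x = (\<integral>\<^sup>+ y. (SUP D\<in>minorants \<kappa>. step_kernel D x y) \<partial>\<nu>)"
    unfolding pot_def by (intro nn_integral_cong kernel_eq_SUP)
  also have "\<dots> = (SUP D\<in>minorants \<kappa>. \<integral>\<^sup>+ y. step_kernel D x y \<partial>\<nu>)"
    by (intro nn_integral_SUP_minorants[OF assms] lsc_step_kernel step_kernel_mono)
  finally show ?thesis .
qed

lemma lsc_pot:
  assumes "radon \<nu>" shows "lsc (pot \<kappa> \<nu>)"
proof -
  have "lsc (\<lambda>x. SUP D\<in>minorants \<kappa>. \<integral>\<^sup>+ y. step_kernel D x y \<partial>\<nu>)"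
    by (intro lsc_SUP lsc_nn_integral_step_kernel)
  then show ?thesis by (simp add: pot_eq_SUP[OF assms, symmetric])
qed

lemma pot_borel: "radon \<nu> \<Longrightarrow> pot \<kappa> \<nu> \<in> borel_measurable borel"
  by (intro borel_measurable_lsc lsc_pot)

lemma kint_eq_SUP:
  assumes "radon \<mu>" "radon \<nu>"
  shows "kint \<kappa> \<mu> \<nu> = (SUP D\<in>minorants \<kappa>. \<integral>\<^sup>+ x. \<integral>\<^sup>+ y. step_kernel D x y \<partial>\<nu> \<partial>\<mu>)"
  unfolding kint_def pot_eq_SUP[OF assms(2)]
  by (intro nn_integral_SUP_minorants[OF assms(1)] lsc_nn_integral_step_kernel nn_integral_mono
      step_kernel_mono)

lemma kint_sym:
  assumes "radon \<mu>" "radon \<nu>"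
  shows "kint \<kappa> \<mu> \<nu> = kint \<kappa> \<nu> \<mu>"
proof -
  let ?J = "\<lambda>D. \<integral>\<^sup>+ y. \<integral>\<^sup>+ x. step_kernel D y x \<partial>\<mu> \<partial>\<nu>"
  have "kint \<kappa> \<mu> \<nu> = (SUP D\<in>minorants \<kappa>. ?J (transpose_rectangles D))"
    unfolding kint_eq_SUP[OF assms] step_kernel_transpose
    using sets_radon[OF assms(1)] sets_radon[OF assms(2)]
    by (intro SUP_cong refl nn_integral_step_kernel_commute)
  also have "\<dots> = (SUP D\<in>transpose_rectangles ` minorants \<kappa>. ?J D)" by (simp only: image_image)
  also have "\<dots> = kint \<kappa> \<nu> \<mu>"
    by (simp only: transpose_rectangles_image_minorants kernel_sym kint_eq_SUP[OF assms(2,1)])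
  finally show ?thesis .
qed

lemma kint_madd_left:
  assumes "radon \<mu>" "radon \<mu>'" "radon \<nu>"
  shows "kint \<kappa> (madd \<mu> \<mu>') \<nu> = kint \<kappa> \<mu> \<nu> + kint \<kappa> \<mu>' \<nu>"
  unfolding kint_def using assms by (intro nn_integral_madd pot_borel) (auto simp: sets_radon)

lemma kint_madd_right:
  assumes "radon \<mu>" "radon \<nu>" "radon \<nu>'"
  shows "kint \<kappa> \<mu> (madd \<nu> \<nu>') = kint \<kappa> \<mu> \<nu> + kint \<kappa> \<mu> \<nu>'"
  using assms
  by (simp add: kint_sym[OF assms(1) radon_madd[OF assms(2,3)]] kint_madd_left
      kint_sym[OF assms(1,2)] kint_sym[OF assms(1,3)])

lemma kint_madd_self_ge:
  assumes "radon \<mu>" "radon \<nu>"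
  shows "kint \<kappa> \<mu> \<mu> + kint \<kappa> \<nu> \<nu> \<le> kint \<kappa> (madd \<mu> \<nu>) (madd \<mu> \<nu>)"
  using assms
  by (simp add: kint_madd_left kint_madd_right radon_madd add_mono add_increasing2 add_increasing)

lemma kint_scale_left:
  assumes "radon \<mu>" "radon \<nu>"
  shows "kint \<kappa> (scale_measure (ennreal t) \<mu>) \<nu> = ennreal t * kint \<kappa> \<mu> \<nu>"
  unfolding kint_def
  by (rule nn_integral_scale_measure[OF borel_measurable_radon[OF assms(1) pot_borel[OF assms(2)]]])

lemma kint_scale_right:
  assumes "radon \<mu>" "radon \<nu>" "t \<ge> 0"
  shows "kint \<kappa> \<mu> (scale_measure (ennreal t) \<nu>) = ennreal t * kint \<kappa> \<mu> \<nu>"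
  using assms
  by (simp add: kint_sym[OF assms(1) radon_scale[OF assms(2,3)]] kint_scale_left kint_sym[OF assms(1,2)])

lemma kint_restr_left:
  assumes "radon \<mu>" "radon \<nu>" "B \<in> sets borel"
  shows "kint \<kappa> (restr B \<mu>) \<nu> = (\<integral>\<^sup>+ x. indicator B x * pot \<kappa> \<nu> x \<partial>\<mu>)"
  unfolding kint_def using assms by (intro nn_integral_restr pot_borel) (auto simp: sets_radon)

lemma kint_restr_left_le:
  assumes "radon \<mu>" "radon \<nu>" "B \<in> sets borel"
  shows "kint \<kappa> (restr B \<mu>) \<nu> \<le> kint \<kappa> \<mu> \<nu>"
  by (subst kint_restr_left[OF assms], unfold kint_def, intro nn_integral_mono) (auto simp: indicator_def)

lemma kint_restr_le:
  assumes "radon \<mu>" "radon \<nu>" "B \<in> sets borel" "C \<in> sets borel" "radon (restr B \<mu>)" "radon (restr C \<nu>)"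
  shows "kint \<kappa> (restr B \<mu>) (restr C \<nu>) \<le> kint \<kappa> \<mu> \<nu>"
proof -
  have "kint \<kappa> (restr B \<mu>) (restr C \<nu>) \<le> kint \<kappa> \<mu> (restr C \<nu>)"
    using assms by (intro kint_restr_left_le)
  also have "\<dots> = kint \<kappa> (restr C \<nu>) \<mu>" using assms by (intro kint_sym)
  also have "\<dots> \<le> kint \<kappa> \<nu> \<mu>" using assms by (intro kint_restr_left_le)
  also have "\<dots> = kint \<kappa> \<mu> \<nu>" using assms by (intro kint_sym)
  finally show ?thesis .
qed

lemma kint_restr_Un_le:
  assumes \<mu>: "radon \<mu>" and compact: "compact K" "compact L"
  shows "kint \<kappa> (restr L \<mu>) (restr K \<mu>) \<le> kint \<kappa> (restr (K \<union> L) \<mu>) (restr (K \<union> L) \<mu>)"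
proof -
  let ?\<rho> = "restr (K \<union> L) \<mu>"
  have [measurable]: "K \<in> sets borel" "L \<in> sets borel" using compact by (auto intro: borel_compact)
  have "restr M ?\<rho> = restr M \<mu>" if "compact M" "M \<subseteq> K \<union> L" for M
    using that borel_compact[OF that(1)] sets_radon[OF \<mu>]
    by (intro measure_eqI) (auto simp: emeasure_restr intro!: arg_cong[where f="emeasure \<mu>"])
  then have "restr L ?\<rho> = restr L \<mu>" "restr K ?\<rho> = restr K \<mu>" using compact by auto
  moreover have "kint \<kappa> (restr L ?\<rho>) (restr K ?\<rho>) \<le> kint \<kappa> ?\<rho> ?\<rho>"
    using compact \<mu> calculation by (intro kint_restr_le) (auto intro: radon_restr_compact compact_Un)
  ultimately show ?thesis by simp
qed

lemma kint_compact_exhaustion_left: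
  assumes "radon \<mu>" "radon \<nu>"
  shows "kint \<kappa> \<mu> \<nu> = (SUP K\<in>{K. compact K}. kint \<kappa> (restr K \<mu>) \<nu>)"
proof -
  have "kint \<kappa> \<mu> \<nu> = (SUP K\<in>{K. compact K}. \<integral>\<^sup>+ x. indicator K x * pot \<kappa> \<nu> x \<partial>\<mu>)"
    unfolding kint_def by (rule nn_integral_lsc_compact_exhaustion[OF assms(1) lsc_pot[OF assms(2)]])
  also have "\<dots> = (SUP K\<in>{K. compact K}. kint \<kappa> (restr K \<mu>) \<nu>)"
    by (intro SUP_cong refl kint_restr_left[OF assms, symmetric]) (auto intro: borel_compact)
  finally show ?thesis .
qed

lemma kint_compact_exhaustion:
  assumes \<mu>: "radon \<mu>"
  shows "kint \<kappa> \<mu> \<mu> = (SUP K\<in>{K. compact K}. kint \<kappa> (restr K \<mu>) (restr K \<mu>))"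
proof (rule antisym)
  have "kint \<kappa> \<mu> \<mu> = (SUP K\<in>{K. compact K}. kint \<kappa> (restr K \<mu>) \<mu>)"
    by (rule kint_compact_exhaustion_left[OF \<mu> \<mu>])
  also have "\<dots> = (SUP K\<in>{K. compact K}. SUP L\<in>{K. compact K}. kint \<kappa> (restr L \<mu>) (restr K \<mu>))"
  proof (intro SUP_cong refl)
    fix K :: "'a set" assume "K \<in> {K. compact K}"
    then have "radon (restr K \<mu>)" using radon_restr_compact[OF \<mu>] by simp
    then show "kint \<kappa> (restr K \<mu>) \<mu> = (SUP L\<in>{K. compact K}. kint \<kappa> (restr L \<mu>) (restr K \<mu>))"
      by (subst kint_sym[OF _ \<mu>]) (simp_all add: kint_compact_exhaustion_left[OF \<mu>])
  qed
  also have "\<dots> \<le> (SUP K\<in>{K. compact K}. kint \<kappa> (restr K \<mu>) (restr K \<mu>))"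
  proof (intro SUP_least)
    fix K L :: "'a set" assume "K \<in> {K. compact K}" "L \<in> {K. compact K}"
    then show "kint \<kappa> (restr L \<mu>) (restr K \<mu>) \<le> (SUP K\<in>{K. compact K}. kint \<kappa> (restr K \<mu>) (restr K \<mu>))"
      by (intro SUP_upper2[of "K \<union> L"] kint_restr_Un_le[OF \<mu>]) (auto simp: compact_Un)
  qed
  finally show "kint \<kappa> \<mu> \<mu> \<le> (SUP K\<in>{K. compact K}. kint \<kappa> (restr K \<mu>) (restr K \<mu>))" .
  show "(SUP K\<in>{K. compact K}. kint \<kappa> (restr K \<mu>) (restr K \<mu>)) \<le> kint \<kappa> \<mu> \<mu>"
    using \<mu> by (intro SUP_least kint_restr_le) (auto intro: radon_restr_compact borel_compact)
qed

end

subsection \<open>Measures of finite energy are carried by \<open>\<sigma>\<close>-compact closed sets\<close>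

lemma radon_return: "radon (return borel (x::'a::t2_space))"
proof (rule radonI)
  show "emeasure (return borel x) K < \<infinity>" if "compact K" for K
    using borel_compact[OF that] by (simp add: indicator_def)
  show "\<exists>U. open U \<and> B \<subseteq> U \<and> emeasure (return borel x) U \<le> emeasure (return borel x) B + ennreal e"
    if "B \<in> sets borel" for B e
    using that by (intro exI[of _ "if x \<in> B then UNIV else - {x}"]) auto
  show "emeasure (return borel x) U \<le> (SUP K\<in>{K. compact K \<and> K \<subseteq> U}. emeasure (return borel x) K)"
    if "open U" for U
  proof (cases "x \<in> U")
    case True
    then show ?thesis using that by (intro SUP_upper2[of "{x}"]) auto
  qed (use that in simp)
qed simp

lemma kint_null_right[simp]: "kint \<kappa> \<mu> (null_measure borel) = 0"
  unfolding kint_def pot_def by (simp add: nn_integral_null_measure)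

lemma kint_null_left[simp]: "kint \<kappa> (null_measure borel) \<mu> = 0"
  unfolding kint_def by (simp add: nn_integral_null_measure)

locale energy_kernel = lsc_kernel +
  assumes spd: "kernel_spd \<kappa>" and offdiag: "kernel_offdiag \<kappa>" and vanishing: "kernel_vanishing \<kappa>"
begin

lemma zero_energy_imp_null:
  assumes "radon \<nu>" "kint \<kappa> \<nu> \<nu> = 0"
  shows "emeasure \<nu> UNIV = 0"
proof -
  have "inE \<kappa> (\<nu>, null_measure borel)"
    using assms radon_null_measure by (auto simp: inE_def finen_def msingular_def intro!: bexI[of _ UNIV])
  moreover have "ip \<kappa> (\<nu>, null_measure borel) (\<nu>, null_measure borel) = 0"
    using assms by (simp add: ip_def)
  ultimately show ?thesis using spd unfolding kernel_spd_def by (metis fst_conv)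
qed

lemma kernel_diag_pos: "0 < \<kappa> x x"
proof (rule ccontr)
  assume "\<not> 0 < \<kappa> x x"
  moreover have "kint \<kappa> (return borel x) (return borel x) = \<kappa> x x"
    unfolding kint_def using pot_borel[OF radon_return]
    by (simp add: nn_integral_return) (simp add: pot_def nn_integral_return kernel_borel)
  ultimately have "emeasure (return borel x) UNIV = 0"
    by (intro zero_energy_imp_null radon_return) simp
  then show False by simp
qed

lemma kernel_bounded_below_near_diagonal:
  "\<exists>U n. open U \<and> x \<in> U \<and> (\<forall>y\<in>U. \<forall>z\<in>U. ennreal (1 / real (Suc n)) < \<kappa> y z)"
proof -
  obtain c where c: "0 < c" "c < \<kappa> x x" using dense kernel_diag_pos by blast
  then obtain r where r: "c = ennreal r" "0 < r" by (cases c) auto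
  then obtain n where "1 / real (Suc n) < r" using nat_approx_posE by blast
  then have "ennreal (1 / real (Suc n)) < \<kappa> x x" using r c by (meson ennreal_leI less_imp_le le_less_trans)
  then obtain U V where "open U" "open V" "x \<in> U" "x \<in> V" "\<forall>y\<in>U. \<forall>z\<in>V. ennreal (1 / real (Suc n)) < \<kappa> y z"
    by (rule kernel_superlevel_rectangle)
  then show ?thesis by (intro exI[of _ "U \<inter> V"] exI[of _ n]) auto
qed

text \<open>Around each \<open>x\<close> there is an open \<open>U x\<close> on whose square \<open>\<kappa>\<close> exceeds some \<open>1/(n+1)\<close>. Since \<open>\<kappa>\<close>
  vanishes at infinity, the \<open>U x\<close> with the same \<open>n\<close> that meet a given compact set lie in a
  single compact set; iterating this yields a \<open>\<sigma>\<close>-compact set containing every \<open>U x\<close> it meets.\<close>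

lemma sigma_compact_closed_superset:
  assumes K\<^sub>0: "\<And>n::nat. compact (K\<^sub>0 n)"
  obtains K :: "nat \<Rightarrow> 'a set" where "\<And>n. compact (K n)" "(\<Union>n. K\<^sub>0 n) \<subseteq> (\<Union>n. K n)" "closed (\<Union>n. K n)"
proof -
  obtain U n where U: "\<And>x. open (U x)" "\<And>x. x \<in> U x"
      "\<And>x y z. y \<in> U x \<Longrightarrow> z \<in> U x \<Longrightarrow> ennreal (1 / real (Suc (n x))) < \<kappa> y z"
    using kernel_bounded_below_near_diagonal by metis
  have "\<exists>L. compact L \<and> (\<forall>x\<in>C. \<forall>y. y \<notin> L \<longrightarrow> \<kappa> x y < ennreal (1 / real (Suc m)))" if "compact C" for C m
    using vanishing that unfolding kernel_vanishing_def
    by (metis of_nat_0_less_iff zero_less_Suc zero_less_divide_1_iff)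
  then obtain L where L: "\<And>C m. compact C \<Longrightarrow> compact (L C m)"
     "\<And>C m x y. compact C \<Longrightarrow> x \<in> C \<Longrightarrow> y \<notin> L C m \<Longrightarrow> \<kappa> x y < ennreal (1 / real (Suc m))" by metis
  define \<C> where "\<C> = {(C, L C m) |C m. True}\<^sup>* `` range K\<^sub>0"
  have "{(C, L C m) |C m. True} `` \<A> = (\<Union>C\<in>\<A>. range (L C))" for \<A> by auto
  then have "countable \<C>" unfolding \<C>_def by (intro countable_rtrancl) auto
  moreover have "K\<^sub>0 n \<in> \<C>" for n unfolding \<C>_def by auto
  ultimately have enum: "range (from_nat_into \<C>) = \<C>" by (intro range_from_nat_into) auto
  have compact_\<C>: "compact C" if "C \<in> \<C>" for C
  proof -
    obtain n where "(K\<^sub>0 n, C) \<in> {(C, L C m) |C m. True}\<^sup>*"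
      using \<open>C \<in> \<C>\<close> unfolding \<C>_def by auto
    then show ?thesis by (induction rule: rtrancl_induct) (auto intro: K\<^sub>0 L(1))
  qed
  have L_\<C>: "L C m \<in> \<C>" if "C \<in> \<C>" for C m
    using that unfolding \<C>_def by (auto intro: rtrancl_into_rtrancl)
  have U_subset: "U x \<subseteq> \<Union>\<C>" if y: "y \<in> U x" "y \<in> \<Union>\<C>" for x y
  proof
    fix z assume z: "z \<in> U x"
    obtain C where C: "C \<in> \<C>" "y \<in> C" using y(2) by blast
    have "z \<in> L C (n x)" using L(2)[OF compact_\<C>[OF C(1)] C(2)] U(3)[OF y(1) z] by (meson less_asym)
    then show "z \<in> \<Union>\<C>" using L_\<C>[OF C(1)] by blast
  qed
  have "open (- \<Union>\<C>)"
  proof (rule Topological_Spaces.openI)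
    fix x assume "x \<in> - \<Union>\<C>"
    then have "U x \<subseteq> - \<Union>\<C>" using U_subset U(2) by blast
    then show "\<exists>T. open T \<and> x \<in> T \<and> T \<subseteq> - \<Union>\<C>" using U(1,2) by blast
  qed
  then have "closed (\<Union>n. from_nat_into \<C> n)" by (simp add: enum closed_def)
  moreover have "compact (from_nat_into \<C> n)" for n using enum compact_\<C> by blast
  moreover have "(\<Union>n. K\<^sub>0 n) \<subseteq> (\<Union>n. from_nat_into \<C> n)" using \<open>\<And>n. K\<^sub>0 n \<in> \<C>\<close> by (auto simp: enum)
  ultimately show ?thesis using that by blast
qed

lemma finite_energy_moderated:
  assumes "inEp \<kappa> \<mu>" shows "moderated \<mu>"
proof -
  have \<mu>: "radon \<mu>" and finite: "kint \<kappa> \<mu> \<mu> < \<infinity>" using assms by (auto simp: inEp_def)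
  let ?e = "\<lambda>K. kint \<kappa> (restr K \<mu>) (restr K \<mu>)"
  obtain f :: "nat \<Rightarrow> ennreal" where f: "range f \<subseteq> ?e ` {K. compact K}" "kint \<kappa> \<mu> \<mu> = (SUP n. f n)"
    using ennreal_Sup_countable_SUP[of "?e ` {K. compact K}"] compact_empty
    unfolding kint_compact_exhaustion[OF \<mu>] by blast
  then have "\<forall>n. \<exists>K. compact K \<and> f n = ?e K" by (auto simp: image_subset_iff)
  then obtain K\<^sub>0 where K\<^sub>0: "\<And>n. compact (K\<^sub>0 n)" "\<And>n. f n = ?e (K\<^sub>0 n)" by metis
  obtain K :: "nat \<Rightarrow> 'a set" where K: "\<And>n. compact (K n)" "(\<Union>n. K\<^sub>0 n) \<subseteq> (\<Union>n. K n)" "closed (\<Union>n. K n)"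
    using sigma_compact_closed_superset[of K\<^sub>0] K\<^sub>0 by metis
  have null: "emeasure \<mu> C = 0" if C: "compact C" "C \<subseteq> - (\<Union>n. K n)" for C
  proof -
    have "f n + ?e C \<le> kint \<kappa> \<mu> \<mu>" for n
    proof -
      have "K\<^sub>0 n \<inter> C = {}" using C K(2) by blast
      then have "restr (K\<^sub>0 n \<union> C) \<mu> = madd (restr (K\<^sub>0 n) \<mu>) (restr C \<mu>)"
        using K\<^sub>0 C by (intro restr_Un sets_radon[OF \<mu>] borel_compact)
      then have "?e (K\<^sub>0 n) + ?e C \<le> ?e (K\<^sub>0 n \<union> C)"
        using K\<^sub>0 C by (simp add: kint_madd_self_ge radon_restr_compact[OF \<mu>])
      also have "\<dots> \<le> kint \<kappa> \<mu> \<mu>"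
        using K\<^sub>0 C \<mu> by (intro kint_restr_le radon_restr_compact borel_compact compact_Un)
      finally show ?thesis by (simp add: K\<^sub>0)
    qed
    then have "(SUP n. f n + ?e C) \<le> kint \<kappa> \<mu> \<mu>" by (intro SUP_least)
    then have "kint \<kappa> \<mu> \<mu> + ?e C \<le> kint \<kappa> \<mu> \<mu> + 0" by (simp add: ennreal_SUP_add_left f)
    then have "?e C = 0" using finite by (subst (asm) ennreal_add_left_cancel_le) auto
    then have "emeasure (restr C \<mu>) UNIV = 0" by (intro zero_energy_imp_null radon_restr_compact \<mu> C)
    then show ?thesis using emeasure_restr[OF sets_radon[OF \<mu>] borel_compact[OF C(1)], of UNIV] by simp
  qed
  have "emeasure \<mu> (UNIV - (\<Union>n. K n)) = (SUP C\<in>{C. compact C \<and> C \<subseteq> UNIV - (\<Union>n. K n)}. emeasure \<mu> C)"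
    using K(3) by (intro radon_inner_regular[OF \<mu>]) auto
  also have "\<dots> = (SUP C\<in>{C. compact C \<and> C \<subseteq> UNIV - (\<Union>n. K n)}. 0)"
    by (intro SUP_cong refl null) auto
  also have "\<dots> = 0" by (intro SUP_eq_const) auto
  finally show ?thesis using K unfolding moderated_def by blast
qed

end

subsection \<open>Positive definiteness for arbitrary pairs\<close>

lemma sigma_finite_moderated:
  fixes \<tau> :: "'a::t2_space measure"
  assumes \<tau>: "radon \<tau>" "moderated \<tau>" shows "sigma_finite_measure \<tau>"
proof -
  obtain K :: "nat \<Rightarrow> 'a set" where K: "\<And>n. compact (K n)" "\<And>n. K n \<in> sets borel"
    "closed (\<Union>n. K n)" "emeasure \<tau> (UNIV - (\<Union>n. K n)) = 0"
    using moderatedE[OF \<tau>(2)] by metis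
  show ?thesis
  proof (standard, intro exI[of _ "insert (UNIV - (\<Union>n. K n)) (range K)"] conjI)
    show "\<forall>a\<in>insert (UNIV - (\<Union>n. K n)) (range K). emeasure \<tau> a \<noteq> \<infinity>"
      using K(4) emeasure_radon_compact[OF \<tau>(1) K(1)] by (auto simp: less_top)
  qed (use K sets_radon[OF \<tau>(1)] space_radon[OF \<tau>(1)] in auto)
qed

lemma density_lattice_decomposition:
  fixes \<tau> :: "'a::topological_space measure"
  assumes \<tau>: "sets \<tau> = sets borel" and [measurable]: "f \<in> borel_measurable \<tau>" "g \<in> borel_measurable \<tau>"
  obtains p n m where "sets p = sets borel" "sets n = sets borel" "sets m = sets borel"
    "density \<tau> f = madd p m" "density \<tau> g = madd n m" "msingular p n"
proof -
  define excess :: "('a \<Rightarrow> ennreal) \<Rightarrow> ('a \<Rightarrow> ennreal) \<Rightarrow> 'a \<Rightarrow> ennreal"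
    where "excess u v x = (if v x < u x then u x - v x else 0)" for u v x
  let ?p = "density \<tau> (excess f g)" and ?n = "density \<tau> (excess g f)"
    and ?m = "density \<tau> (\<lambda>x. min (f x) (g x))"
  have [measurable]: "excess u v \<in> borel_measurable \<tau>" if [measurable]: "u \<in> borel_measurable \<tau>"
      "v \<in> borel_measurable \<tau>" for u v
    unfolding excess_def[abs_def] by measurable
  have excess: "excess u v x + min (u x) (v x) = u x" for u v x
    using diff_add_cancel_ennreal[of "v x" "u x"] by (auto simp: excess_def min_def not_less)
  have split: "density \<tau> u = madd (density \<tau> (excess u v)) (density \<tau> (\<lambda>x. min (u x) (v x)))"
    if [measurable]: "u \<in> borel_measurable \<tau>" "v \<in> borel_measurable \<tau>" for u v
    by (rule measure_eqI) (simp_all add: \<tau> emeasure_madd emeasure_density_add excess)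
  have f: "density \<tau> f = madd ?p ?m" by (rule split) measurable
  have g: "density \<tau> g = madd ?n ?m" using split[of g f] by (simp add: min.commute)
  have space: "space \<tau> = UNIV" using sets_eq_imp_space_eq[OF \<tau>] by simp
  have B: "{x\<in>space \<tau>. g x < f x} \<in> sets \<tau>" by measurable
  have "emeasure ?p (UNIV - {x\<in>space \<tau>. g x < f x}) = 0"
    using sets.compl_sets[OF B] space
    by (subst emeasure_density)
      (auto intro!: nn_integral_0_iff_AE[THEN iffD2] AE_I2 simp: indicator_def excess_def)
  moreover have "emeasure ?n {x\<in>space \<tau>. g x < f x} = 0"
    using B
    by (subst emeasure_density)
      (auto intro!: nn_integral_0_iff_AE[THEN iffD2] AE_I2 simp: indicator_def excess_def)
  ultimately have "msingular ?p ?n" unfolding msingular_def using B \<tau> by blast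
  then show ?thesis using that[of ?p ?n ?m] f g \<tau> by simp
qed

lemma jordan_decomposition:
  fixes \<mu> \<nu> :: "'a::t2_space measure"
  assumes radon: "radon \<mu>" "radon \<nu>" and moderated: "moderated \<mu>" "moderated \<nu>"
  obtains p n m where "radon p" "radon n" "radon m" "moderated p" "moderated n"
    "\<mu> = madd p m" "\<nu> = madd n m" "msingular p n"
proof -
  have sets: "sets \<mu> = sets borel" "sets \<nu> = sets borel" using radon sets_radon by auto
  define \<tau> where "\<tau> = madd \<mu> \<nu>"
  interpret \<tau>: sigma_finite_measure \<tau>
    unfolding \<tau>_def using radon moderated sets by (intro sigma_finite_moderated radon_madd moderated_madd)
  have "emeasure \<tau> B = emeasure \<mu> B + emeasure \<nu> B" for B unfolding \<tau>_def using sets by (rule emeasure_madd)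
  then have "absolutely_continuous \<tau> \<mu>" "absolutely_continuous \<tau> \<nu>"
    unfolding absolutely_continuous_def null_sets_def using sets by (auto simp: \<tau>_def)
  then obtain f g where f: "f \<in> borel_measurable \<tau>" "density \<tau> f = \<mu>" and g: "g \<in> borel_measurable \<tau>"
      "density \<tau> g = \<nu>"
    using \<tau>.Radon_Nikodym[of \<mu>] \<tau>.Radon_Nikodym[of \<nu>] sets by (auto simp: \<tau>_def)
  obtain p n m where parts: "sets p = sets borel" "sets n = sets borel" "sets m = sets borel"
    "\<mu> = madd p m" "\<nu> = madd n m" "msingular p n"
    using density_lattice_decomposition[OF _ f(1) g(1)] unfolding f(2) g(2) by (auto simp: \<tau>_def)
  have parts_le: "emeasure p B \<le> emeasure \<mu> B" "emeasure m B \<le> emeasure \<mu> B" "emeasure n B \<le> emeasure \<nu> B" for B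
    by (simp_all add: parts(1-5) emeasure_madd)
  have "moderated p" "moderated m" "moderated n"
    using moderated_mono[OF moderated(1) parts_le(1)] moderated_mono[OF moderated(1) parts_le(2)]
      moderated_mono[OF moderated(2) parts_le(3)] by auto
  moreover from this have "radon p" "radon m" "radon n"
    using radon_dominated[OF radon(1) _ parts(1) parts_le(1)]
      radon_dominated[OF radon(1) _ parts(3) parts_le(2)]
      radon_dominated[OF radon(2) _ parts(2) parts_le(3)] by auto
  ultimately show ?thesis using that parts(4-6) by blast
qed

lemma msingular_compact_carriers:
  fixes p n :: "'a::t2_space measure"
  assumes radon: "radon p" "radon n" and moderated: "moderated p" "moderated n" and "msingular p n"
  obtains C D :: "nat \<Rightarrow> 'a set" where "\<And>j. compact (C j)" "\<And>j. compact (D j)" "incseq C" "incseq D"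
    "\<And>j k. C j \<inter> D k = {}" "emeasure p (UNIV - (\<Union>j. C j)) = 0" "emeasure n (UNIV - (\<Union>j. D j)) = 0"
proof -
  obtain B where B: "B \<in> sets borel" "emeasure p (UNIV - B) = 0" "emeasure n B = 0"
    using assms(5) by (auto simp: msingular_def)
  then have complement: "UNIV - B \<in> sets borel" by auto
  have carrier:
      "\<exists>C::nat \<Rightarrow> 'a set. (\<forall>j. compact (C j)) \<and> incseq C \<and> (\<forall>j. C j \<subseteq> S) \<and> emeasure q (UNIV - (\<Union>j. C j)) = 0"
    if q: "radon q" "moderated q" and S[measurable]: "S \<in> sets borel"
      and null: "emeasure q (UNIV - S) = 0" for q S
  proof -
    note [simp] = sets_radon[OF q(1)]
    obtain C :: "nat \<Rightarrow> 'a set" where C: "\<And>j. compact (C j)" "incseq C" "\<And>j. C j \<subseteq> S"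
        "emeasure q (S - (\<Union>j. C j)) = 0"
      using moderated_inner[OF q(1,2) _ order_refl S] by auto
    note [measurable] = borel_compact[OF C(1)]
    have "emeasure q ((UNIV - S) \<union> (S - (\<Union>j. C j))) = 0"
      using null C(4) by (subst emeasure_Un_null_set) (auto simp: null_sets_def)
    then have "emeasure q (UNIV - (\<Union>j. C j)) = 0" by (rule emeasure_eq_0[rotated]) auto
    then show ?thesis using C(1-3) by blast
  qed
  obtain C :: "nat \<Rightarrow> 'a set" where C: "\<And>j. compact (C j)" "incseq C" "\<And>j. C j \<subseteq> B"
      "emeasure p (UNIV - (\<Union>j. C j)) = 0"
    using carrier[OF radon(1) moderated(1) B(1,2)] by blast
  obtain D :: "nat \<Rightarrow> 'a set" where D: "\<And>j. compact (D j)" "incseq D" "\<And>j. D j \<subseteq> UNIV - B"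
      "emeasure n (UNIV - (\<Union>j. D j)) = 0"
    using carrier[OF radon(2) moderated(2) complement] B(3) by (auto simp: Diff_Diff_Int)
  have "C j \<inter> D k = {}" for j k using C(3)[of j] D(3)[of k] by blast
  then show ?thesis using that C(1,2,4) D(1,2,4) by blast
qed

lemma kint_le_of_bounded_kernel:
  assumes \<mu>: "AE x in \<mu>. x \<in> P" and \<nu>: "AE y in \<nu>. y \<in> N"
    and bound: "\<And>x y. x \<in> P \<Longrightarrow> y \<in> N \<Longrightarrow> \<kappa> x y \<le> M"
  shows "kint \<kappa> \<mu> \<nu> \<le> M * emeasure \<nu> (space \<nu>) * emeasure \<mu> (space \<mu>)"
proof -
  have "pot \<kappa> \<nu> x \<le> M * emeasure \<nu> (space \<nu>)" if "x \<in> P" for x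
  proof -
    have "AE y in \<nu>. \<kappa> x y \<le> M" using \<nu> by eventually_elim (rule bound[OF that])
    then have "pot \<kappa> \<nu> x \<le> (\<integral>\<^sup>+ y. M \<partial>\<nu>)" unfolding pot_def by (rule nn_integral_mono_AE)
    then show ?thesis by simp
  qed
  then have "AE x in \<mu>. pot \<kappa> \<nu> x \<le> M * emeasure \<nu> (space \<nu>)" using \<mu> by (auto elim: eventually_mono)
  then have "kint \<kappa> \<mu> \<nu> \<le> (\<integral>\<^sup>+ x. M * emeasure \<nu> (space \<nu>) \<partial>\<mu>)"
    unfolding kint_def by (rule nn_integral_mono_AE)
  then show ?thesis by simp
qed

lemma nn_integral_le_incseq_carrier:
  assumes sets: "sets p = sets borel" and f: "f \<in> borel_measurable borel"
    and C: "incseq C" "\<And>j. C j \<in> sets borel" "emeasure p (UNIV - (\<Union>j. C j)) = 0"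
    and bound: "\<And>j::nat. (\<integral>\<^sup>+ x. indicator (C j) x * f x \<partial>p) \<le> b"
  shows "(\<integral>\<^sup>+ x. f x \<partial>p) \<le> b"
proof -
  have [measurable]: "f \<in> borel_measurable p" "\<And>j. C j \<in> sets p"
    using sets f C(2) borel_measurable_cong_sets by auto
  have "AE x in p. x \<in> (\<Union>j. C j)"
    by (rule AE_I'[of "UNIV - (\<Union>j. C j)"]) (use sets C in \<open>auto simp: null_sets_def\<close>)
  then have "(\<integral>\<^sup>+ x. f x \<partial>p) = (\<integral>\<^sup>+ x. (SUP j. indicator (C j) x * f x) \<partial>p)"
  proof (intro nn_integral_cong_AE, eventually_elim)
    fix x assume "x \<in> (\<Union>j. C j)"
    then obtain j where "x \<in> C j" by auto
    then show "f x = (SUP j. indicator (C j) x * f x)"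
      by (intro antisym SUP_upper2[of j] SUP_least) (auto simp: indicator_def)
  qed
  also have "\<dots> = (SUP j. \<integral>\<^sup>+ x. indicator (C j) x * f x \<partial>p)"
    using C(1)
    by (intro nn_integral_monotone_convergence_SUP) (auto simp: mono_def le_fun_def indicator_def subset_eq)
  also have "\<dots> \<le> b" by (intro SUP_least bound)
  finally show ?thesis .
qed

context energy_kernel
begin

lemma kernel_bounded_on_disjoint_compacts:
  assumes C: "compact C" "compact D" "C \<inter> D = {}"
  obtains M where "M < \<infinity>" "\<And>x y. x \<in> C \<Longrightarrow> y \<in> D \<Longrightarrow> \<kappa> x y \<le> M"
proof (cases "C \<times> D = {}")
  case False
  have off: "C \<times> D \<subseteq> {z. fst z \<noteq> snd z}" using C by auto
  then have "continuous_on (C \<times> D) (\<lambda>z. \<kappa> (fst z) (snd z))"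
    using offdiag unfolding kernel_offdiag_def by (meson continuous_on_subset)
  then obtain z where z: "z \<in> C \<times> D" "\<forall>w\<in>C \<times> D. \<kappa> (fst w) (snd w) \<le> \<kappa> (fst z) (snd z)"
    using continuous_attains_sup[OF compact_Times[OF C(1,2)] False] by blast
  moreover have "\<kappa> (fst z) (snd z) < \<infinity>" using offdiag off z(1) unfolding kernel_offdiag_def by blast
  ultimately show ?thesis using that[of "\<kappa> (fst z) (snd z)"] by auto
qed (use that[of 0] in auto)

lemma kint_disjoint_compacts_finite:
  assumes radon: "radon p" "radon n" and C: "compact C" "compact D" "C \<inter> D = {}"
  shows "kint \<kappa> (restr C p) (restr D n) < \<infinity>"
proof -
  obtain M where M: "M < \<infinity>" "\<And>x y. x \<in> C \<Longrightarrow> y \<in> D \<Longrightarrow> \<kappa> x y \<le> M"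
    using kernel_bounded_on_disjoint_compacts[OF C] by metis
  have AE_restr: "AE x in restr K q. x \<in> K" if "radon q" "compact K" for K and q :: "'a measure"
    using borel_compact[OF that(2)] sets_radon[OF that(1)]
    by (subst AE_density) (auto simp: indicator_def intro!: borel_measurable_indicator)
  have "emeasure (restr K q) (space (restr K q)) < \<infinity>" if "radon q" "compact K" for K and q :: "'a measure"
    using emeasure_restr_le[OF sets_radon, of q K UNIV]
      emeasure_restr[OF sets_radon[OF that(1)] borel_compact[OF that(2)], of UNIV]
      emeasure_radon_compact[OF that] by (simp add: space_radon[OF that(1)])
  then have "M * emeasure (restr D n) (space (restr D n)) * emeasure (restr C p) (space (restr C p)) < \<infinity>"
    using M(1) radon C by (simp add: ennreal_mult_less_top)
  with kint_le_of_bounded_kernel[OF AE_restr AE_restr M(2)] show ?thesis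
    using radon C by (meson le_less_trans)
qed

lemma kint_cross_le_of_inE:
  assumes "inE \<kappa> (p, n)"
  shows "2 * enn2real (kint \<kappa> p n) \<le> enn2real (kint \<kappa> p p) + enn2real (kint \<kappa> n n)"
proof -
  have "kint \<kappa> n p = kint \<kappa> p n" using assms by (intro kint_sym) (auto simp: inE_def)
  moreover have "0 \<le> ip \<kappa> (p, n) (p, n)" using spd assms unfolding kernel_spd_def by blast
  ultimately show ?thesis by (simp add: ip_def)
qed

lemma kint_disjoint_compacts_le:
  assumes radon: "radon p" "radon n" and finite: "kint \<kappa> p p < \<infinity>" "kint \<kappa> n n < \<infinity>"
    and C: "compact C" "compact D" "C \<inter> D = {}"
  shows "kint \<kappa> (restr C p) (restr D n) \<le> kint \<kappa> p p + kint \<kappa> n n"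
proof -
  let ?p = "restr C p" and ?n = "restr D n"
  have [measurable]: "C \<in> sets borel" "D \<in> sets borel" using C by (auto intro: borel_compact)
  have restr: "radon ?p" "radon ?n" using radon C by (auto intro: radon_restr_compact)
  then have restr_le: "kint \<kappa> ?p ?p \<le> kint \<kappa> p p" "kint \<kappa> ?n ?n \<le> kint \<kappa> n n"
    using radon by (auto intro!: kint_restr_le)
  have restr_finite: "kint \<kappa> ?p ?p < \<infinity>" "kint \<kappa> ?n ?n < \<infinity>"
    using restr_le finite by (auto intro: le_less_trans)
  have cross: "kint \<kappa> ?p ?n < \<infinity>" "kint \<kappa> ?n ?p < \<infinity>"
    using kint_disjoint_compacts_finite[OF radon C] kint_sym[OF restr] by auto
  have "msingular ?p ?n"
    unfolding msingular_def using radon C(3)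
    by (intro bexI[of _ C]) (auto simp: emeasure_restr sets_radon Int_commute)
  then have "inE \<kappa> (?p, ?n)" using restr_finite cross restr by (auto simp: inE_def finen_def)
  from kint_cross_le_of_inE[OF this] have "enn2real (kint \<kappa> ?p ?n)
      \<le> enn2real (kint \<kappa> ?p ?p) + enn2real (kint \<kappa> ?n ?n)"
    using enn2real_nonneg[of "kint \<kappa> ?p ?n"] by linarith
  then have "ennreal (enn2real (kint \<kappa> ?p ?n))
      \<le> ennreal (enn2real (kint \<kappa> ?p ?p)) + ennreal (enn2real (kint \<kappa> ?n ?n))"
    by (simp flip: ennreal_plus add: ennreal_leI)
  then have "kint \<kappa> ?p ?n \<le> kint \<kappa> ?p ?p + kint \<kappa> ?n ?n" using restr_finite cross by simp
  also have "\<dots> \<le> kint \<kappa> p p + kint \<kappa> n n" by (intro add_mono restr_le)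
  finally show ?thesis .
qed

lemma kint_le_incseq_carrier:
  assumes radon: "radon p" "radon \<nu>" and C: "incseq C" "\<And>j. compact (C j)"
      "emeasure p (UNIV - (\<Union>j. C j)) = 0"
    and bound: "\<And>j::nat. kint \<kappa> (restr (C j) p) \<nu> \<le> b"
  shows "kint \<kappa> p \<nu> \<le> b"
  unfolding kint_def
proof (rule nn_integral_le_incseq_carrier[OF
    sets_radon[OF radon(1)] pot_borel[OF radon(2)] C(1) borel_compact[OF C(2)] C(3)])
  show "(\<integral>\<^sup>+ x. indicator (C j) x * pot \<kappa> \<nu> x \<partial>p) \<le> b" for j
    using bound[of j] kint_restr_left[OF radon borel_compact[OF C(2)]] by simp
qed

lemma kint_singular_finite:
  assumes radon: "radon p" "radon n" and "moderated p" "moderated n" "msingular p n"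
    and finite: "kint \<kappa> p p < \<infinity>" "kint \<kappa> n n < \<infinity>"
  shows "kint \<kappa> p n < \<infinity>"
proof -
  obtain C D :: "nat \<Rightarrow> 'a set" where C: "\<And>j. compact (C j)" and D: "\<And>j. compact (D j)"
    and inc: "incseq C" "incseq D" and disjoint: "\<And>j k. C j \<inter> D k = {}"
    and carrier: "emeasure p (UNIV - (\<Union>j. C j)) = 0" "emeasure n (UNIV - (\<Union>j. D j)) = 0"
    using msingular_compact_carriers[OF assms(1-5)] by metis
  have restr_D: "radon (restr (D k) n)" for k by (intro radon_restr_compact radon D)
  have "kint \<kappa> p (restr (D k) n) \<le> kint \<kappa> p p + kint \<kappa> n n" for k
    by (rule kint_le_incseq_carrier[OF radon(1) restr_D inc(1) C carrier(1)])
       (rule kint_disjoint_compacts_le[OF radon finite C D disjoint])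
  then have "kint \<kappa> n p \<le> kint \<kappa> p p + kint \<kappa> n n"
    by (intro kint_le_incseq_carrier[OF radon(2,1) inc(2) D carrier(2)])
      (simp add: kint_sym[OF restr_D radon(1)])
  also have "\<dots> < \<infinity>" using finite by simp
  finally show ?thesis by (simp add: kint_sym[OF radon])
qed

lemma
  assumes \<mu>: "inEp \<kappa> \<mu>" and \<nu>: "inEp \<kappa> \<nu>"
  shows kint_finite: "kint \<kappa> \<mu> \<nu> < \<infinity>"
    and kint_cross_le: "2 * enn2real (kint \<kappa> \<mu> \<nu>) \<le> enn2real (kint \<kappa> \<mu> \<mu>) + enn2real (kint \<kappa> \<nu> \<nu>)"
    and kint_cross_eq: "2 * enn2real (kint \<kappa> \<mu> \<nu>) = enn2real (kint \<kappa> \<mu> \<mu>) + enn2real (kint \<kappa> \<nu> \<nu>) \<Longrightarrow> \<mu> = \<nu>"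
proof -
  have radon: "radon \<mu>" "radon \<nu>" and energies: "kint \<kappa> \<mu> \<mu> < \<infinity>" "kint \<kappa> \<nu> \<nu> < \<infinity>"
    using \<mu> \<nu> by (auto simp: inEp_def)
  obtain p n m where parts: "radon p" "radon n" "radon m" "moderated p" "moderated n"
    and \<mu>_eq: "\<mu> = madd p m" and \<nu>_eq: "\<nu> = madd n m" and singular: "msingular p n"
    using jordan_decomposition[OF radon finite_energy_moderated[OF \<mu>] finite_energy_moderated[OF \<nu>]]
    by metis
  note sym = kint_sym[OF parts(3,1)] kint_sym[OF parts(3,2)] kint_sym[OF parts(2,1)]
  have expand: "kint \<kappa> \<mu> \<mu> = kint \<kappa> p p + kint \<kappa> p m + (kint \<kappa> p m + kint \<kappa> m m)"
    "kint \<kappa> \<nu> \<nu> = kint \<kappa> n n + kint \<kappa> n m + (kint \<kappa> n m + kint \<kappa> m m)"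
    "kint \<kappa> \<mu> \<nu> = kint \<kappa> p n + kint \<kappa> p m + (kint \<kappa> n m + kint \<kappa> m m)"
    unfolding \<mu>_eq \<nu>_eq using parts by (simp_all add: kint_madd_left kint_madd_right radon_madd sym)
  have finite: "kint \<kappa> p p < top" "kint \<kappa> p m < top" "kint \<kappa> m m < top" "kint \<kappa> n n < top"
      "kint \<kappa> n m < top"
    using energies unfolding expand by auto
  have cross: "kint \<kappa> p n < top" using kint_singular_finite[OF parts(1,2,4,5) singular] finite by auto
  show "kint \<kappa> \<mu> \<nu> < \<infinity>" unfolding expand using finite cross by simp
  have pn: "inE \<kappa> (p, n)" using parts singular finite cross sym by (auto simp: inE_def finen_def)
  have real_expand:
      "enn2real (kint \<kappa> \<mu> \<mu>) = enn2real (kint \<kappa> p p) + 2 * enn2real (kint \<kappa> p m) + enn2real (kint \<kappa> m m)"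
     "enn2real (kint \<kappa> \<nu> \<nu>) = enn2real (kint \<kappa> n n) + 2 * enn2real (kint \<kappa> n m) + enn2real (kint \<kappa> m m)"
     "enn2real (kint \<kappa> \<mu> \<nu>)
         = enn2real (kint \<kappa> p n) + enn2real (kint \<kappa> p m) + enn2real (kint \<kappa> n m) + enn2real (kint \<kappa> m m)"
    unfolding expand using finite cross by (simp_all add: enn2real_plus)
  show "2 * enn2real (kint \<kappa> \<mu> \<nu>) \<le> enn2real (kint \<kappa> \<mu> \<mu>) + enn2real (kint \<kappa> \<nu> \<nu>)"
    using kint_cross_le_of_inE[OF pn] unfolding real_expand by simp
  assume "2 * enn2real (kint \<kappa> \<mu> \<nu>) = enn2real (kint \<kappa> \<mu> \<mu>) + enn2real (kint \<kappa> \<nu> \<nu>)"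
  then have "ip \<kappa> (p, n) (p, n) = 0" unfolding real_expand by (simp add: ip_def sym)
  then have "emeasure p UNIV = 0" "emeasure n UNIV = 0" using spd pn unfolding kernel_spd_def by auto
  then have "emeasure p B = 0" "emeasure n B = 0" for B
    using parts by (auto intro!: emeasure_eq_0[of UNIV] simp: sets_radon)
  then show "\<mu> = \<nu>"
    unfolding \<mu>_eq \<nu>_eq using parts by (intro measure_eqI) (simp_all add: emeasure_madd sets_radon)
qed

end

subsection \<open>The energy form on pairs of measures of finite energy\<close>

definition padd :: "'a::topological_space smeasure \<Rightarrow> 'a smeasure \<Rightarrow> 'a smeasure" where
  "padd z w = (madd (fst z) (fst w), madd (snd z) (snd w))"

definition pscale :: "real \<Rightarrow> 'a::topological_space smeasure \<Rightarrow> 'a smeasure" where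
  "pscale t z = (scale_measure (ennreal t) (fst z), scale_measure (ennreal t) (snd z))"

definition pneg :: "'a smeasure \<Rightarrow> 'a smeasure" where
  "pneg z = (snd z, fst z)"

definition pdiff :: "'a::topological_space smeasure \<Rightarrow> 'a smeasure \<Rightarrow> 'a smeasure" where
  "pdiff z w = padd z (pneg w)"

definition mconv :: "real \<Rightarrow> 'a::topological_space measure \<Rightarrow> 'a measure \<Rightarrow> 'a measure" where
  "mconv t \<mu> \<nu> = madd (scale_measure (ennreal (1 - t)) \<mu>) (scale_measure (ennreal t) \<nu>)"

definition pconv :: "real \<Rightarrow> 'a::topological_space smeasure \<Rightarrow> 'a smeasure \<Rightarrow> 'a smeasure" where
  "pconv t z w = padd (pscale (1 - t) z) (pscale t w)"

lemma sets_mconv[simp]: "sets (mconv t \<mu> \<nu>) = sets borel"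
  by (simp add: mconv_def)

lemma emeasure_mconv:
  "sets \<mu> = sets borel \<Longrightarrow> sets \<nu> = sets borel \<Longrightarrow>
    emeasure (mconv t \<mu> \<nu>) B = ennreal (1 - t) * emeasure \<mu> B + ennreal t * emeasure \<nu> B"
  by (simp add: mconv_def emeasure_madd)

lemma nn_integral_mconv:
  assumes "sets \<mu> = sets borel" "sets \<nu> = sets borel" "f \<in> borel_measurable borel"
  shows "(\<integral>\<^sup>+ x. f x \<partial>mconv t \<mu> \<nu>) = ennreal (1 - t) * (\<integral>\<^sup>+ x. f x \<partial>\<mu>) + ennreal t * (\<integral>\<^sup>+ x. f x \<partial>\<nu>)"
  using assms
  by (simp add: mconv_def nn_integral_madd nn_integral_scale_measure borel_measurable_cong_sets)

lemma msum_mconv: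
  assumes sets: "\<And>i. i \<in> S \<Longrightarrow> sets (\<mu> i) = sets borel" "\<And>i. i \<in> S \<Longrightarrow> sets (\<nu> i) = sets borel"
  shows "msum S (\<lambda>i. mconv t (\<mu> i) (\<nu> i)) = mconv t (msum S \<mu>) (msum S \<nu>)"
proof (rule measure_eqI)
  fix B
  have "emeasure (msum S (\<lambda>i. mconv t (\<mu> i) (\<nu> i))) B
      = (\<Sum>\<^sub>\<infinity>i\<in>S. ennreal (1 - t) * emeasure (\<mu> i) B + ennreal t * emeasure (\<nu> i) B)"
    using sets by (simp add: emeasure_msum emeasure_mconv cong: infsum_cong)
  also have "\<dots> = ennreal (1 - t) * (\<Sum>\<^sub>\<infinity>i\<in>S. emeasure (\<mu> i) B) + ennreal t * (\<Sum>\<^sub>\<infinity>i\<in>S. emeasure (\<nu> i) B)"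
    by (simp add: infsum_add nonneg_summable_on_complete infsum_cmult_ennreal)
  finally show "emeasure (msum S (\<lambda>i. mconv t (\<mu> i) (\<nu> i))) B = emeasure (mconv t (msum S \<mu>) (msum S \<nu>)) B"
    using sets by (simp add: emeasure_mconv emeasure_msum)
qed simp

lemma nonneg_quadratic_imp_discriminant:
  fixes a b c :: real
  assumes nonneg: "\<And>t. 0 \<le> a + 2 * t * b + t\<^sup>2 * c" and "0 \<le> a" "0 \<le> c"
  shows "b\<^sup>2 \<le> a * c"
proof (cases "c = 0")
  case True
  have "b = 0"
  proof (rule ccontr)
    assume "b \<noteq> 0"
    then show False using nonneg[of "- (a + 1) / (2 * b)"] \<open>0 \<le> a\<close> True by (simp add: field_simps)
  qed
  then show ?thesis using True by simp
next
  case False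
  then have "c > 0" using \<open>0 \<le> c\<close> by simp
  have "0 \<le> a + 2 * (- b / c) * b + (- b / c)\<^sup>2 * c" by (rule nonneg)
  also have "\<dots> = a - b\<^sup>2 / c" using \<open>c > 0\<close> by (simp add: field_simps power2_eq_square)
  finally show ?thesis using \<open>c > 0\<close> by (simp add: field_simps)
qed

context energy_kernel
begin

abbreviation energy :: "'a measure \<Rightarrow> 'a measure \<Rightarrow> real" where
  "energy \<mu> \<nu> \<equiv> enn2real (kint \<kappa> \<mu> \<nu>)"

definition energy_pair :: "'a smeasure \<Rightarrow> bool" where
  "energy_pair z \<longleftrightarrow> inEp \<kappa> (fst z) \<and> inEp \<kappa> (snd z)"

lemma inEp_radon: "inEp \<kappa> \<mu> \<Longrightarrow> radon \<mu>"
  by (simp add: inEp_def)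

lemma inEp_sets: "inEp \<kappa> \<mu> \<Longrightarrow> sets \<mu> = sets borel"
  by (simp add: inEp_def sets_radon)

lemma ennreal_energy: "inEp \<kappa> \<mu> \<Longrightarrow> inEp \<kappa> \<nu> \<Longrightarrow> ennreal (energy \<mu> \<nu>) = kint \<kappa> \<mu> \<nu>"
  using kint_finite[of \<mu> \<nu>] by simp

lemma energy_sym: "inEp \<kappa> \<mu> \<Longrightarrow> inEp \<kappa> \<nu> \<Longrightarrow> energy \<mu> \<nu> = energy \<nu> \<mu>"
  by (simp add: kint_sym[of \<mu> \<nu>] inEp_def)

lemma inEp_madd: "inEp \<kappa> \<mu> \<Longrightarrow> inEp \<kappa> \<nu> \<Longrightarrow> inEp \<kappa> (madd \<mu> \<nu>)"
  using kint_finite[of \<mu> \<nu>] kint_finite[of \<nu> \<mu>]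
  by (simp add: inEp_def radon_madd kint_madd_left kint_madd_right)

lemma inEp_maddD:
  assumes "radon \<mu>" "radon \<nu>" "inEp \<kappa> (madd \<mu> \<nu>)"
  shows "inEp \<kappa> \<mu>" "inEp \<kappa> \<nu>"
proof -
  have "kint \<kappa> \<mu> \<mu> + kint \<kappa> \<nu> \<nu> < top"
    using assms(3) by (intro le_less_trans[OF kint_madd_self_ge[OF assms(1,2)]]) (simp add: inEp_def)
  then show "inEp \<kappa> \<mu>" "inEp \<kappa> \<nu>" using assms(1,2) by (auto simp: inEp_def)
qed

lemma inEp_scale: "inEp \<kappa> \<mu> \<Longrightarrow> t \<ge> 0 \<Longrightarrow> inEp \<kappa> (scale_measure (ennreal t) \<mu>)"
  by (simp add: inEp_def radon_scale kint_scale_left kint_scale_right ennreal_mult_less_top)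

lemma inEp_mconv: "inEp \<kappa> \<mu> \<Longrightarrow> inEp \<kappa> \<nu> \<Longrightarrow> 0 \<le> t \<Longrightarrow> t \<le> 1 \<Longrightarrow> inEp \<kappa> (mconv t \<mu> \<nu>)"
  by (simp add: mconv_def inEp_madd inEp_scale)

lemma inEp_restr:
  assumes "inEp \<kappa> \<mu>" "B \<in> sets borel" shows "inEp \<kappa> (restr B \<mu>)"
proof -
  have "radon (restr B \<mu>)" using assms finite_energy_moderated by (intro radon_restr inEp_radon)
  moreover from this have "kint \<kappa> (restr B \<mu>) (restr B \<mu>) \<le> kint \<kappa> \<mu> \<mu>"
    using assms by (intro kint_restr_le) (auto simp: inEp_def)
  ultimately show ?thesis using assms by (auto simp: inEp_def intro: le_less_trans)
qed

lemma energy_restr_le: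
  assumes "inEp \<kappa> \<mu>" "B \<in> sets borel" shows "energy (restr B \<mu>) (restr B \<mu>) \<le> energy \<mu> \<mu>"
  using assms inEp_restr[OF assms]
  by (intro enn2real_mono kint_restr_le) (auto simp: inEp_def)

lemma energy_madd_left:
  "inEp \<kappa> \<mu> \<Longrightarrow> inEp \<kappa> \<mu>' \<Longrightarrow> inEp \<kappa> \<nu> \<Longrightarrow> energy (madd \<mu> \<mu>') \<nu> = energy \<mu> \<nu> + energy \<mu>' \<nu>"
  using kint_finite[of \<mu> \<nu>] kint_finite[of \<mu>' \<nu>]
  by (simp add: kint_madd_left inEp_radon enn2real_plus)

lemma energy_madd_right:
  "inEp \<kappa> \<mu> \<Longrightarrow> inEp \<kappa> \<nu> \<Longrightarrow> inEp \<kappa> \<nu>' \<Longrightarrow> energy \<mu> (madd \<nu> \<nu>') = energy \<mu> \<nu> + energy \<mu> \<nu>'"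
  using kint_finite[of \<mu> \<nu>] kint_finite[of \<mu> \<nu>']
  by (simp add: kint_madd_right inEp_radon enn2real_plus)

lemma energy_scale_left:
  "inEp \<kappa> \<mu> \<Longrightarrow> inEp \<kappa> \<nu> \<Longrightarrow> t \<ge> 0 \<Longrightarrow> energy (scale_measure (ennreal t) \<mu>) \<nu> = t * energy \<mu> \<nu>"
  by (simp add: kint_scale_left inEp_radon enn2real_mult)

lemma energy_scale_right:
  "inEp \<kappa> \<mu> \<Longrightarrow> inEp \<kappa> \<nu> \<Longrightarrow> t \<ge> 0 \<Longrightarrow> energy \<mu> (scale_measure (ennreal t) \<nu>) = t * energy \<mu> \<nu>"
  by (simp add: kint_scale_right inEp_radon enn2real_mult)

lemma energy_scale:
  "inEp \<kappa> \<mu> \<Longrightarrow> t \<ge> 0 \<Longrightarrow>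
    energy (scale_measure (ennreal t) \<mu>) (scale_measure (ennreal t) \<mu>) = t\<^sup>2 * energy \<mu> \<mu>"
  by (simp add: energy_scale_left energy_scale_right inEp_scale power2_eq_square mult.assoc)

lemma energy_le_madd:
  assumes "radon \<mu>" "radon \<nu>" "inEp \<kappa> (madd \<mu> \<nu>)"
  shows "energy \<nu> \<nu> \<le> energy (madd \<mu> \<nu>) (madd \<mu> \<nu>)"
  using assms(3)
  by (intro enn2real_mono order_trans[OF _ kint_madd_self_ge[OF assms(1,2)]])
    (auto simp: inEp_def add_increasing)

lemma energy_pair_padd: "energy_pair z \<Longrightarrow> energy_pair w \<Longrightarrow> energy_pair (padd z w)"
  by (simp add: energy_pair_def padd_def inEp_madd)

lemma energy_pair_pscale: "energy_pair z \<Longrightarrow> t \<ge> 0 \<Longrightarrow> energy_pair (pscale t z)"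
  by (simp add: energy_pair_def pscale_def inEp_scale)

lemma energy_pair_pneg: "energy_pair z \<Longrightarrow> energy_pair (pneg z)"
  by (simp add: energy_pair_def pneg_def)

lemma energy_pair_pdiff: "energy_pair z \<Longrightarrow> energy_pair w \<Longrightarrow> energy_pair (pdiff z w)"
  by (simp add: pdiff_def energy_pair_padd energy_pair_pneg)

lemma energy_pair_pconv: "energy_pair z \<Longrightarrow> energy_pair w \<Longrightarrow> 0 \<le> t \<Longrightarrow> t \<le> 1 \<Longrightarrow> energy_pair (pconv t z w)"
  by (simp add: pconv_def energy_pair_padd energy_pair_pscale)

lemma ip_sym: "energy_pair z \<Longrightarrow> energy_pair w \<Longrightarrow> ip \<kappa> z w = ip \<kappa> w z"
  unfolding ip_def energy_pair_def using energy_sym by simp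

lemma ip_padd_left:
    "energy_pair z \<Longrightarrow> energy_pair w \<Longrightarrow> energy_pair u \<Longrightarrow> ip \<kappa> (padd z w) u = ip \<kappa> z u + ip \<kappa> w u"
  unfolding ip_def energy_pair_def padd_def by (simp add: energy_madd_left)

lemma ip_padd_right:
    "energy_pair z \<Longrightarrow> energy_pair w \<Longrightarrow> energy_pair u \<Longrightarrow> ip \<kappa> u (padd z w) = ip \<kappa> u z + ip \<kappa> u w"
  unfolding ip_def energy_pair_def padd_def by (simp add: energy_madd_right)

lemma ip_pscale_left: "energy_pair z \<Longrightarrow> energy_pair u \<Longrightarrow> t \<ge> 0 \<Longrightarrow> ip \<kappa> (pscale t z) u = t * ip \<kappa> z u"
  unfolding ip_def energy_pair_def pscale_def by (simp add: energy_scale_left algebra_simps)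

lemma ip_pscale_right: "energy_pair z \<Longrightarrow> energy_pair u \<Longrightarrow> t \<ge> 0 \<Longrightarrow> ip \<kappa> u (pscale t z) = t * ip \<kappa> u z"
  unfolding ip_def energy_pair_def pscale_def by (simp add: energy_scale_right algebra_simps)

lemma ip_pneg_left: "ip \<kappa> (pneg z) u = - ip \<kappa> z u"
  unfolding ip_def pneg_def by simp

lemma ip_pneg_right: "ip \<kappa> u (pneg z) = - ip \<kappa> u z"
  unfolding ip_def pneg_def by simp

lemmas ip_linear = ip_padd_left ip_padd_right ip_pscale_left ip_pscale_right ip_pneg_left ip_pneg_right
  energy_pair_padd energy_pair_pscale energy_pair_pneg

lemma ip_nonneg: "energy_pair z \<Longrightarrow> 0 \<le> ip \<kappa> z z"
  using kint_cross_le[of "fst z" "snd z"] energy_sym[of "fst z" "snd z"]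
  by (simp add: ip_def energy_pair_def)

lemma ip_zero_imp_eq: "energy_pair z \<Longrightarrow> ip \<kappa> z z = 0 \<Longrightarrow> fst z = snd z"
  using kint_cross_eq[of "fst z" "snd z"] energy_sym[of "fst z" "snd z"]
  by (simp add: ip_def energy_pair_def)

lemma nrm_nonneg: "energy_pair z \<Longrightarrow> 0 \<le> nrm \<kappa> z"
  by (simp add: nrm_def ip_nonneg)

lemma nrm_sq: "energy_pair z \<Longrightarrow> (nrm \<kappa> z)\<^sup>2 = ip \<kappa> z z"
  by (simp add: nrm_def ip_nonneg)

lemma nrm_pneg: "nrm \<kappa> (pneg z) = nrm \<kappa> z"
  by (simp add: nrm_def ip_pneg_left ip_pneg_right)

lemma nrm_swap: "nrm \<kappa> (\<mu>, \<nu>) = nrm \<kappa> (\<nu>, \<mu>)"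
  using nrm_pneg[of "(\<mu>, \<nu>)"] by (simp add: pneg_def)

lemma ip_cauchy_schwarz:
  assumes z: "energy_pair z" and w: "energy_pair w"
  shows "\<bar>ip \<kappa> z w\<bar> \<le> nrm \<kappa> z * nrm \<kappa> w"
proof -
  have "0 \<le> ip \<kappa> z z + 2 * t * ip \<kappa> z w + t\<^sup>2 * ip \<kappa> w w" for t
  proof (cases "t \<ge> 0")
    case True
    have "0 \<le> ip \<kappa> (padd z (pscale t w)) (padd z (pscale t w))"
      using z w True by (intro ip_nonneg) (simp add: ip_linear)
    then show ?thesis using z w True ip_sym[OF w z]
      by (simp add: ip_linear power2_eq_square algebra_simps)
  next
    case False
    then have t: "- t \<ge> 0" by simp
    have "0 \<le> ip \<kappa> (padd z (pscale (- t) (pneg w))) (padd z (pscale (- t) (pneg w)))"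
      using z w t by (intro ip_nonneg) (simp add: ip_linear)
    then show ?thesis using z w t ip_sym[OF w z]
      by (simp add: ip_linear power2_eq_square algebra_simps)
  qed
  then have "(ip \<kappa> z w)\<^sup>2 \<le> ip \<kappa> z z * ip \<kappa> w w"
    by (rule nonneg_quadratic_imp_discriminant) (intro ip_nonneg z w)+
  then have "sqrt ((ip \<kappa> z w)\<^sup>2) \<le> sqrt (ip \<kappa> z z * ip \<kappa> w w)" by (rule real_sqrt_le_mono)
  then show ?thesis by (simp add: nrm_def real_sqrt_mult)
qed

lemma nrm_triangle:
  assumes z: "energy_pair z" and w: "energy_pair w"
  shows "nrm \<kappa> (padd z w) \<le> nrm \<kappa> z + nrm \<kappa> w"
proof (rule power2_le_imp_le)
  have "(nrm \<kappa> (padd z w))\<^sup>2 = ip \<kappa> z z + 2 * ip \<kappa> z w + ip \<kappa> w w"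
    using z w ip_sym[OF w z] by (simp add: nrm_sq ip_linear)
  also have "\<dots> \<le> (nrm \<kappa> z)\<^sup>2 + 2 * (nrm \<kappa> z * nrm \<kappa> w) + (nrm \<kappa> w)\<^sup>2"
    using z w ip_cauchy_schwarz[OF z w] by (simp add: nrm_sq)
  also have "\<dots> = (nrm \<kappa> z + nrm \<kappa> w)\<^sup>2" by (simp add: power2_eq_square algebra_simps)
  finally show "(nrm \<kappa> (padd z w))\<^sup>2 \<le> (nrm \<kappa> z + nrm \<kappa> w)\<^sup>2" .
qed (use nrm_nonneg z w in auto)

lemma ip_pconv:
  assumes "energy_pair z" "energy_pair w" "0 \<le> t" "t \<le> 1"
  shows "ip \<kappa> (pconv t z w) (pconv t z w)
     = (1 - t) * ip \<kappa> z z + t * ip \<kappa> w w - t * (1 - t) * (nrm \<kappa> (pdiff z w))\<^sup>2"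
  using assms ip_sym[OF assms(2,1)]
  by (simp add: nrm_sq energy_pair_pdiff)
    (simp add: pconv_def pdiff_def ip_linear algebra_simps power2_eq_square)

lemma energy_mconv:
  assumes "inEp \<kappa> \<mu>" "inEp \<kappa> \<nu>" "0 \<le> t" "t \<le> 1"
  shows "energy (mconv t \<mu> \<nu>) (mconv t \<mu> \<nu>)
    = (1 - t) * energy \<mu> \<mu> + t * energy \<nu> \<nu> - t * (1 - t) * (nrm \<kappa> (\<mu>, \<nu>))\<^sup>2"
proof -
  have dist: "(nrm \<kappa> (\<mu>, \<nu>))\<^sup>2 = energy \<mu> \<mu> - 2 * energy \<mu> \<nu> + energy \<nu> \<nu>"
    using assms(1,2) energy_sym[OF assms(1,2)] by (simp add: nrm_sq energy_pair_def ip_def)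
  show ?thesis
    unfolding dist using assms energy_sym[OF assms(1,2)]
    by (simp add: mconv_def energy_madd_left energy_madd_right energy_scale_left energy_scale_right
        inEp_madd inEp_scale algebra_simps power2_eq_square)
qed

lemma nrm_madd_cancel:
  assumes "inEp \<kappa> \<mu>" "inEp \<kappa> \<nu>" "inEp \<kappa> \<rho>"
  shows "nrm \<kappa> (madd \<mu> \<rho>, madd \<nu> \<rho>) = nrm \<kappa> (\<mu>, \<nu>)"
  using assms energy_sym
  by (simp add: nrm_def ip_def energy_madd_left energy_madd_right inEp_madd)

lemma nrm_madd_self:
  assumes "inEp \<kappa> \<mu>" "inEp \<kappa> \<rho>"
  shows "nrm \<kappa> (\<mu>, madd \<mu> \<rho>) = sqrt (energy \<rho> \<rho>)"
  using assms energy_sym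
  by (simp add: nrm_def ip_def energy_madd_left energy_madd_right inEp_madd)

lemma compact_restr_approx:
  assumes \<mu>: "inEp \<kappa> \<mu>" and e: "e > 0"
  obtains K where "compact K" "nrm \<kappa> (restr K \<mu>, \<mu>) \<le> e"
proof -
  have finite: "kint \<kappa> \<mu> \<mu> \<noteq> \<infinity>" using \<mu> by (auto simp: inEp_def)
  have nonempty: "{K::'a set. compact K} \<noteq> {}" using compact_empty by blast
  obtain K where K: "compact K" "kint \<kappa> \<mu> \<mu> < kint \<kappa> (restr K \<mu>) (restr K \<mu>) + ennreal (e\<^sup>2)"
    using SUP_approx_ennreal[OF _ nonempty kint_compact_exhaustion[OF inEp_radon[OF \<mu>]] finite, of "e\<^sup>2"] e
    by auto
  have [measurable]: "K \<in> sets borel" by (rule borel_compact[OF K(1)])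
  let ?\<omega> = "restr K \<mu>" and ?\<rho> = "restr (UNIV - K) \<mu>"
  have parts: "inEp \<kappa> ?\<omega>" "inEp \<kappa> ?\<rho>" using \<mu> by (auto intro!: inEp_restr)
  have "restr (K \<union> (UNIV - K)) \<mu> = \<mu>" by (simp add: density_1)
  then have split: "\<mu> = madd ?\<omega> ?\<rho>" using restr_Un[of \<mu> K "UNIV - K"] inEp_sets[OF \<mu>] by auto
  have "kint \<kappa> ?\<omega> ?\<omega> + kint \<kappa> ?\<rho> ?\<rho> \<le> kint \<kappa> \<mu> \<mu>"
    by (subst (5 6) split) (intro kint_madd_self_ge inEp_radon parts)
  also have "\<dots> \<le> kint \<kappa> ?\<omega> ?\<omega> + ennreal (e\<^sup>2)" using K(2) by simp
  finally have "kint \<kappa> ?\<rho> ?\<rho> \<le> ennreal (e\<^sup>2)"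
    using parts(1) by (auto simp: inEp_def ennreal_add_left_cancel_le)
  then have "sqrt (energy ?\<rho> ?\<rho>) \<le> sqrt (e\<^sup>2)" by (intro real_sqrt_le_mono enn2real_leI) auto
  then have "nrm \<kappa> (?\<omega>, madd ?\<omega> ?\<rho>) \<le> e" using e nrm_madd_self[OF parts] by simp
  then show ?thesis using that[OF K(1)] split by simp
qed

end

subsection \<open>The Riesz representation theorem\<close>

lemma Cc_I:
  fixes f :: "'a::t2_space \<Rightarrow> real"
  assumes "continuous_on UNIV f" "compact K" "\<And>x. x \<notin> K \<Longrightarrow> f x = 0"
  shows "f \<in> Cc"
proof -
  have "closure {x. f x \<noteq> 0} \<subseteq> K"
    using assms by (intro closure_minimal) (auto simp: compact_imp_closed)
  then have "compact (closure {x. f x \<noteq> 0})"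
    using compact_Int_closed[OF assms(2) closed_closure, of "{x. f x \<noteq> 0}"] by (simp add: Int_absorb1)
  then show ?thesis using assms by (simp add: Cc_def)
qed

lemma Cc_E:
  assumes "f \<in> Cc"
  obtains K where "continuous_on UNIV f" "compact K" "\<And>x. x \<notin> K \<Longrightarrow> f x = 0"
  using assms closure_subset[of "{x. f x \<noteq> 0}"] unfolding Cc_def by blast

lemma Cc_comp2:
  fixes f g :: "'a::t2_space \<Rightarrow> real"
  assumes f: "f \<in> Cc" and g: "g \<in> Cc" and h: "continuous_on UNIV (\<lambda>x. h (f x) (g x))" and zero: "h 0 0 = 0"
  shows "(\<lambda>x. h (f x) (g x)) \<in> Cc"
proof -
  obtain K where K: "compact K" "\<And>x. x \<notin> K \<Longrightarrow> f x = 0" using Cc_E[OF f] by metis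
  obtain L where L: "compact L" "\<And>x. x \<notin> L \<Longrightarrow> g x = 0" using Cc_E[OF g] by metis
  show ?thesis by (rule Cc_I[OF h compact_Un[OF K(1) L(1)]]) (use K L zero in auto)
qed

lemma Cc_cont: "f \<in> Cc \<Longrightarrow> continuous_on UNIV f"
  by (simp add: Cc_def)

lemma Cc_add: "f \<in> Cc \<Longrightarrow> g \<in> Cc \<Longrightarrow> (\<lambda>x::'a::t2_space. f x + g x) \<in> Cc"
  using Cc_cont[of f] Cc_cont[of g] by (intro Cc_comp2[of f g "(+)"]) (auto intro!: continuous_intros)

lemma Cc_diff: "f \<in> Cc \<Longrightarrow> g \<in> Cc \<Longrightarrow> (\<lambda>x::'a::t2_space. f x - g x) \<in> Cc"
  using Cc_cont[of f] Cc_cont[of g] by (intro Cc_comp2[of f g "(-)"]) (auto intro!: continuous_intros)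

lemma Cc_cmult: "f \<in> Cc \<Longrightarrow> (\<lambda>x::'a::t2_space. c * f x) \<in> Cc"
  using Cc_cont[of f] by (intro Cc_comp2[of f f "\<lambda>a b. c * a"]) (auto intro!: continuous_intros)

lemma Cc_mult_continuous:
  fixes f :: "'a::t2_space \<Rightarrow> real"
  assumes "f \<in> Cc" "continuous_on UNIV h" shows "(\<lambda>x. f x * h x) \<in> Cc"
proof -
  obtain K where K: "compact K" "\<And>x. x \<notin> K \<Longrightarrow> f x = 0" using Cc_E[OF assms(1)] by metis
  show ?thesis
    by (rule Cc_I[OF _ K(1)]) (use K(2) assms(2) Cc_cont[OF assms(1)] in \<open>auto intro: continuous_intros\<close>)
qed

lemma Cc_zero: "(\<lambda>x::'a::t2_space. 0) \<in> Cc"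
  by (rule Cc_I[of _ "{}"]) auto

lemma Cc_min_const: "f \<in> Cc \<Longrightarrow> 0 \<le> c \<Longrightarrow> (\<lambda>x::'a::t2_space. min (f x) c) \<in> Cc"
  using Cc_cont[of f] by (intro Cc_comp2[of f f "\<lambda>a b. min a c"]) (auto intro!: continuous_intros)

lemma Cc_max: "f \<in> Cc \<Longrightarrow> g \<in> Cc \<Longrightarrow> (\<lambda>x::'a::t2_space. max (f x) (g x)) \<in> Cc"
  using Cc_cont[of f] Cc_cont[of g] by (intro Cc_comp2[of f g max]) (auto intro!: continuous_intros)

lemma Cc_pos_neg_parts:
  fixes f :: "'a::t2_space \<Rightarrow> real"
  assumes "f \<in> Cc"
  obtains p n where "p \<in> Cc" "n \<in> Cc" "\<And>x. 0 \<le> p x" "\<And>x. 0 \<le> n x" "\<And>x. f x = p x - n x"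
    "\<And>x. f x = 0 \<Longrightarrow> p x = 0" "\<And>x. f x = 0 \<Longrightarrow> n x = 0"
proof -
  have "(\<lambda>x. max (f x) 0) \<in> Cc" by (intro Cc_max assms Cc_zero)
  moreover have "(\<lambda>x. max (- 1 * f x) 0) \<in> Cc" by (intro Cc_max Cc_cmult assms Cc_zero)
  ultimately show ?thesis by (rule that) auto
qed

lemma Cc_bounded:
  assumes "f \<in> Cc" obtains b where "b \<ge> 0" "\<And>x. \<bar>f x\<bar> \<le> b"
proof -
  obtain K where K: "continuous_on UNIV f" "compact K" "\<And>x. x \<notin> K \<Longrightarrow> f x = 0" using Cc_E[OF assms] by metis
  have "compact (f ` K)" using K by (meson compact_continuous_image continuous_on_subset subset_UNIV)
  then obtain b where b: "\<And>y. y \<in> f ` K \<Longrightarrow> norm y \<le> b" using compact_imp_bounded bounded_iff by metis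
  have "\<bar>f x\<bar> \<le> max b 0" for x using b[of "f x"] K(3)[of x] by (cases "x \<in> K") auto
  then show ?thesis using that[of "max b 0"] by auto
qed

lemma borel_measurable_Cc: "f \<in> Cc \<Longrightarrow> f \<in> borel_measurable borel"
  by (intro borel_measurable_continuous_onI Cc_cont)

lemma integrable_Cc:
  fixes \<nu> :: "'a::t2_space measure"
  assumes \<nu>: "radon \<nu>" and f: "f \<in> Cc" shows "integrable \<nu> f"
proof -
  obtain K where K: "compact K" "\<And>x. x \<notin> K \<Longrightarrow> f x = 0" using Cc_E[OF f] by metis
  obtain b where b: "b \<ge> 0" "\<And>x. \<bar>f x\<bar> \<le> b" using Cc_bounded[OF f] by metis
  have "(\<integral>\<^sup>+ x. ennreal (norm (f x)) \<partial>\<nu>) \<le> (\<integral>\<^sup>+ x. ennreal b * indicator K x \<partial>\<nu>)"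
    using b K by (intro nn_integral_mono) (auto simp: indicator_def intro!: ennreal_leI)
  also have "\<dots> = ennreal b * emeasure \<nu> K"
    using borel_compact[OF K(1)] by (simp add: nn_integral_cmult_indicator sets_radon[OF \<nu>])
  also have "\<dots> < \<infinity>" using emeasure_radon_compact[OF \<nu> K(1)] by (simp add: ennreal_mult_less_top)
  finally show ?thesis by (intro integrableI_bounded borel_measurable_radon[OF \<nu> borel_measurable_Cc[OF f]])
qed

lemma nn_integral_Cc:
  fixes \<nu> :: "'a::t2_space measure"
  assumes "radon \<nu>" "f \<in> Cc" "\<And>x. 0 \<le> f x"
  shows "(\<integral>\<^sup>+ x. ennreal (f x) \<partial>\<nu>) = ennreal (integral\<^sup>L \<nu> f)"
  using assms integrable_Cc by (intro nn_integral_eq_integral) auto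

lemma Hausdorff_space_t2: "Hausdorff_space (euclidean :: 'a::t2_space topology)"
  unfolding Hausdorff_space_def by (simp add: disjnt_def) (metis hausdorff)

lemma completely_regular_locally_compact_t2:
  assumes "locally_compact_space (euclidean :: 'a::t2_space topology)"
  shows "completely_regular_space (euclidean :: 'a topology)"
  using locally_compact_regular_imp_completely_regular_space Hausdorff_space_t2 assms by blast

lemma compact_neighbourhood_within_open:
  fixes K U :: "'a::t2_space set"
  assumes lc: "locally_compact_space (euclidean :: 'a topology)" and K: "compact K" and U: "open U" "K \<subseteq> U"
  obtains W L where "open W" "compact L" "K \<subseteq> W" "W \<subseteq> L" "L \<subseteq> U"
proof -
  have "neighbourhood_base_of (compactin euclidean) (euclidean :: 'a topology)"
    using locally_compact_space_neighbourhood_base Hausdorff_space_t2 lc by blast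
  then have "\<exists>V C. open V \<and> compact C \<and> x \<in> V \<and> V \<subseteq> C \<and> C \<subseteq> U" if "x \<in> K" for x
    using U that by (auto simp: neighbourhood_base_of)
  then obtain V C where V: "\<And>x. x \<in> K \<Longrightarrow> open (V x)" "\<And>x. x \<in> K \<Longrightarrow> x \<in> V x"
    and C: "\<And>x. x \<in> K \<Longrightarrow> compact (C x)" "\<And>x. x \<in> K \<Longrightarrow> V x \<subseteq> C x" "\<And>x. x \<in> K \<Longrightarrow> C x \<subseteq> U" by metis
  have cover: "K \<subseteq> (\<Union>x\<in>K. V x)" using V(2) by blast
  obtain D where D: "D \<subseteq> K" "finite D" "K \<subseteq> (\<Union>x\<in>D. V x)"
    by (rule compactE_image[OF K V(1) cover])
  show ?thesis
  proof
    show "open (\<Union>x\<in>D. V x)" using D(1) V(1) by (intro open_UN) blast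
    show "compact (\<Union>x\<in>D. C x)" using D(1,2) C(1) by (intro compact_UN) auto
    show "(\<Union>x\<in>D. V x) \<subseteq> (\<Union>x\<in>D. C x)" using D(1) C(2) by (intro UN_mono) auto
    show "(\<Union>x\<in>D. C x) \<subseteq> U" using D(1) C(3) by blast
  qed (rule D(3))
qed

lemma urysohn_compact:
  fixes K U :: "'a::t2_space set"
  assumes lc: "locally_compact_space (euclidean :: 'a topology)" and K: "compact K" and U: "open U" "K \<subseteq> U"
  obtains f C where "f \<in> Cc" "\<And>x. 0 \<le> f x" "\<And>x. f x \<le> 1" "\<And>x. x \<in> K \<Longrightarrow> f x = 1"
    "compact C" "C \<subseteq> U" "\<And>x. x \<notin> C \<Longrightarrow> f x = 0"
proof -
  obtain W L where W: "open W" "K \<subseteq> W" and L: "compact L" "W \<subseteq> L" "L \<subseteq> U"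
    using compact_neighbourhood_within_open[OF assms] .
  obtain f where f: "continuous_map euclidean (top_of_set {0..1::real}) f" "f ` (- W) \<subseteq> {0}" "f ` K \<subseteq> {1}"
    using Urysohn_completely_regular_compact_closed[of 0 1 euclidean K "- W"]
      completely_regular_locally_compact_t2[OF lc] K W by (auto simp: disjnt_def)
  have cont: "continuous_on UNIV f" and unit_range: "\<And>x. f x \<in> {0..1}"
    using f(1) by (auto simp: continuous_map_in_subtopology)
  have vanishes: "f x = 0" if "x \<notin> L" for x using that L(2) f(2) by auto
  show ?thesis
    by (rule that[of f L]) (use Cc_I[OF cont L(1) vanishes] unit_range f L vanishes in auto)
qed

definition subordinate :: "'a::topological_space set \<Rightarrow> ('a \<Rightarrow> real) set" where
  "subordinate U = {\<phi>\<in>Cc. (\<forall>x. 0 \<le> \<phi> x \<and> \<phi> x \<le> 1) \<and> (\<exists>K. compact K \<and> K \<subseteq> U \<and> (\<forall>x. x \<notin> K \<longrightarrow> \<phi> x = 0))}"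

lemma subordinateI:
  assumes "\<phi> \<in> Cc" "\<And>x. 0 \<le> \<phi> x" "\<And>x. \<phi> x \<le> 1" "compact K" "K \<subseteq> U" "\<And>x. x \<notin> K \<Longrightarrow> \<phi> x = 0"
  shows "\<phi> \<in> subordinate U"
  using assms unfolding subordinate_def by blast

lemma subordinateE:
  assumes "\<phi> \<in> subordinate U"
  obtains K where "\<phi> \<in> Cc" "\<And>x. 0 \<le> \<phi> x" "\<And>x. \<phi> x \<le> 1" "compact K" "K \<subseteq> U" "\<And>x. x \<notin> K \<Longrightarrow> \<phi> x = 0"
  using assms unfolding subordinate_def by blast

lemma zero_subordinate: "(\<lambda>x::'a::t2_space. 0) \<in> subordinate U"
  by (rule subordinateI[OF Cc_zero, of "{}"]) auto

lemma subordinate_Un_split: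
  fixes U V :: "'a::t2_space set"
  assumes lc: "locally_compact_space (euclidean :: 'a topology)" and U: "open U" and V: "open V"
    and \<phi>: "\<phi> \<in> subordinate (U \<union> V)"
  obtains a b where "a \<in> subordinate U" "b \<in> subordinate V" "\<phi> = (\<lambda>x. a x + b x)"
proof -
  obtain K where \<phi>: "\<phi> \<in> Cc" "\<And>x. 0 \<le> \<phi> x" "\<And>x. \<phi> x \<le> 1" and K: "compact K" "K \<subseteq> U \<union> V"
      "\<And>x. x \<notin> K \<Longrightarrow> \<phi> x = 0"
    using subordinateE[OF \<phi>] by metis
  have "compact (K - V)" "K - V \<subseteq> U" using K V by (auto intro: compact_diff)
  then obtain u C where u: "u \<in> Cc" "\<And>x. 0 \<le> u x" "\<And>x. x \<in> K - V \<Longrightarrow> u x = 1"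
    and C: "compact C" "C \<subseteq> U" "\<And>x. x \<notin> C \<Longrightarrow> u x = 0" using urysohn_compact[OF lc _ U] by metis
  define \<psi> where "\<psi> x = min 1 (2 * u x)" for x
  have cont: "continuous_on UNIV \<psi>" unfolding \<psi>_def by (intro continuous_intros Cc_cont u)
  have \<psi>01: "0 \<le> \<psi> x" "\<psi> x \<le> 1" for x using u by (auto simp: \<psi>_def)
  let ?a = "\<lambda>x. \<phi> x * \<psi> x" and ?b = "\<lambda>x. \<phi> x * (1 - \<psi> x)"
  have "?a \<in> subordinate U"
    using \<phi> \<psi>01 C
    by (intro subordinateI[OF _ _ _ C(1,2)] Cc_mult_continuous cont mult_nonneg_nonneg mult_le_one)
      (auto simp: \<psi>_def)
  moreover have "?b \<in> subordinate V"
  proof (rule subordinateI)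
    show "compact (K \<inter> {x. u x \<le> 1/2})"
      by (intro compact_Int_closed K closed_Collect_le continuous_intros Cc_cont u)
    show "K \<inter> {x. u x \<le> 1/2} \<subseteq> V"
    proof
      fix x assume "x \<in> K \<inter> {x. u x \<le> 1/2}"
      then show "x \<in> V" using u(3)[of x] by (cases "x \<in> V") auto
    qed
    show "?b \<in> Cc" using \<phi>(1) cont by (intro Cc_mult_continuous continuous_intros)
    show "?b x = 0" if "x \<notin> K \<inter> {x. u x \<le> 1/2}" for x
      using that K(3)[of x] by (cases "x \<in> K") (auto simp: \<psi>_def)
    show "0 \<le> ?b x" "?b x \<le> 1" for x using \<phi> \<psi>01[of x] by (auto intro!: mult_le_one)
  qed
  moreover have "\<phi> = (\<lambda>x. ?a x + ?b x)" by (auto simp: algebra_simps)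
  ultimately show ?thesis by (rule that)
qed

definition sandwiched_by :: "(('a::topological_space \<Rightarrow> real) \<Rightarrow> real) \<Rightarrow> ('a set \<Rightarrow> real) \<Rightarrow> bool" where
  "sandwiched_by \<Lambda> m \<longleftrightarrow> (\<forall>\<phi>\<in>Cc. \<forall>S. compact S \<longrightarrow> (\<forall>x. 0 \<le> \<phi> x) \<longrightarrow>
     ((\<forall>x\<in>S. 1 \<le> \<phi> x) \<longrightarrow> m S \<le> \<Lambda> \<phi>) \<and>
     ((\<forall>x. \<phi> x \<le> 1) \<longrightarrow> (\<forall>x. x \<notin> S \<longrightarrow> \<phi> x = 0) \<longrightarrow> \<Lambda> \<phi> \<le> m S))"

locale positive_functional =
  fixes \<Lambda> :: "('a::t2_space \<Rightarrow> real) \<Rightarrow> real"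
  assumes functional_add: "\<And>\<phi> \<psi>. \<phi> \<in> Cc \<Longrightarrow> \<psi> \<in> Cc \<Longrightarrow> \<Lambda> (\<lambda>x. \<phi> x + \<psi> x) = \<Lambda> \<phi> + \<Lambda> \<psi>"
    and functional_cmult: "\<And>\<phi> c. \<phi> \<in> Cc \<Longrightarrow> \<Lambda> (\<lambda>x. c * \<phi> x) = c * \<Lambda> \<phi>"
    and functional_nonneg: "\<And>\<phi>. \<phi> \<in> Cc \<Longrightarrow> (\<And>x. 0 \<le> \<phi> x) \<Longrightarrow> 0 \<le> \<Lambda> \<phi>"
begin

lemma functional_diff: "\<phi> \<in> Cc \<Longrightarrow> \<psi> \<in> Cc \<Longrightarrow> \<Lambda> (\<lambda>x. \<phi> x - \<psi> x) = \<Lambda> \<phi> - \<Lambda> \<psi>"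
  using functional_add[of \<phi> "\<lambda>x. (- 1) * \<psi> x"] functional_cmult[of \<psi> "- 1"] Cc_cmult[of \<psi> "- 1"] by simp

lemma functional_zero: "\<Lambda> (\<lambda>x. 0) = 0"
  using functional_cmult[OF Cc_zero, of 0] by simp

lemma functional_mono: "\<phi> \<in> Cc \<Longrightarrow> \<psi> \<in> Cc \<Longrightarrow> (\<And>x. \<phi> x \<le> \<psi> x) \<Longrightarrow> \<Lambda> \<phi> \<le> \<Lambda> \<psi>"
  using functional_nonneg[of "\<lambda>x. \<psi> x - \<phi> x"] functional_diff[of \<psi> \<phi>] by (simp add: Cc_diff)

lemma functional_sum:
  assumes "\<And>k. s k \<in> Cc"
  shows "(\<lambda>x. \<Sum>k<n::nat. s k x) \<in> Cc \<and> \<Lambda> (\<lambda>x. \<Sum>k<n. s k x) = (\<Sum>k<n. \<Lambda> (s k))"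
  by (induction n) (auto simp: functional_zero functional_add Cc_zero Cc_add assms)

text \<open>Slicing \<open>\<phi>\<close> at the heights \<open>k/N\<close> reduces \<open>\<Lambda> \<phi>\<close> to functions with values in \<open>[0, 1/N]\<close> which are
  constant outside the region between two consecutive superlevel sets.\<close>

lemma functional_slice_bounds:
  assumes m: "sandwiched_by \<Lambda> m" and \<phi>: "\<phi> \<in> Cc" "\<And>x. 0 \<le> \<phi> x" "\<And>x. \<phi> x \<le> 1"
    and K: "compact K" "\<And>x. x \<notin> K \<Longrightarrow> \<phi> x = 0" and N: "N > 0"
  defines "S \<equiv> \<lambda>k. K \<inter> {x. real k / real N \<le> \<phi> x}"
  shows "(\<Sum>k<N. m (S (Suc k))) / real N \<le> \<Lambda> \<phi>" "\<Lambda> \<phi> \<le> (\<Sum>k<N. m (S k)) / real N"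
proof -
  define s where "s k x = min (\<phi> x) (real (Suc k) / real N) - min (\<phi> x) (real k / real N)" for k x
  have compact_S: "compact (S k)" for k
    unfolding S_def by (intro compact_Int_closed K closed_Collect_le continuous_intros Cc_cont \<phi>)
  have s_Cc: "s k \<in> Cc" for k unfolding s_def by (intro Cc_diff Cc_min_const \<phi>) auto
  have scaled_Cc: "(\<lambda>x. real N * s k x) \<in> Cc" for k by (intro Cc_cmult s_Cc)
  have step: "real (Suc k) / real N = real k / real N + 1 / real N" for k by (simp add: add_divide_distrib)
  have "0 \<le> min y (c + d) - min y c \<and> min y (c + d) - min y c \<le> d
      \<and> (c + d \<le> y \<longrightarrow> min y (c + d) - min y c = d)"
    if "0 \<le> d" for y c d :: real using that by (auto simp: min_def)
  from this[of "1 / real N"] have "0 \<le> s k x" "s k x \<le> 1 / real N"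
    and s_one: "x \<in> S (Suc k) \<Longrightarrow> s k x = 1 / real N" for k x
    unfolding s_def S_def step by auto
  then have scaled_range: "0 \<le> real N * s k x" "real N * s k x \<le> 1" for k x
    using N by (auto simp: field_simps)
  have scaled_one: "real N * s k x = 1" if "x \<in> S (Suc k)" for k x
    using s_one[OF that] N by simp
  have scaled_zero: "real N * s k x = 0" if "x \<notin> S k" for k x
  proof -
    have "\<phi> x \<le> real k / real N" using that K(2)[of x] by (cases "x \<in> K") (auto simp: S_def)
    moreover from this have "\<phi> x \<le> real (Suc k) / real N" unfolding step by (rule order_trans) simp
    ultimately show ?thesis by (simp add: s_def)
  qed
  have bounds: "m (S (Suc k)) \<le> real N * \<Lambda> (s k)" "real N * \<Lambda> (s k) \<le> m (S k)" for k
    using m scaled_Cc[of k] compact_S scaled_range scaled_one scaled_zero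
    unfolding sandwiched_by_def functional_cmult[OF s_Cc, symmetric] by (metis order_refl)+
  have "(\<Sum>k<n. s k x) = min (\<phi> x) (real n / real N)" for n x
    using \<phi>(2)[of x] by (induction n) (auto simp: s_def)
  then have "\<phi> = (\<lambda>x. \<Sum>k<N. s k x)" using \<phi>(3) N by auto
  then have "\<Lambda> \<phi> = (\<Sum>k<N. \<Lambda> (s k))" using functional_sum[of s N, OF s_Cc] by simp
  then have slices: "real N * \<Lambda> \<phi> = (\<Sum>k<N. real N * \<Lambda> (s k))" by (simp add: sum_distrib_left)
  have "(\<Sum>k<N. m (S (Suc k))) \<le> real N * \<Lambda> \<phi>" unfolding slices by (intro sum_mono bounds)
  moreover have "real N * \<Lambda> \<phi> \<le> (\<Sum>k<N. m (S k))" unfolding slices by (intro sum_mono bounds)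
  ultimately show "(\<Sum>k<N. m (S (Suc k))) / real N \<le> \<Lambda> \<phi>" "\<Lambda> \<phi> \<le> (\<Sum>k<N. m (S k)) / real N"
    using N by (auto simp: field_simps)
qed

end

lemma positive_functionals_agree_unit_interval:
  assumes J: "positive_functional J" "sandwiched_by J m" and L: "positive_functional L" "sandwiched_by L m"
    and \<phi>: "\<phi> \<in> Cc" "\<And>x. 0 \<le> \<phi> x" "\<And>x. \<phi> x \<le> 1"
  shows "J \<phi> = L \<phi>"
proof -
  obtain K where K: "compact K" "\<And>x. x \<notin> K \<Longrightarrow> \<phi> x = 0" using Cc_E[OF \<phi>(1)] by metis
  have m_nonneg: "0 \<le> m S" if "compact S" for S
    using J(2) that Cc_zero positive_functional.functional_zero[OF J(1)] unfolding sandwiched_by_def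
    by fastforce
  have bound: "\<bar>J \<phi> - L \<phi>\<bar> \<le> m K / real N" if N: "N > 0" for N
  proof -
    define S where "S k = K \<inter> {x. real k / real N \<le> \<phi> x}" for k
    have "compact (S N)"
      unfolding S_def by (intro compact_Int_closed K closed_Collect_le continuous_intros Cc_cont \<phi>)
    note J_bounds = positive_functional.functional_slice_bounds[OF J \<phi> K N, folded S_def]
      and L_bounds = positive_functional.functional_slice_bounds[OF L \<phi> K N, folded S_def]
    have "\<bar>J \<phi> - L \<phi>\<bar> \<le> (\<Sum>k<N. m (S k)) / real N - (\<Sum>k<N. m (S (Suc k))) / real N"
      using J_bounds L_bounds by linarith
    also have "\<dots> = (\<Sum>k<N. m (S k) - m (S (Suc k))) / real N"
      by (simp add: sum_subtractf diff_divide_distrib)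
    also have "\<dots> = (m (S 0) - m (S N)) / real N" using sum_lessThan_telescope'[of "\<lambda>k. m (S k)" N] by simp
    also have "\<dots> \<le> m K / real N"
      using m_nonneg[OF \<open>compact (S N)\<close>] \<phi>(2) by (intro divide_right_mono) (auto simp: S_def)
    finally show ?thesis .
  qed
  have "(\<lambda>n. m K / real (Suc n)) \<longlonglongrightarrow> 0" using LIMSEQ_Suc[OF lim_const_over_n[of "m K"]] by simp
  then have "\<bar>J \<phi> - L \<phi>\<bar> \<le> 0"
    using bound[of "Suc n" for n] by (intro LIMSEQ_le_const[where X="\<lambda>n. m K / real (Suc n)"]) blast+
  then show ?thesis by simp
qed

lemma positive_functionals_agree:
  assumes J: "positive_functional J" "sandwiched_by J m" and L: "positive_functional L" "sandwiched_by L m"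
    and \<phi>: "\<phi> \<in> Cc"
  shows "J \<phi> = L \<phi>"
proof -
  interpret J: positive_functional J by (rule J)
  interpret L: positive_functional L by (rule L)
  have agree: "J \<psi> = L \<psi>" if \<psi>: "\<psi> \<in> Cc" "\<And>x. 0 \<le> \<psi> x" for \<psi>
  proof -
    obtain b where b: "b \<ge> 0" "\<And>x. \<bar>\<psi> x\<bar> \<le> b" using Cc_bounded[OF \<psi>(1)] by metis
    let ?c = "1 / (b + 1)"
    have "\<psi> x \<le> b + 1" for x using b(2)[of x] by linarith
    then have "J (\<lambda>x. ?c * \<psi> x) = L (\<lambda>x. ?c * \<psi> x)"
      using b(1) \<psi> by (intro positive_functionals_agree_unit_interval[OF J L] Cc_cmult) auto
    then have "?c * J \<psi> = ?c * L \<psi>" by (simp only: J.functional_cmult L.functional_cmult \<psi>(1))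
    then show ?thesis using b(1) by simp
  qed
  obtain p n where pn: "p \<in> Cc" "n \<in> Cc" "\<And>x. 0 \<le> p x" "\<And>x. 0 \<le> n x" "\<And>x. \<phi> x = p x - n x"
    using Cc_pos_neg_parts[OF \<phi>] by metis
  have "\<phi> = (\<lambda>x. p x - n x)" using pn(5) by auto
  then show ?thesis by (simp add: J.functional_diff L.functional_diff agree pn(1-4))
qed

lemma positive_functional_integral:
  fixes \<nu> :: "'a::t2_space measure"
  assumes "radon \<nu>" shows "positive_functional (integral\<^sup>L \<nu>)"
  using integrable_Cc[OF assms] by unfold_locales auto

lemma sandwiched_by_measure:
  fixes \<nu> :: "'a::t2_space measure"
  assumes \<nu>: "radon \<nu>" shows "sandwiched_by (integral\<^sup>L \<nu>) (measure \<nu>)"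
  unfolding sandwiched_by_def
proof (intro ballI allI impI conjI)
  fix \<phi> :: "'a \<Rightarrow> real" and S :: "'a set" assume \<phi>: "\<phi> \<in> Cc" "\<forall>x. 0 \<le> \<phi> x" and S: "compact S"
  have [simp]: "S \<in> sets \<nu>" using borel_compact[OF S] by (simp add: sets_radon[OF \<nu>])
  have indicator: "integrable \<nu> (indicator S :: 'a \<Rightarrow> real)" "integral\<^sup>L \<nu> (indicator S) = measure \<nu> S"
    using emeasure_radon_compact[OF \<nu> S] by (simp_all add: integrable_indicator_iff space_radon[OF \<nu>])
  show "measure \<nu> S \<le> integral\<^sup>L \<nu> \<phi>" if "\<forall>x\<in>S. 1 \<le> \<phi> x"
    unfolding indicator(2)[symmetric] using that \<phi>
    by (intro integral_mono indicator integrable_Cc[OF \<nu>]) (auto simp: indicator_def)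
  show "integral\<^sup>L \<nu> \<phi> \<le> measure \<nu> S" if "\<forall>x. \<phi> x \<le> 1" "\<forall>x. x \<notin> S \<longrightarrow> \<phi> x = 0"
    unfolding indicator(2)[symmetric] using that \<phi>
    by (intro integral_mono indicator integrable_Cc[OF \<nu>]) (auto simp: indicator_def)
qed

context positive_functional
begin

definition content :: "'a set \<Rightarrow> ennreal" where
  "content U = (SUP \<phi>\<in>subordinate U. ennreal (\<Lambda> \<phi>))"

definition outer :: "'a set \<Rightarrow> ennreal" where
  "outer E = (INF U\<in>{U. open U \<and> E \<subseteq> U}. content U)"

definition riesz_measure :: "'a measure" where
  "riesz_measure = measure_of UNIV (sets borel) outer"

lemma content_mono: "U \<subseteq> V \<Longrightarrow> content U \<le> content V"
  unfolding content_def subordinate_def by (intro SUP_subset_mono) auto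

lemma le_content: "\<phi> \<in> subordinate U \<Longrightarrow> ennreal (\<Lambda> \<phi>) \<le> content U"
  unfolding content_def by (rule SUP_upper)

lemma outer_open: "open U \<Longrightarrow> outer U = content U"
  unfolding outer_def by (intro antisym INF_lower INF_greatest content_mono) auto

lemma outer_mono: "E \<subseteq> F \<Longrightarrow> outer E \<le> outer F"
  unfolding outer_def by (intro INF_superset_mono) auto

lemma outer_approx:
  assumes "outer E < \<infinity>" "e > 0"
  shows "\<exists>U. open U \<and> E \<subseteq> U \<and> content U \<le> outer E + ennreal e"
  using INF_approx_ennreal[OF assms(2) outer_def[of E]] assms(1) by (auto simp: less_top intro: less_imp_le)

lemma content_empty: "content {} = 0"
proof -
  have "\<Lambda> \<phi> = 0" if "\<phi> \<in> subordinate {}" for \<phi>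
  proof -
    have "\<phi> = (\<lambda>x. 0)" using that by (auto simp: subordinate_def)
    then show ?thesis by (simp add: functional_zero)
  qed
  then show ?thesis unfolding content_def by (intro antisym SUP_least) auto
qed

lemma ennreal_functional_add:
  assumes "\<phi> \<in> subordinate U" "\<psi> \<in> subordinate V"
  shows "ennreal (\<Lambda> (\<lambda>x. \<phi> x + \<psi> x)) = ennreal (\<Lambda> \<phi>) + ennreal (\<Lambda> \<psi>)"
proof -
  have "\<phi> \<in> Cc" "\<psi> \<in> Cc" "0 \<le> \<Lambda> \<phi>" "0 \<le> \<Lambda> \<psi>"
    using assms by (auto simp: subordinate_def functional_nonneg)
  then show ?thesis by (simp add: functional_add)
qed

lemma le_outer:
  assumes "\<psi> \<in> Cc" "\<And>x. 0 \<le> \<psi> x" "\<And>x. \<psi> x \<le> 1" "compact S" "\<And>x. x \<notin> S \<Longrightarrow> \<psi> x = 0"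
  shows "ennreal (\<Lambda> \<psi>) \<le> outer S"
  unfolding outer_def using assms by (intro INF_greatest le_content subordinateI) auto

lemma outer_le:
  assumes \<psi>: "\<psi> \<in> Cc" "\<And>x. 0 \<le> \<psi> x" and S: "\<And>x. x \<in> S \<Longrightarrow> 1 \<le> \<psi> x"
  shows "outer S \<le> ennreal (\<Lambda> \<psi>)"
proof -
  have scaled: "ennreal t * outer S \<le> ennreal (\<Lambda> \<psi>)" if t: "0 < t" "t < 1" for t
  proof -
    have "outer S \<le> content {x. t < \<psi> x}"
      unfolding outer_def using S t
      by (intro INF_lower) (force intro: less_le_trans open_Collect_less continuous_intros Cc_cont \<psi>)
    then have "ennreal t * outer S \<le> ennreal t * content {x. t < \<psi> x}" by (rule mult_left_mono) simp
    also have "\<dots> = (SUP \<phi>\<in>subordinate {x. t < \<psi> x}. ennreal t * ennreal (\<Lambda> \<phi>))"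
      unfolding content_def by (rule SUP_mult_left_ennreal)
    also have "\<dots> \<le> ennreal (\<Lambda> \<psi>)"
    proof (rule SUP_least)
      fix \<phi> assume "\<phi> \<in> subordinate {x. t < \<psi> x}"
      then obtain K where \<phi>: "\<phi> \<in> Cc" "\<And>x. \<phi> x \<le> 1" "K \<subseteq> {x. t < \<psi> x}" "\<And>x. x \<notin> K \<Longrightarrow> \<phi> x = 0"
        by (metis subordinateE)
      have "t * \<phi> x \<le> \<psi> x" for x
      proof (cases "x \<in> K")
        case True
        have "t * \<phi> x \<le> t" using \<phi>(2)[of x] t by (simp add: mult_left_le)
        also have "t \<le> \<psi> x" using True \<phi>(3) by auto
        finally show ?thesis .
      qed (use \<phi>(4) \<psi>(2) in simp)
      then have "t * \<Lambda> \<phi> \<le> \<Lambda> \<psi>"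
        using functional_mono[OF Cc_cmult[OF \<phi>(1)] \<psi>(1)] functional_cmult[OF \<phi>(1)] by metis
      then show "ennreal t * ennreal (\<Lambda> \<phi>) \<le> ennreal (\<Lambda> \<psi>)"
        using t by (simp add: ennreal_mult'[symmetric] ennreal_leI)
    qed
    finally show ?thesis .
  qed
  show ?thesis
  proof (cases "outer S")
    case (real r)
    have "t * r \<le> \<Lambda> \<psi>" if "0 < t" "t < 1" for t
      using scaled[OF that] real that functional_nonneg[OF \<psi>]
      by (simp add: ennreal_mult'[symmetric] ennreal_le_iff)
    then have "r \<le> \<Lambda> \<psi>" by (rule field_le_mult_one_interval)
    then show ?thesis using real by (simp add: ennreal_leI)
  next
    case top
    then show ?thesis using scaled[of "1/2"] by (simp add: ennreal_mult_top top_unique)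
  qed
qed

end

locale riesz_functional = positive_functional +
  assumes locally_compact: "locally_compact_space (euclidean :: 'a::t2_space topology)"
begin

lemma content_Un:
  assumes "open U" "open V" shows "content (U \<union> V) \<le> content U + content V"
  unfolding content_def[of "U \<union> V"]
proof (rule SUP_least)
  fix \<phi> assume "\<phi> \<in> subordinate (U \<union> V)"
  then obtain a b where "a \<in> subordinate U" "b \<in> subordinate V" "\<phi> = (\<lambda>x. a x + b x)"
    using subordinate_Un_split[OF locally_compact assms] by metis
  then show "ennreal (\<Lambda> \<phi>) \<le> content U + content V"
    by (simp add: ennreal_functional_add add_mono le_content)
qed

lemma content_UN_finite:
  "finite F \<Longrightarrow> (\<And>i. i \<in> F \<Longrightarrow> open (U i)) \<Longrightarrow> content (\<Union>i\<in>F. U i) \<le> (\<Sum>i\<in>F. content (U i))"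
proof (induction F rule: finite_induct)
  case empty then show ?case by (simp add: content_empty)
next
  case (insert i F)
  have "content (\<Union>j\<in>insert i F. U j) \<le> content (U i) + content (\<Union>j\<in>F. U j)"
    using insert by (simp add: content_Un open_UN)
  also have "\<dots> \<le> content (U i) + (\<Sum>j\<in>F. content (U j))" using insert by (intro add_left_mono) auto
  finally show ?case using insert by simp
qed

lemma content_UN:
  assumes U: "\<And>n::nat. open (U n)" shows "content (\<Union>n. U n) \<le> (\<Sum>n. content (U n))"
  unfolding content_def[of "\<Union>n. U n"]
proof (rule SUP_least)
  fix \<phi> assume "\<phi> \<in> subordinate (\<Union>n. U n)"
  then obtain K where \<phi>: "\<phi> \<in> Cc" "\<And>x. 0 \<le> \<phi> x" "\<And>x. \<phi> x \<le> 1" "compact K" "K \<subseteq> (\<Union>n. U n)"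
      "\<And>x. x \<notin> K \<Longrightarrow> \<phi> x = 0"
    by (metis subordinateE)
  obtain F where F: "finite F" "K \<subseteq> (\<Union>n\<in>F. U n)" using compactE_image[OF \<phi>(4), of UNIV U] U \<phi>(5) by metis
  have "ennreal (\<Lambda> \<phi>) \<le> content (\<Union>n\<in>F. U n)" using \<phi> F by (intro le_content subordinateI) auto
  also have "\<dots> \<le> (\<Sum>n\<in>F. content (U n))" using content_UN_finite[OF F(1)] U by blast
  also have "\<dots> \<le> (\<Sum>n. content (U n))" using F by (intro sum_le_suminf) auto
  finally show "ennreal (\<Lambda> \<phi>) \<le> (\<Sum>n. content (U n))" .
qed

lemma outer_UN_le:
  fixes A :: "nat \<Rightarrow> 'a set" shows "outer (\<Union>n. A n) \<le> (\<Sum>n. outer (A n))"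
proof (rule ennreal_le_epsilon)
  fix e :: real assume finite: "(\<Sum>n. outer (A n)) < top" and e: "0 < e"
  have "\<exists>U. open U \<and> A n \<subseteq> U \<and> content U \<le> outer (A n) + ennreal (e * (1/2) ^ Suc n)" for n
    using finite e by (intro outer_approx) (auto dest: ennreal_suminf_lessD)
  then obtain U where U: "\<And>n. open (U n)" "\<And>n. A n \<subseteq> U n"
      "\<And>n. content (U n) \<le> outer (A n) + ennreal (e * (1/2) ^ Suc n)"
    by metis
  have "outer (\<Union>n. A n) \<le> content (\<Union>n. U n)" unfolding outer_def using U by (intro INF_lower) auto
  also have "\<dots> \<le> (\<Sum>n. content (U n))" using U by (intro content_UN)
  also have "\<dots> \<le> (\<Sum>n. outer (A n) + ennreal (e * (1/2) ^ Suc n))" by (intro suminf_le U) auto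
  also have "\<dots> = (\<Sum>n. outer (A n)) + (\<Sum>n. ennreal (e * (1/2) ^ Suc n))" by (rule suminf_add[symmetric]) auto
  also have "(\<Sum>n. ennreal (e * (1/2) ^ Suc n)) = ennreal e" using e by (intro suminf_half_powers) simp
  finally show "outer (\<Union>n. A n) \<le> (\<Sum>n. outer (A n)) + ennreal e" .
qed

lemma outer_measure_space_outer: "outer_measure_space (Pow UNIV) outer"
  unfolding outer_measure_space_def positive_def increasing_def countably_subadditive_def
  by (auto simp: outer_open content_empty outer_mono outer_UN_le)

lemma outer_disjoint_Un_le:
  assumes "E \<inter> F = {}" shows "outer (E \<union> F) \<le> outer E + outer F"
proof -
  interpret sigma_algebra UNIV "Pow (UNIV :: 'a set)" by (rule sigma_algebra_Pow)
  have "subadditive (Pow UNIV) outer"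
    using outer_measure_space_outer
    by (intro countably_subadditive_subadditive) (auto simp: outer_measure_space_def)
  then show ?thesis by (rule subadditiveD) (use assms in auto)
qed

lemma functional_add_outer_le_content:
  assumes V: "open V" and \<phi>: "\<phi> \<in> subordinate (V \<inter> U)"
  shows "ennreal (\<Lambda> \<phi>) + outer (V - U) \<le> content V"
proof -
  obtain K where \<phi>_props: "\<phi> \<in> Cc" "\<And>x. 0 \<le> \<phi> x" "\<And>x. \<phi> x \<le> 1" and K: "compact K" "K \<subseteq> V \<inter> U"
      "\<And>x. x \<notin> K \<Longrightarrow> \<phi> x = 0"
    using subordinateE[OF \<phi>] by metis
  have "ennreal (\<Lambda> \<phi>) + ennreal (\<Lambda> \<psi>) \<le> content V" if \<psi>: "\<psi> \<in> subordinate (V - K)" for \<psi>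
  proof -
    obtain L where \<psi>_props: "\<psi> \<in> Cc" "\<And>x. 0 \<le> \<psi> x" "\<And>x. \<psi> x \<le> 1" and L: "compact L" "L \<subseteq> V - K"
        "\<And>x. x \<notin> L \<Longrightarrow> \<psi> x = 0"
      using subordinateE[OF \<psi>] by metis
    have "\<phi> x + \<psi> x \<le> 1" for x
      using \<phi>_props(3)[of x] \<psi>_props(3)[of x] K(3)[of x] L(2,3) by (cases "x \<in> K") fastforce+
    then have "(\<lambda>x. \<phi> x + \<psi> x) \<in> subordinate V"
      using \<phi>_props \<psi>_props K L by (intro subordinateI[where K="K \<union> L"] Cc_add compact_Un) auto
    from le_content[OF this] show ?thesis by (simp add: ennreal_functional_add[OF \<phi> \<psi>])
  qed
  then have "ennreal (\<Lambda> \<phi>) + content (V - K) \<le> content V"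
    unfolding content_def[of "V - K"] using zero_subordinate[of "V - K"]
    by (subst ennreal_SUP_add_right) (auto intro!: SUP_least)
  moreover have "outer (V - U) \<le> content (V - K)"
    using outer_mono[of "V - U" "V - K"] outer_open[of "V - K"] V K
    by (auto simp: open_Diff compact_imp_closed)
  ultimately show ?thesis by (meson add_left_mono order_trans)
qed

lemma open_caratheodory:
  assumes U: "open U" shows "outer (U \<inter> E) + outer ((UNIV - U) \<inter> E) = outer E"
proof (rule antisym)
  have "outer (U \<inter> E) + outer ((UNIV - U) \<inter> E) \<le> content V" if V: "open V" "E \<subseteq> V" for V
  proof -
    have "outer (U \<inter> E) \<le> content (V \<inter> U)"
      using outer_mono[of "U \<inter> E" "V \<inter> U"] outer_open[OF open_Int[OF V(1) U]] V(2) by auto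
    moreover have "outer ((UNIV - U) \<inter> E) \<le> outer (V - U)" using V by (intro outer_mono) auto
    moreover have "content (V \<inter> U) + outer (V - U) \<le> content V"
      unfolding content_def[of "V \<inter> U"] using zero_subordinate[of "V \<inter> U"]
        functional_add_outer_le_content[OF V(1)]
      by (subst ennreal_SUP_add_left[symmetric]) (auto intro!: SUP_least)
    ultimately show ?thesis by (meson add_mono order_trans)
  qed
  then show "outer (U \<inter> E) + outer ((UNIV - U) \<inter> E) \<le> outer E"
    unfolding outer_def[of E] by (intro INF_greatest) auto
  have "U \<inter> E \<union> (UNIV - U) \<inter> E = E" by auto
  then show "outer E \<le> outer (U \<inter> E) + outer ((UNIV - U) \<inter> E)"
    using outer_disjoint_Un_le[of "U \<inter> E" "(UNIV - U) \<inter> E"] by auto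
qed

lemma sets_riesz[simp]: "sets riesz_measure = sets borel"
  unfolding riesz_measure_def using sets.sigma_sets_eq[of borel] by (simp add: sets_measure_of_conv)

lemma emeasure_riesz:
  assumes "B \<in> sets borel" shows "emeasure riesz_measure B = outer B"
proof -
  interpret sigma_algebra UNIV "Pow (UNIV :: 'a set)" by (rule sigma_algebra_Pow)
  let ?L = "lambda_system UNIV (Pow UNIV) outer"
  have "measure_space UNIV ?L outer" using caratheodory_lemma[OF outer_measure_space_outer] .
  then have sigma: "sigma_algebra UNIV ?L" and additive: "countably_additive ?L outer"
    by (auto simp: measure_space_def)
  have "open U \<Longrightarrow> U \<in> ?L" for U by (simp add: lambda_system_def open_caratheodory)
  then have "sigma_sets UNIV {U. open U} \<subseteq> ?L"
    by (intro sigma_algebra.sigma_sets_subset[OF sigma]) auto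
  then have "sets borel \<subseteq> ?L" by (simp add: borel_def)
  then have "countably_additive (sets borel) outer"
    using additive unfolding countably_additive_def by (meson order_trans subsetD)
  then show ?thesis
    unfolding riesz_measure_def using assms sets.sigma_algebra_axioms[of borel]
    by (intro emeasure_measure_of_sigma) (auto simp: positive_def outer_open content_empty)
qed

lemma outer_compact_finite:
  assumes "compact K" shows "outer K < \<infinity>"
proof -
  obtain f C where f: "f \<in> Cc" "\<And>x. 0 \<le> f x" "\<And>x. x \<in> K \<Longrightarrow> f x = 1"
    using urysohn_compact[OF locally_compact assms open_UNIV subset_UNIV] by metis
  then have "outer K \<le> ennreal (\<Lambda> f)" by (intro outer_le) auto
  then show ?thesis by (auto intro: le_less_trans)
qed

lemma radon_riesz: "radon riesz_measure"
proof (rule radonI)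
  show "emeasure riesz_measure K < \<infinity>" if "compact K" for K
    using that outer_compact_finite by (simp add: emeasure_riesz borel_compact)
  show "\<exists>U. open U \<and> B \<subseteq> U \<and> emeasure riesz_measure U \<le> emeasure riesz_measure B + ennreal e"
    if "B \<in> sets borel" "emeasure riesz_measure B < \<infinity>" "e > 0" for B e
    using outer_approx[of B e] that by (auto simp: emeasure_riesz outer_open)
  show "emeasure riesz_measure U \<le> (SUP K\<in>{K. compact K \<and> K \<subseteq> U}. emeasure riesz_measure K)"
    if U: "open U" for U
  proof -
    have "ennreal (\<Lambda> \<phi>) \<le> (SUP K\<in>{K. compact K \<and> K \<subseteq> U}. emeasure riesz_measure K)"
      if \<phi>: "\<phi> \<in> subordinate U" for \<phi>
    proof -
      obtain K where "\<phi> \<in> Cc" "\<And>x. 0 \<le> \<phi> x" "\<And>x. \<phi> x \<le> 1" "compact K" "K \<subseteq> U" "\<And>x. x \<notin> K \<Longrightarrow> \<phi> x = 0"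
        using subordinateE[OF \<phi>] by metis
      then show ?thesis
        using le_outer[of \<phi> K] by (intro SUP_upper2[of K]) (auto simp: emeasure_riesz borel_compact)
    qed
    then show ?thesis using U by (simp add: emeasure_riesz outer_open content_def SUP_least)
  qed
qed simp

lemma sandwiched_by_riesz: "sandwiched_by \<Lambda> (measure riesz_measure)"
  unfolding sandwiched_by_def
proof (intro ballI allI impI conjI)
  fix \<phi> :: "'a \<Rightarrow> real" and S :: "'a set" assume \<phi>: "\<phi> \<in> Cc" "\<forall>x. 0 \<le> \<phi> x" and S: "compact S"
  have "ennreal (measure riesz_measure S) = emeasure riesz_measure S"
    using emeasure_radon_compact[OF radon_riesz S] by (intro emeasure_eq_ennreal_measure[symmetric]) auto
  then have measure: "ennreal (measure riesz_measure S) = outer S"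
    using borel_compact[OF S] by (simp add: emeasure_riesz)
  show "measure riesz_measure S \<le> \<Lambda> \<phi>" if "\<forall>x\<in>S. 1 \<le> \<phi> x"
    using outer_le[of \<phi> S] that \<phi> functional_nonneg[OF \<phi>(1)]
    by (simp add: measure[symmetric] ennreal_le_iff)
  show "\<Lambda> \<phi> \<le> measure riesz_measure S" if "\<forall>x. \<phi> x \<le> 1" "\<forall>x. x \<notin> S \<longrightarrow> \<phi> x = 0"
    using le_outer[of \<phi> S] that \<phi> S by (simp add: measure[symmetric] ennreal_le_iff)
qed

theorem riesz_representation: "\<exists>\<nu>. radon \<nu> \<and> (\<forall>\<phi>\<in>Cc. integral\<^sup>L \<nu> \<phi> = \<Lambda> \<phi>)"
  using positive_functionals_agree[OF positive_functional_integral[OF radon_riesz]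
      sandwiched_by_measure[OF radon_riesz]
      positive_functional_axioms sandwiched_by_riesz] radon_riesz by blast

end

subsection \<open>Vague limits\<close>

lemma compact_superlevel_margin:
  fixes f :: "'a::topological_space \<Rightarrow> ennreal"
  assumes f: "lsc f" and c: "c < top" and K: "compact K" "K \<subseteq> {x. c < f x}"
  obtains q where "c < ennreal q" "0 \<le> q" "K \<subseteq> {x. ennreal q < f x}"
proof -
  have "\<exists>d\<in>{c<..<top}. K \<subseteq> {x. d < f x}"
  proof (rule compact_subset_directed_Union[OF K(1)])
    show "K \<subseteq> (\<Union>d\<in>{c<..<top}. {x. d < f x})"
    proof
      fix x assume "x \<in> K"
      then obtain d where "c < d" "d < f x" using K(2) dense by blast
      then show "x \<in> (\<Union>d\<in>{c<..<top}. {x. d < f x})" using less_le_trans[of d "f x" top] by auto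
    qed
    show "{c<..<top} \<noteq> {}" using dense[OF c] by auto
    show "open {x. d < f x}" for d by (rule lsc_open[OF f])
    fix d d' assume "d \<in> {c<..<top}" "d' \<in> {c<..<top}"
    then show "\<exists>e\<in>{c<..<top}. {x. d < f x} \<subseteq> {x. e < f x} \<and> {x. d' < f x} \<subseteq> {x. e < f x}"
      by (intro bexI[of _ "min d d'"]) (auto simp: min_less_iff_disj min_def)
  qed
  then obtain d where d: "c < d" "d < top" "K \<subseteq> {x. d < f x}" by auto
  then show ?thesis using that by (cases d) auto
qed

lemma Cc_minorant_above:
  fixes f :: "'a::t2_space \<Rightarrow> ennreal"
  assumes lc: "locally_compact_space (euclidean :: 'a topology)" and f: "lsc f" and c: "c < top"
    and K: "compact K" "K \<subseteq> {x. c < f x}"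
  obtains \<phi> where "\<phi> \<in> Cc" "\<And>x. 0 \<le> \<phi> x" "\<And>x. ennreal (\<phi> x) \<le> f x" "\<And>x. x \<in> K \<Longrightarrow> c < ennreal (\<phi> x)"
proof -
  obtain q where q: "c < ennreal q" "0 \<le> q" "K \<subseteq> {x. ennreal q < f x}"
    using compact_superlevel_margin[OF f c K] .
  obtain u C where u: "u \<in> Cc" "\<And>x. 0 \<le> u x" "\<And>x. u x \<le> 1" "\<And>x. x \<in> K \<Longrightarrow> u x = 1"
    and C: "C \<subseteq> {x. ennreal q < f x}" "\<And>x. x \<notin> C \<Longrightarrow> u x = 0"
    using urysohn_compact[OF lc K(1) lsc_open[OF f] q(3)] by metis
  show ?thesis
  proof (rule that[of "\<lambda>x. q * u x"])
    show "ennreal (q * u x) \<le> f x" for x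
    proof (cases "x \<in> C")
      case True
      have "ennreal (q * u x) \<le> ennreal q"
        using q(2) u(2,3)[of x] by (intro ennreal_leI) (simp add: mult_left_le)
      also have "\<dots> \<le> f x" using C(1) True by auto
      finally show ?thesis .
    qed (simp add: C)
  qed (use u q in \<open>auto intro: Cc_cmult\<close>)
qed

lemma nn_integral_lsc_eq_SUP_Cc:
  fixes f :: "'a::t2_space \<Rightarrow> ennreal"
  assumes lc: "locally_compact_space (euclidean :: 'a topology)" and \<nu>: "radon \<nu>" and f: "lsc f"
  shows "(\<integral>\<^sup>+ x. f x \<partial>\<nu>) = (SUP \<phi>\<in>{\<phi>\<in>Cc. \<forall>x. 0 \<le> \<phi> x \<and> ennreal (\<phi> x) \<le> f x}. \<integral>\<^sup>+ x. ennreal (\<phi> x) \<partial>\<nu>)"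
    (is "_ = (SUP \<phi>\<in>?D. _)")
proof (rule antisym)
  show "(\<integral>\<^sup>+ x. f x \<partial>\<nu>) \<le> (SUP \<phi>\<in>?D. \<integral>\<^sup>+ x. ennreal (\<phi> x) \<partial>\<nu>)"
  proof (rule nn_integral_lsc_le_SUP[OF \<nu> f])
    show "?D \<noteq> {}" using Cc_zero by (auto intro!: exI[of _ "\<lambda>x. 0"])
    show "(\<lambda>x. ennreal (\<phi> x)) \<in> borel_measurable borel" if "\<phi> \<in> ?D" for \<phi>
    proof -
      have [measurable]: "\<phi> \<in> borel_measurable borel" using that by (intro borel_measurable_Cc) simp
      show ?thesis by measurable
    qed
    fix \<phi> \<psi> assume D: "\<phi> \<in> ?D" "\<psi> \<in> ?D"
    show "\<exists>\<eta>\<in>?D. (\<lambda>x. ennreal (\<phi> x)) \<le> (\<lambda>x. ennreal (\<eta> x)) \<and> (\<lambda>x. ennreal (\<psi> x)) \<le> (\<lambda>x. ennreal (\<eta> x))"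
    proof (rule bexI[of _ "\<lambda>x. max (\<phi> x) (\<psi> x)"])
      show "(\<lambda>x. max (\<phi> x) (\<psi> x)) \<in> ?D" using D by (intro CollectI conjI Cc_max) (auto simp: max_def)
    qed (auto simp: le_fun_def intro!: ennreal_leI)
  next
    fix c K assume "c < top" "compact K" "K \<subseteq> {x. c < f x}"
    then obtain \<phi> where "\<phi> \<in> Cc" "\<And>x. 0 \<le> \<phi> x" "\<And>x. ennreal (\<phi> x) \<le> f x" "\<And>x. x \<in> K \<Longrightarrow> c < ennreal (\<phi> x)"
      using Cc_minorant_above[OF lc f] by metis
    then show "\<exists>\<phi>\<in>?D. K \<subseteq> {x. c < ennreal (\<phi> x)}" by (intro bexI[of _ \<phi>]) auto
  qed
  show "(SUP \<phi>\<in>?D. \<integral>\<^sup>+ x. ennreal (\<phi> x) \<partial>\<nu>) \<le> (\<integral>\<^sup>+ x. f x \<partial>\<nu>)"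
    by (intro SUP_least nn_integral_mono) auto
qed

definition vaguely_tendsto :: "('v \<Rightarrow> 'a::topological_space measure) \<Rightarrow> 'a measure \<Rightarrow> 'v filter \<Rightarrow> bool" where
  "vaguely_tendsto M \<nu> G \<longleftrightarrow> (\<forall>\<phi>\<in>Cc. ((\<lambda>v. integral\<^sup>L (M v) \<phi>) \<longlongrightarrow> integral\<^sup>L \<nu> \<phi>) G)"

lemma vaguely_tendstoD:
  "vaguely_tendsto M \<nu> G \<Longrightarrow> \<phi> \<in> Cc \<Longrightarrow> ((\<lambda>v. integral\<^sup>L (M v) \<phi>) \<longlongrightarrow> integral\<^sup>L \<nu> \<phi>) G"
  by (simp add: vaguely_tendsto_def)

lemma vague_limit_lsc_le:
  fixes f :: "'a::t2_space \<Rightarrow> ennreal"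
  assumes lc: "locally_compact_space (euclidean :: 'a topology)" and \<nu>: "radon \<nu>" and f: "lsc f"
    and G: "G \<noteq> bot" and M: "\<forall>\<^sub>F v in G. radon (M v) \<and> (\<integral>\<^sup>+ x. f x \<partial>M v) \<le> b"
    and vague: "vaguely_tendsto M \<nu> G"
  shows "(\<integral>\<^sup>+ x. f x \<partial>\<nu>) \<le> b"
  unfolding nn_integral_lsc_eq_SUP_Cc[OF lc \<nu> f]
proof (rule SUP_least, elim CollectE conjE)
  fix \<phi> :: "'a \<Rightarrow> real" assume \<phi>: "\<phi> \<in> Cc" "\<forall>x. 0 \<le> \<phi> x \<and> ennreal (\<phi> x) \<le> f x"
  have integral: "(\<integral>\<^sup>+ x. ennreal (\<phi> x) \<partial>\<mu>) = ennreal (integral\<^sup>L \<mu> \<phi>)" if "radon \<mu>" for \<mu>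
    using \<phi> by (intro nn_integral_Cc that) auto
  have limit: "((\<lambda>v. ennreal (integral\<^sup>L (M v) \<phi>)) \<longlongrightarrow> ennreal (integral\<^sup>L \<nu> \<phi>)) G"
    by (intro tendsto_ennrealI vaguely_tendstoD[OF vague] \<phi>)
  have "\<forall>\<^sub>F v in G. ennreal (integral\<^sup>L (M v) \<phi>) \<le> b"
    using M
  proof eventually_elim
    case (elim v)
    have "ennreal (integral\<^sup>L (M v) \<phi>) = (\<integral>\<^sup>+ x. ennreal (\<phi> x) \<partial>M v)" using elim by (simp add: integral)
    also have "\<dots> \<le> (\<integral>\<^sup>+ x. f x \<partial>M v)" using \<phi> by (intro nn_integral_mono) auto
    finally show ?case using elim by auto
  qed
  from tendsto_upperbound[OF limit this G] show "(\<integral>\<^sup>+ x. ennreal (\<phi> x) \<partial>\<nu>) \<le> b" by (simp add: integral \<nu>)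
qed

lemma compact_cluster_point:
  fixes K :: "'b::topological_space set"
  assumes K: "compact K" and G: "G \<noteq> bot" and K_eventually: "\<forall>\<^sub>F v in G. f v \<in> K"
  obtains x G' where "G' \<le> G" "G' \<noteq> bot" "(f \<longlongrightarrow> x) G'"
proof -
  have "filtermap f G \<noteq> bot" "\<forall>\<^sub>F y in filtermap f G. y \<in> K"
    using G K_eventually by (auto simp: filtermap_bot_iff eventually_filtermap)
  then obtain x where x: "inf (nhds x) (filtermap f G) \<noteq> bot"
    using K compact_filter[of K] by blast
  define G' where "G' = inf G (filtercomap f (nhds x))"
  have "G' \<noteq> bot"
  proof
    assume "G' = bot"
    then have "eventually (\<lambda>_. False) G'" by simp
    then obtain P Q where PQ: "eventually P G" "eventually Q (filtercomap f (nhds x))"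
        "\<And>v. P v \<Longrightarrow> Q v \<Longrightarrow> False"
      unfolding G'_def eventually_inf by blast
    then obtain S where S: "eventually S (nhds x)" "\<And>v. S (f v) \<Longrightarrow> Q v"
      unfolding eventually_filtercomap by blast
    have "eventually (\<lambda>y. \<not> S y) (filtermap f G)"
      unfolding eventually_filtermap using PQ(1) by eventually_elim (use PQ S in blast)
    then have "eventually (\<lambda>_. False) (inf (nhds x) (filtermap f G))"
      unfolding eventually_inf using S by blast
    then show False using x by (simp add: trivial_limit_def)
  qed
  moreover have "(f \<longlongrightarrow> x) G'"
    unfolding G'_def by (rule filterlim_mono[OF filterlim_filtercomap]) auto
  ultimately show ?thesis using that[of G' x] by (simp add: G'_def)
qed

lemma bounded_family_cluster:
  fixes f :: "'v \<Rightarrow> 'j \<Rightarrow> real"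
  assumes G: "G \<noteq> bot" and bounded: "\<forall>\<^sub>F v in G. \<forall>j. \<bar>f v j\<bar> \<le> B j"
  obtains x G' where "G' \<le> G" "G' \<noteq> bot" "\<And>j. ((\<lambda>v. f v j) \<longlongrightarrow> x j) G'"
proof -
  let ?K = "PiE UNIV (\<lambda>j. {- B j..B j})"
  have "compactin (product_topology (\<lambda>_. euclidean) UNIV) ?K" by (simp add: compactin_PiE)
  then have K: "compact ?K" by (simp add: euclidean_product_topology)
  have "\<forall>\<^sub>F v in G. f v \<in> ?K"
    using bounded by eventually_elim (auto simp: PiE_UNIV_domain abs_le_iff minus_le_iff)
  from compact_cluster_point[OF K G this] obtain x G' where G': "G' \<le> G" "G' \<noteq> bot" "(f \<longlongrightarrow> x) G'"
    by metis
  have "((\<lambda>v. f v j) \<longlongrightarrow> x j) G'" for j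
    by (rule continuous_on_tendsto_compose[OF continuous_on_product_coordinates[of j] G'(3)]) auto
  then show ?thesis using that G'(1,2) by blast
qed

lemma abs_integral_Cc_le:
  fixes \<mu> :: "'a::t2_space measure"
  assumes \<mu>: "radon \<mu>" "emeasure \<mu> UNIV \<le> ennreal c" "0 \<le> c"
    and \<phi>: "\<phi> \<in> Cc" "\<And>x. \<bar>\<phi> x\<bar> \<le> b" "0 \<le> b"
  shows "\<bar>integral\<^sup>L \<mu> \<phi>\<bar> \<le> b * c"
proof -
  have space: "space \<mu> = UNIV" by (rule space_radon[OF \<mu>(1)])
  interpret finite_measure \<mu> using \<mu>(2) space by (intro finite_measureI) (auto simp: top_unique)
  have "\<bar>integral\<^sup>L \<mu> \<phi>\<bar> \<le> integral\<^sup>L \<mu> (\<lambda>x. \<bar>\<phi> x\<bar>)" by (rule integral_abs_bound)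
  also have "\<dots> \<le> integral\<^sup>L \<mu> (\<lambda>x. b)"
    using \<phi> integrable_Cc[OF \<mu>(1)] by (intro integral_mono integrable_abs) auto
  also have "\<dots> = b * measure \<mu> UNIV" using space by (simp add: mult.commute)
  also have "measure \<mu> UNIV \<le> c" using \<mu>(2,3) by (simp add: measure_def enn2real_leI)
  finally show ?thesis using \<phi>(3) by (simp add: mult_left_mono)
qed

lemma vague_limit_exists:
  fixes M :: "'v \<Rightarrow> 'a::t2_space measure"
  assumes lc: "locally_compact_space (euclidean :: 'a topology)" and G: "G \<noteq> bot"
    and M: "\<forall>\<^sub>F v in G. radon (M v)"
    and limit: "\<And>\<phi>. \<phi> \<in> Cc \<Longrightarrow> ((\<lambda>v. integral\<^sup>L (M v) \<phi>) \<longlongrightarrow> L \<phi>) G"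
  shows "\<exists>\<nu>. radon \<nu> \<and> vaguely_tendsto M \<nu> G"
proof -
  interpret riesz_functional L
  proof
    fix \<phi> \<psi> :: "'a \<Rightarrow> real" assume \<phi>: "\<phi> \<in> Cc" "\<psi> \<in> Cc"
    have "((\<lambda>v. integral\<^sup>L (M v) \<phi> + integral\<^sup>L (M v) \<psi>) \<longlongrightarrow> L \<phi> + L \<psi>) G"
      by (intro tendsto_add limit \<phi>)
    moreover have "\<forall>\<^sub>F v in G. integral\<^sup>L (M v) \<phi> + integral\<^sup>L (M v) \<psi> = integral\<^sup>L (M v) (\<lambda>x. \<phi> x + \<psi> x)"
      using M by eventually_elim (intro Bochner_Integration.integral_add[symmetric] integrable_Cc \<phi>)
    ultimately have "((\<lambda>v. integral\<^sup>L (M v) (\<lambda>x. \<phi> x + \<psi> x)) \<longlongrightarrow> L \<phi> + L \<psi>) G"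
      by (rule Lim_transform_eventually)
    then show "L (\<lambda>x. \<phi> x + \<psi> x) = L \<phi> + L \<psi>"
      by (rule tendsto_unique[OF G limit[OF Cc_add[OF \<phi>]]])
  next
    fix \<phi> :: "'a \<Rightarrow> real" and c assume \<phi>: "\<phi> \<in> Cc"
    have "((\<lambda>v. integral\<^sup>L (M v) (\<lambda>x. c * \<phi> x)) \<longlongrightarrow> c * L \<phi>) G"
      using tendsto_mult[OF tendsto_const limit[OF \<phi>]] by simp
    then show "L (\<lambda>x. c * \<phi> x) = c * L \<phi>"
      by (rule tendsto_unique[OF G limit[OF Cc_cmult[OF \<phi>]]])
  next
    fix \<phi> :: "'a \<Rightarrow> real" assume \<phi>: "\<phi> \<in> Cc" "\<And>x. 0 \<le> \<phi> x"
    show "0 \<le> L \<phi>"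
      by (rule tendsto_lowerbound[OF limit[OF \<phi>(1)] _ G])
        (auto intro!: always_eventually \<phi> integral_nonneg_AE)
  qed (rule lc)
  obtain \<nu> where "radon \<nu>" "\<forall>\<phi>\<in>Cc. integral\<^sup>L \<nu> \<phi> = L \<phi>" using riesz_representation by blast
  then show ?thesis using limit by (auto simp: vaguely_tendsto_def)
qed

lemma vague_cluster_family:
  fixes M :: "'v \<Rightarrow> 'i \<Rightarrow> 'a::t2_space measure"
  assumes lc: "locally_compact_space (euclidean :: 'a topology)" and G: "G \<noteq> bot"
    and c: "\<And>i. i \<in> I \<Longrightarrow> 0 \<le> c i"
    and M: "\<forall>\<^sub>F v in G. \<forall>i\<in>I. radon (M v i) \<and> emeasure (M v i) UNIV \<le> ennreal (c i)"
  obtains G' \<nu> where "G' \<le> G" "G' \<noteq> bot" "\<And>i. i \<in> I \<Longrightarrow> radon (\<nu> i)"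
    "\<And>i. i \<in> I \<Longrightarrow> vaguely_tendsto (\<lambda>v. M v i) (\<nu> i) G'"
proof -
  have "\<exists>b. b \<ge> 0 \<and> (\<forall>x. \<bar>\<phi> x\<bar> \<le> b)" if "\<phi> \<in> Cc" for \<phi> :: "'a \<Rightarrow> real" using Cc_bounded[OF that] by metis
  then obtain b where b: "\<And>\<phi>::'a \<Rightarrow> real. \<phi> \<in> Cc \<Longrightarrow> b \<phi> \<ge> 0" "\<And>\<phi> x. \<phi> \<in> Cc \<Longrightarrow> \<bar>\<phi> x\<bar> \<le> b \<phi>" by metis
  define f where "f v = (\<lambda>(i, \<phi>). if i \<in> I \<and> \<phi> \<in> Cc then integral\<^sup>L (M v i) \<phi> else 0)" for v
  define B where "B = (\<lambda>(i, \<phi>). if i \<in> I \<and> \<phi> \<in> Cc then b \<phi> * c i else 0)"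
  have "\<forall>\<^sub>F v in G. \<forall>j. \<bar>f v j\<bar> \<le> B j"
    using M by eventually_elim (auto simp: f_def B_def b c intro!: abs_integral_Cc_le)
  from bounded_family_cluster[OF G this] obtain x G' where G': "G' \<le> G" "G' \<noteq> bot"
      "\<And>j. ((\<lambda>v. f v j) \<longlongrightarrow> x j) G'"
    by metis
  have "\<exists>\<nu>. radon \<nu> \<and> vaguely_tendsto (\<lambda>v. M v i) \<nu> G'" if i: "i \<in> I" for i
  proof (rule vague_limit_exists[OF lc G'(2)])
    show "\<forall>\<^sub>F v in G'. radon (M v i)" using filter_leD[OF G'(1) M] by eventually_elim (use i in auto)
    show "((\<lambda>v. integral\<^sup>L (M v i) \<phi>) \<longlongrightarrow> x (i, \<phi>)) G'" if "\<phi> \<in> Cc" for \<phi>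
      using G'(3)[of "(i, \<phi>)"] i that by (simp add: f_def)
  qed
  then show ?thesis using that G'(1,2) by metis
qed

subsection \<open>Sets of finite capacity do not lose mass at infinity\<close>

locale consistent_kernel = energy_kernel +
  assumes consistent: "kernel_consistent \<kappa>" and lc: "locally_compact_space (euclidean :: 'a topology)"
begin

definition unit_measures :: "'a set \<Rightarrow> 'a measure set" where
  "unit_measures E = {\<nu>. inEp \<kappa> \<nu> \<and> conc \<nu> E \<and> emeasure \<nu> UNIV = 1}"

definition least_energy :: "'a set \<Rightarrow> ennreal" where
  "least_energy E = (INF \<nu>\<in>unit_measures E. kint \<kappa> \<nu> \<nu>)"

lemma cap_eq_inverse_least_energy: "cap \<kappa> E = inverse (least_energy E)"
  by (simp add: cap_def least_energy_def unit_measures_def)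

lemma unit_measures_mono: "E \<subseteq> F \<Longrightarrow> unit_measures E \<subseteq> unit_measures F"
  unfolding unit_measures_def conc_def by blast

lemma least_energy_antimono: "E \<subseteq> F \<Longrightarrow> least_energy F \<le> least_energy E"
  unfolding least_energy_def by (intro INF_superset_mono unit_measures_mono) auto

lemma least_energy_le: "\<nu> \<in> unit_measures E \<Longrightarrow> least_energy E \<le> ennreal (energy \<nu> \<nu>)"
  by (subst ennreal_energy) (auto simp: least_energy_def unit_measures_def intro: INF_lower)

lemma unit_measures_mconv:
  assumes \<mu>: "\<mu> \<in> unit_measures E" and \<nu>: "\<nu> \<in> unit_measures E" and t: "0 \<le> t" "t \<le> 1"
  shows "mconv t \<mu> \<nu> \<in> unit_measures E"
proof -
  have energy: "inEp \<kappa> \<mu>" "inEp \<kappa> \<nu>" and mass: "emeasure \<mu> UNIV = 1" "emeasure \<nu> UNIV = 1"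
    using \<mu> \<nu> by (auto simp: unit_measures_def)
  have sets: "sets \<mu> = sets borel" "sets \<nu> = sets borel" using energy inEp_sets by auto
  obtain B C where B: "B \<in> sets borel" "B \<subseteq> E" "emeasure \<mu> (UNIV - B) = 0"
    and C: "C \<in> sets borel" "C \<subseteq> E" "emeasure \<nu> (UNIV - C) = 0"
    using \<mu> \<nu> by (auto simp: unit_measures_def conc_def)
  have "emeasure \<mu> (UNIV - (B \<union> C)) = 0" "emeasure \<nu> (UNIV - (B \<union> C)) = 0"
    using B(1) C(1) sets by (intro emeasure_eq_0[OF _ B(3)] emeasure_eq_0[OF _ C(3)]; force)+
  then have "conc (mconv t \<mu> \<nu>) E"
    unfolding conc_def using B C by (intro bexI[of _ "B \<union> C"]) (auto simp: emeasure_mconv sets)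
  moreover have "emeasure (mconv t \<mu> \<nu>) UNIV = 1"
    using t by (simp add: emeasure_mconv sets mass flip: ennreal_plus)
  ultimately show ?thesis using energy t by (simp add: unit_measures_def inEp_mconv)
qed

definition near_minimizers :: "'a set \<Rightarrow> real \<Rightarrow> 'a set \<Rightarrow> real \<Rightarrow> 'a measure set" where
  "near_minimizers A s K e = {\<nu> \<in> unit_measures (A - K). energy \<nu> \<nu> < s + e}"

definition tail_filter :: "'a set \<Rightarrow> real \<Rightarrow> 'a measure filter" where
  "tail_filter A s = (INF (K, e)\<in>{K. compact K} \<times> {0<..}. principal (near_minimizers A s K e))"

lemma near_minimizers_mono:
  "K \<subseteq> L \<Longrightarrow> d \<le> e \<Longrightarrow> near_minimizers A s L d \<subseteq> near_minimizers A s K e"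
  using unit_measures_mono[of "A - L" "A - K"] by (auto simp: near_minimizers_def)

lemma eventually_tail_filter:
  "eventually P (tail_filter A s) \<longleftrightarrow> (\<exists>K e. compact K \<and> 0 < e \<and> (\<forall>\<nu>\<in>near_minimizers A s K e. P \<nu>))"
proof -
  let ?N = "\<lambda>(K, e). near_minimizers A s K e" and ?I = "{K :: 'a set. compact K} \<times> {0::real<..}"
  have "eventually P (tail_filter A s) \<longleftrightarrow> (\<exists>z\<in>?I. eventually P (principal (?N z)))"
    unfolding tail_filter_def case_prod_unfold
  proof (rule eventually_INF_base)
    have "({}, 1) \<in> ?I" by simp
    then show "?I \<noteq> {}" by blast
    fix y z assume "y \<in> ?I" "z \<in> ?I"
    then show "\<exists>x\<in>?I. principal (near_minimizers A s (fst x) (snd x))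
        \<le> inf (principal (near_minimizers A s (fst y) (snd y)))
          (principal (near_minimizers A s (fst z) (snd z)))"
      by (intro bexI[of _ "(fst y \<union> fst z, min (snd y) (snd z))"])
         (auto simp: compact_Un intro: near_minimizers_mono[THEN subsetD, rotated 2])
  qed
  then show ?thesis by (auto simp: eventually_principal)
qed

lemma near_minimizers_dist_less:
  assumes s: "0 \<le> s" "ennreal (s - d) \<le> least_energy (A - K)"
    and \<mu>: "\<mu> \<in> near_minimizers A s K d" and \<nu>: "\<nu> \<in> near_minimizers A s K d"
  shows "(nrm \<kappa> (\<mu>, \<nu>))\<^sup>2 < 8 * d"
proof -
  have unit: "\<mu> \<in> unit_measures (A - K)" "\<nu> \<in> unit_measures (A - K)"
    and energy: "energy \<mu> \<mu> < s + d" "energy \<nu> \<nu> < s + d" using \<mu> \<nu> by (auto simp: near_minimizers_def)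
  have "ennreal (s - d) \<le> ennreal (energy (mconv (1/2) \<mu> \<nu>) (mconv (1/2) \<mu> \<nu>))"
    by (rule order_trans[OF s(2) least_energy_le[OF unit_measures_mconv[OF unit]]]) simp_all
  then have "s - d \<le> energy (mconv (1/2) \<mu> \<nu>) (mconv (1/2) \<mu> \<nu>)" by (simp add: ennreal_le_iff)
  also have "\<dots> = (energy \<mu> \<mu> + energy \<nu> \<nu>) / 2 - (nrm \<kappa> (\<mu>, \<nu>))\<^sup>2 / 4"
    using unit energy_mconv[of \<mu> \<nu> "1/2"] by (simp add: unit_measures_def)
  finally show ?thesis using energy by argo
qed

context
  fixes A :: "'a set" and s :: real
  assumes s: "(SUP K\<in>{K. compact K}. least_energy (A - K)) = ennreal s" "0 \<le> s"
begin

lemma near_minimizers_nonempty: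
  assumes "compact K" "0 < e" shows "near_minimizers A s K e \<noteq> {}"
proof -
  have "least_energy (A - K) \<le> ennreal s" unfolding s(1)[symmetric] using assms(1) by (intro SUP_upper) auto
  also have "\<dots> < ennreal (s + e)" using s(2) assms(2) by (simp add: ennreal_less_iff)
  finally obtain \<nu> where "\<nu> \<in> unit_measures (A - K)" "kint \<kappa> \<nu> \<nu> < ennreal (s + e)"
    unfolding least_energy_def INF_less_iff by blast
  then have "\<nu> \<in> near_minimizers A s K e"
    using s(2) assms(2)
    by (cases "kint \<kappa> \<nu> \<nu>") (auto simp: near_minimizers_def ennreal_less_iff simp del: ennreal_plus)
  then show ?thesis by blast
qed

lemma tail_filter_Cauchy:
  assumes e: "e > 0"
  shows "\<forall>\<^sub>F z in tail_filter A s \<times>\<^sub>F tail_filter A s. nrm \<kappa> (fst z, snd z) < e"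
proof -
  define d where "d = e\<^sup>2 / 8"
  have d: "d > 0" using e by (simp add: d_def)
  have "\<exists>K. compact K \<and> ennreal (s - d) \<le> least_energy (A - K)"
  proof (cases "s - d > 0")
    case True
    then have "ennreal (s - d) < (SUP K\<in>{K. compact K}. least_energy (A - K))"
      unfolding s(1) using d s(2) by (intro ennreal_lessI) auto
    then show ?thesis by (auto simp: less_SUP_iff intro: less_imp_le)
  next
    case False
    then show ?thesis by (intro exI[of _ "{}"]) (simp add: ennreal_neg)
  qed
  then obtain K where K: "compact K" "ennreal (s - d) \<le> least_energy (A - K)" by blast
  have "nrm \<kappa> (\<mu>, \<nu>) < e" if "\<mu> \<in> near_minimizers A s K d" "\<nu> \<in> near_minimizers A s K d" for \<mu> \<nu>
    using near_minimizers_dist_less[OF s(2) K(2) that] e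
    by (intro power2_less_imp_less[of _ e]) (simp_all add: d_def)
  moreover have "\<forall>\<^sub>F \<nu> in tail_filter A s. \<nu> \<in> near_minimizers A s K d"
    unfolding eventually_tail_filter using K(1) d by blast
  ultimately show ?thesis
    unfolding eventually_prod_filter by (intro exI[of _ "\<lambda>\<nu>. \<nu> \<in> near_minimizers A s K d"]) auto
qed

lemma tail_filter_vague_cluster_null: "vague_cluster (tail_filter A s) (null_measure borel)"
  unfolding vague_cluster_def
proof (intro allI impI)
  fix \<Phi> :: "('a \<Rightarrow> real) set" and e :: real assume \<Phi>: "finite \<Phi> \<and> \<Phi> \<subseteq> Cc \<and> e > 0"
  let ?K = "\<Union>\<phi>\<in>\<Phi>. closure {x. \<phi> x \<noteq> 0}"
  have K: "compact ?K" using \<Phi> by (intro compact_UN) (auto simp: Cc_def)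
  have "integral\<^sup>L \<nu> \<phi> = 0" if \<nu>: "\<nu> \<in> near_minimizers A s ?K 1" and \<phi>: "\<phi> \<in> \<Phi>" for \<nu> \<phi>
  proof -
    obtain B where B: "B \<in> sets borel" "B \<subseteq> A - ?K" "emeasure \<nu> (UNIV - B) = 0"
      and sets: "sets \<nu> = sets borel"
      using \<nu> by (auto simp: near_minimizers_def unit_measures_def conc_def inEp_sets)
    have "AE x in \<nu>. \<phi> x = 0"
    proof (rule AE_I'[of "UNIV - B"])
      show "UNIV - B \<in> null_sets \<nu>" using B sets by (simp add: null_sets_def)
      show "{x\<in>space \<nu>. \<phi> x \<noteq> 0} \<subseteq> UNIV - B"
        using B(2) \<phi> closure_subset[of "{x. \<phi> x \<noteq> 0}"] by blast
    qed
    then show ?thesis by (rule integral_eq_zero_AE)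
  qed
  then have "\<forall>\<nu>\<in>near_minimizers A s ?K 1. \<forall>\<phi>\<in>\<Phi>. \<bar>integral\<^sup>L \<nu> \<phi> - integral\<^sup>L (null_measure borel) \<phi>\<bar> < e"
    using \<Phi> by (simp add: integral_null_measure)
  then have "\<forall>\<^sub>F \<nu> in tail_filter A s. \<forall>\<phi>\<in>\<Phi>. \<bar>integral\<^sup>L \<nu> \<phi> - integral\<^sup>L (null_measure borel) \<phi>\<bar> < e"
    unfolding eventually_tail_filter using K zero_less_one by blast
  moreover have "tail_filter A s \<noteq> bot"
    unfolding trivial_limit_def eventually_tail_filter using near_minimizers_nonempty by blast
  ultimately show "\<exists>\<^sub>F \<nu> in tail_filter A s. \<forall>\<phi>\<in>\<Phi>. \<bar>integral\<^sup>L \<nu> \<phi> - integral\<^sup>L (null_measure borel) \<phi>\<bar> < e"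
    by (rule eventually_frequently[rotated])
qed

lemma tail_filter_energy_small:
  assumes "e > 0" shows "\<exists>\<nu>\<in>unit_measures A. energy \<nu> \<nu> < e"
proof -
  have "\<forall>\<^sub>F \<nu> in tail_filter A s. inEp \<kappa> \<nu>"
    unfolding eventually_tail_filter
    by (intro exI[of _ "{}"] exI[of _ 1]) (auto simp: near_minimizers_def unit_measures_def)
  then have "\<forall>e>0. \<forall>\<^sub>F \<nu> in tail_filter A s. nrm \<kappa> (\<nu>, null_measure borel) < e"
    using consistent tail_filter_Cauchy radon_null_measure tail_filter_vague_cluster_null
    unfolding kernel_consistent_def by blast
  then obtain K d where K: "compact K" "0 < d"
    and small: "\<forall>\<nu>\<in>near_minimizers A s K d. nrm \<kappa> (\<nu>, null_measure borel) < sqrt e"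
    using assms unfolding eventually_tail_filter by (meson real_sqrt_gt_zero)
  obtain \<nu> where \<nu>: "\<nu> \<in> near_minimizers A s K d" using near_minimizers_nonempty[OF K] by blast
  then have "energy \<nu> \<nu> < e" using small by (auto simp: nrm_def ip_def)
  moreover have "\<nu> \<in> unit_measures A"
    using \<nu> unit_measures_mono[of "A - K" A] by (auto simp: near_minimizers_def)
  ultimately show ?thesis by blast
qed

end

text \<open>If the infima stayed bounded, near-minimizers would form a strong Cauchy filter with vague limit
  \<open>0\<close>, so by consistency their energies would tend to \<open>0\<close>, contradicting \<open>cap \<kappa> A \<noteq> \<infinity>\<close>.\<close>

lemma least_energy_at_infinity:
  assumes "cap \<kappa> A \<noteq> \<infinity>"
  shows "(SUP K\<in>{K. compact K}. least_energy (A - K)) = top"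
proof (rule ccontr)
  assume "\<not> ?thesis"
  then obtain s where s: "(SUP K\<in>{K. compact K}. least_energy (A - K)) = ennreal s" "0 \<le> s"
    by (cases "SUP K\<in>{K. compact K}. least_energy (A - K)") auto
  have "least_energy A \<noteq> 0" using assms by (simp add: cap_eq_inverse_least_energy)
  then have "0 < least_energy A" by (simp add: zero_less_iff_neq_zero)
  then obtain q where q: "0 < q" "q < least_energy A" using dense by blast
  then obtain e where e: "q = ennreal e" "0 < e" by (cases q) auto
  then obtain \<nu> where \<nu>: "\<nu> \<in> unit_measures A" "energy \<nu> \<nu> < e"
    using tail_filter_energy_small[OF s] by blast
  have "ennreal e < ennreal (energy \<nu> \<nu>)"
    using q(2) least_energy_le[OF \<nu>(1)] unfolding e(1) by (rule less_le_trans)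
  then show False using \<nu>(2) e(2) by (simp add: ennreal_less_iff)
qed

lemma mass_sq_mult_le_energy:
  assumes \<mu>: "inEp \<kappa> \<mu>" "emeasure \<mu> UNIV < \<infinity>" and B: "B \<in> sets borel"
    and r: "0 \<le> r" "ennreal r \<le> least_energy B"
  shows "(measure \<mu> B)\<^sup>2 * r \<le> energy \<mu> \<mu>"
proof (cases "measure \<mu> B = 0")
  case False
  define m where "m = measure \<mu> B"
  have m: "m > 0" using False by (simp add: m_def less_le)
  have sets: "sets \<mu> = sets borel" using \<mu>(1) by (rule inEp_sets)
  have "emeasure \<mu> B \<le> emeasure \<mu> UNIV" using sets by (intro emeasure_mono) auto
  then have mass: "emeasure \<mu> B = ennreal m"
    unfolding m_def using \<mu>(2) by (intro emeasure_eq_ennreal_measure) auto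
  let ?\<nu> = "scale_measure (ennreal (1/m)) (restr B \<mu>)"
  have restr: "inEp \<kappa> (restr B \<mu>)" by (rule inEp_restr[OF \<mu>(1) B])
  have "emeasure ?\<nu> UNIV = 1"
    using m mass by (simp add: emeasure_restr sets B ennreal_mult'[symmetric])
  moreover have "conc ?\<nu> B"
    unfolding conc_def using B by (intro bexI[of _ B]) (auto simp: emeasure_restr sets)
  ultimately have "?\<nu> \<in> unit_measures B" using restr m by (simp add: unit_measures_def inEp_scale)
  then have "ennreal r \<le> ennreal (energy ?\<nu> ?\<nu>)" using r(2) least_energy_le order_trans by blast
  then have "r \<le> (1/m)\<^sup>2 * energy (restr B \<mu>) (restr B \<mu>)"
    using restr m by (simp add: energy_scale ennreal_le_iff)
  then have "m\<^sup>2 * r \<le> energy (restr B \<mu>) (restr B \<mu>)" using m by (simp add: field_simps power2_eq_square)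
  also have "\<dots> \<le> energy \<mu> \<mu>" by (rule energy_restr_le[OF \<mu>(1) B])
  finally show ?thesis by (simp add: m_def)
qed simp

lemma capacity_tail:
  assumes "cap \<kappa> A \<noteq> \<infinity>" and A: "closed A" and e: "e > 0"
  obtains K where "compact K"
    "\<And>\<mu>. inEp \<kappa> \<mu> \<Longrightarrow> emeasure \<mu> UNIV < \<infinity> \<Longrightarrow> (measure \<mu> (A - K))\<^sup>2 \<le> e * energy \<mu> \<mu>"
proof -
  have "ennreal (1 / e) < (SUP K\<in>{K. compact K}. least_energy (A - K))"
    unfolding least_energy_at_infinity[OF assms(1)] by simp
  then obtain K where K: "compact K" "ennreal (1 / e) \<le> least_energy (A - K)"
    by (auto simp: less_SUP_iff less_imp_le)
  have "A - K \<in> sets borel" using A K(1) by (auto intro: borel_compact)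
  then have "(measure \<mu> (A - K))\<^sup>2 * (1 / e) \<le> energy \<mu> \<mu>" if "inEp \<kappa> \<mu>" "emeasure \<mu> UNIV < \<infinity>" for \<mu>
    using that K(2) e by (intro mass_sq_mult_le_energy) auto
  then have "(measure \<mu> (A - K))\<^sup>2 \<le> e * energy \<mu> \<mu>" if "inEp \<kappa> \<mu>" "emeasure \<mu> UNIV < \<infinity>" for \<mu>
    using that e by (simp add: field_simps)
  then show ?thesis using that K(1) by blast
qed

lemma capacity_zero_null:
  assumes N: "cap \<kappa> N = 0" and \<mu>: "inEp \<kappa> \<mu>" "emeasure \<mu> UNIV < \<infinity>" and B: "B \<in> sets borel" "B \<subseteq> N"
  shows "emeasure \<mu> B = 0"
proof -
  have "least_energy N = top" using N by (simp add: cap_eq_inverse_least_energy ennreal_inverse_eq_0_iff)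
  then have top: "least_energy B = top" using least_energy_antimono[OF B(2)] by (simp add: top_unique)
  have "measure \<mu> B = 0"
  proof (rule ccontr)
    assume "measure \<mu> B \<noteq> 0"
    then have square_pos: "(measure \<mu> B)\<^sup>2 > 0" by simp
    let ?r = "(energy \<mu> \<mu> + 1) / (measure \<mu> B)\<^sup>2"
    have "(measure \<mu> B)\<^sup>2 * ?r \<le> energy \<mu> \<mu>"
      by (rule mass_sq_mult_le_energy[OF \<mu> B(1)]) (simp_all add: top)
    then show False using square_pos by simp
  qed
  moreover have "emeasure \<mu> B \<le> emeasure \<mu> UNIV" using inEp_sets[OF \<mu>(1)] by (intro emeasure_mono) auto
  ultimately show ?thesis using \<mu>(2) by (auto simp: measure_def enn2real_eq_0_iff)
qed

end

subsection \<open>Weighted masses of measures of bounded energy\<close>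

definition growth_condition :: "'a::topological_space kernel \<Rightarrow> 'a set \<Rightarrow> ('a \<Rightarrow> real) \<Rightarrow> bool" where
  "growth_condition \<kappa> A g \<longleftrightarrow> (\<exists>B. \<forall>x\<in>A. g x \<le> B) \<or>
     (\<exists>r>1. \<exists>\<nu>. inE \<kappa> \<nu> \<and> nearly_everywhere \<kappa> A
        (\<lambda>x. pot \<kappa> (snd \<nu>) x < \<infinity> \<and> ennreal (g x powr r) + pot \<kappa> (snd \<nu>) x \<le> pot \<kappa> (fst \<nu>) x))"

lemma borel_measurable_weight:
  fixes g :: "'a::topological_space \<Rightarrow> real"
  assumes A: "closed A" and g: "continuous_on A g" and B: "B \<in> sets borel" "B \<subseteq> A"
  shows "(\<lambda>x. ennreal (g x) * indicator B x) \<in> borel_measurable borel"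
proof -
  have "(\<lambda>x. indicator A x *\<^sub>R g x) \<in> borel_measurable borel"
    using A g by (intro borel_measurable_continuous_on_indicator) auto
  then have "(\<lambda>x. ennreal (indicator A x *\<^sub>R g x) * indicator B x) \<in> borel_measurable borel"
    using B(1) by measurable
  moreover have "(\<lambda>x. ennreal (indicator A x *\<^sub>R g x) * indicator B x)
      = (\<lambda>x. ennreal (g x) * indicator B x)"
    using B(2) by (auto simp: fun_eq_iff indicator_def)
  ultimately show ?thesis by (simp only:)
qed

lemma le_threshold_plus_powr:
  fixes y T r :: real
  assumes "1 < r" "0 < T" "0 < y"
  shows "y \<le> T + T powr (1 - r) * y powr r"
proof (cases "y \<le> T")
  case False
  have "y = y powr (1 - r) * y powr r" using assms(3) by (simp add: powr_add[symmetric])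
  also have "\<dots> \<le> T powr (1 - r) * y powr r"
    using False assms by (intro mult_right_mono powr_mono2') auto
  finally show ?thesis using assms(2) by simp
qed (simp add: add_increasing2)

lemma powr_threshold:
  fixes r D e :: real
  assumes r: "1 < r" and "0 \<le> D" "0 < e"
  obtains T where "0 < T" "T powr (1 - r) * D \<le> e"
proof -
  define T where "T = ((D + 1) / e) powr (1 / (r - 1))"
  have T: "0 < T" using assms by (simp add: T_def)
  have "T powr (1 - r) = ((D + 1) / e) powr (1 / (r - 1) * (1 - r))" by (simp add: T_def powr_powr)
  also have "1 / (r - 1) * (1 - r) = -1" using r by (simp add: field_simps)
  finally have "T powr (1 - r) * (D + 1) = e" using assms by (simp add: powr_minus_divide)
  then have "T powr (1 - r) * D \<le> e"
    using powr_ge_zero[of T "1 - r"] by (simp only: distrib_left)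
  then show ?thesis using that T by blast
qed

context consistent_kernel
begin

lemma nn_integral_le_kint_of_le_pot_nearly_everywhere:
  assumes \<mu>: "inEp \<kappa> \<mu>" "emeasure \<mu> UNIV < \<infinity>" and \<nu>: "inEp \<kappa> \<nu>" and N: "cap \<kappa> N = 0"
    and A: "closed A" and f: "continuous_on A f" "\<And>x. x \<in> A - N \<Longrightarrow> ennreal (f x) \<le> pot \<kappa> \<nu> x"
  shows "(\<integral>\<^sup>+x\<in>A. ennreal (f x) \<partial>\<mu>) \<le> kint \<kappa> \<mu> \<nu>"
  unfolding kint_def
proof (rule nn_integral_mono_AE)
  have [measurable]: "(\<lambda>x. ennreal (f x) * indicator A x) \<in> borel_measurable borel"
    using A f(1) by (intro borel_measurable_weight) auto
  have [measurable]: "pot \<kappa> \<nu> \<in> borel_measurable borel" by (rule pot_borel[OF inEp_radon[OF \<nu>]])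
  let ?B = "{x\<in>space borel. pot \<kappa> \<nu> x < ennreal (f x) * indicator A x}"
  have B: "?B \<in> sets borel" by measurable
  moreover have "?B \<subseteq> N" using f(2) by (auto simp: indicator_def not_le[symmetric] split: if_splits)
  ultimately have "emeasure \<mu> ?B = 0" by (rule capacity_zero_null[OF N \<mu>])
  then show "AE x in \<mu>. ennreal (f x) * indicator A x \<le> pot \<kappa> \<nu> x"
    using B inEp_sets[OF \<mu>(1)] space_radon[OF inEp_radon[OF \<mu>(1)]]
    by (intro AE_I'[of ?B]) (auto simp: null_sets_def not_le)
qed

lemma kint_le_of_energy_le:
  assumes "inEp \<kappa> \<mu>" "inEp \<kappa> \<nu>" "energy \<mu> \<mu> \<le> R"
  shows "kint \<kappa> \<mu> \<nu> \<le> ennreal (max R 0 + energy \<nu> \<nu>)"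
proof -
  have "energy \<mu> \<nu> \<le> max R 0 + energy \<nu> \<nu>"
    using kint_cross_le[OF assms(1,2)] assms(3) enn2real_nonneg[of "kint \<kappa> \<mu> \<nu>"] by linarith
  then show ?thesis by (subst ennreal_energy[OF assms(1,2), symmetric]) (rule ennreal_leI)
qed

lemma weight_integral_le_of_powr_bound:
  assumes \<mu>: "inEp \<kappa> \<mu>" and A: "closed A" and g: "continuous_on A g" "\<And>x. x \<in> A \<Longrightarrow> 0 < g x"
    and r: "1 < r" and T: "0 < T" and B: "B \<in> sets borel" "B \<subseteq> A"
    and bound: "(\<integral>\<^sup>+x\<in>A. ennreal (g x powr r) \<partial>\<mu>) \<le> ennreal D"
  shows "(\<integral>\<^sup>+x\<in>B. ennreal (g x) \<partial>\<mu>) \<le> ennreal T * emeasure \<mu> B + ennreal (T powr (1 - r)) * ennreal D"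
proof -
  have sets: "sets \<mu> = sets borel" by (rule inEp_sets[OF \<mu>])
  have "continuous_on A (\<lambda>x. g x powr r)" using g by (intro continuous_intros) force+
  then have [measurable]: "(\<lambda>x. ennreal (g x powr r) * indicator A x) \<in> borel_measurable \<mu>"
    using A by (intro borel_measurable_cong_sets[OF sets] borel_measurable_weight) auto
  have [measurable]: "B \<in> sets \<mu>" using B sets by simp
  have "(\<integral>\<^sup>+x\<in>B. ennreal (g x) \<partial>\<mu>)
      \<le> (\<integral>\<^sup>+ x. ennreal T * indicator B x
          + ennreal (T powr (1 - r)) * (ennreal (g x powr r) * indicator A x) \<partial>\<mu>)"
  proof (rule nn_integral_mono)
    fix x
    show "ennreal (g x) * indicator B x
        \<le> ennreal T * indicator B x + ennreal (T powr (1 - r)) * (ennreal (g x powr r) * indicator A x)"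
    proof (cases "x \<in> B")
      case True
      then have "ennreal (g x) \<le> ennreal (T + T powr (1 - r) * g x powr r)"
        using B(2) g(2) by (intro ennreal_leI le_threshold_plus_powr r T) auto
      then show ?thesis using True B(2) T by (auto simp: ennreal_mult)
    qed simp
  qed
  also have "\<dots> = ennreal T * emeasure \<mu> B + ennreal (T powr (1 - r)) * (\<integral>\<^sup>+x\<in>A. ennreal (g x powr r) \<partial>\<mu>)"
    by (simp add: nn_integral_add nn_integral_cmult nn_integral_cmult_indicator)
  also have "\<dots> \<le> ennreal T * emeasure \<mu> B + ennreal (T powr (1 - r)) * ennreal D"
    by (intro add_left_mono mult_left_mono bound) auto
  finally show ?thesis .
qed

lemma weight_uniformly_integrable:
  assumes A: "closed A" and g: "continuous_on A g" "\<And>x. x \<in> A \<Longrightarrow> 0 < g x"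
    and growth: "growth_condition \<kappa> A g" and e: "e > 0"
  shows "\<exists>T\<ge>0. \<forall>\<mu> B. inEp \<kappa> \<mu> \<longrightarrow> emeasure \<mu> UNIV < \<infinity> \<longrightarrow> energy \<mu> \<mu> \<le> R \<longrightarrow> B \<in> sets borel \<longrightarrow> B \<subseteq> A \<longrightarrow>
    (\<integral>\<^sup>+x\<in>B. ennreal (g x) \<partial>\<mu>) \<le> ennreal T * emeasure \<mu> B + ennreal e"
  using growth unfolding growth_condition_def
proof (elim disjE exE conjE)
  fix b assume b: "\<forall>x\<in>A. g x \<le> b"
  have "(\<integral>\<^sup>+x\<in>B. ennreal (g x) \<partial>\<mu>) \<le> ennreal (max b 0) * emeasure \<mu> B + ennreal e"
    if \<mu>: "inEp \<kappa> \<mu>" and B: "B \<in> sets borel" "B \<subseteq> A" for \<mu> B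
  proof -
    have "(\<integral>\<^sup>+x\<in>B. ennreal (g x) \<partial>\<mu>) \<le> (\<integral>\<^sup>+ x. ennreal (max b 0) * indicator B x \<partial>\<mu>)"
      using b B(2)
      by (intro nn_integral_mono) (auto simp: indicator_def intro!: ennreal_leI max.coboundedI1)
    also have "\<dots> = ennreal (max b 0) * emeasure \<mu> B"
      using B(1) inEp_sets[OF \<mu>] by (intro nn_integral_cmult_indicator) simp
    finally show ?thesis by (simp add: add_increasing2)
  qed
  then show ?thesis by (intro exI[of _ "max b 0"]) auto
next
  fix r \<nu>' assume r: "1 < r" and \<nu>': "inE \<kappa> \<nu>'" and "nearly_everywhere \<kappa> A
    (\<lambda>x. pot \<kappa> (snd \<nu>') x < \<infinity> \<and> ennreal (g x powr r) + pot \<kappa> (snd \<nu>') x \<le> pot \<kappa> (fst \<nu>') x)"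
  then obtain N where N: "cap \<kappa> N = 0"
    and "\<And>x. x \<in> A - N \<Longrightarrow> ennreal (g x powr r) + pot \<kappa> (snd \<nu>') x \<le> pot \<kappa> (fst \<nu>') x"
    by (auto simp: nearly_everywhere_def)
  then have le_pot: "ennreal (g x powr r) \<le> pot \<kappa> (fst \<nu>') x" if "x \<in> A - N" for x
    using that by (meson add_increasing2 le_iff_add order_refl order_trans zero_le)
  have \<nu>: "inEp \<kappa> (fst \<nu>')" using \<nu>' by (simp add: inE_def finen_def inEp_def)
  have cont: "continuous_on A (\<lambda>x. g x powr r)" using g by (intro continuous_intros) force+
  define D where "D = max R 0 + energy (fst \<nu>') (fst \<nu>')"
  have D: "D \<ge> 0" by (simp add: D_def)
  obtain T where T: "0 < T" "T powr (1 - r) * D \<le> e" using powr_threshold[OF r D e] .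
  then have small: "ennreal (T powr (1 - r)) * ennreal D \<le> ennreal e"
    using D by (simp add: ennreal_mult[symmetric] ennreal_leI)
  have "(\<integral>\<^sup>+x\<in>B. ennreal (g x) \<partial>\<mu>) \<le> ennreal T * emeasure \<mu> B + ennreal e"
    if \<mu>: "inEp \<kappa> \<mu>" "emeasure \<mu> UNIV < \<infinity>" "energy \<mu> \<mu> \<le> R" and B: "B \<in> sets borel" "B \<subseteq> A" for \<mu> B
  proof -
    have "(\<integral>\<^sup>+x\<in>A. ennreal (g x powr r) \<partial>\<mu>) \<le> ennreal D"
      using nn_integral_le_kint_of_le_pot_nearly_everywhere[OF \<mu>(1,2) \<nu> N A cont le_pot]
        kint_le_of_energy_le[OF \<mu>(1) \<nu> \<mu>(3)] unfolding D_def by (rule order_trans)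
    from weight_integral_le_of_powr_bound[OF \<mu>(1) A g r T(1) B this] small show ?thesis
      by (meson add_left_mono order_trans)
  qed
  then show ?thesis using T(1) by (intro exI[of _ T]) auto
qed

lemma weight_tail:
  assumes "cap \<kappa> A \<noteq> \<infinity>" and A: "closed A" and g: "continuous_on A g" "\<And>x. x \<in> A \<Longrightarrow> 0 < g x"
    and growth: "growth_condition \<kappa> A g" and e: "e > 0"
  obtains K where "compact K"
    "\<And>\<mu>. inEp \<kappa> \<mu> \<Longrightarrow> emeasure \<mu> UNIV < \<infinity> \<Longrightarrow> energy \<mu> \<mu> \<le> R \<Longrightarrow> (\<integral>\<^sup>+x\<in>A - K. ennreal (g x) \<partial>\<mu>) \<le> ennreal e"
proof -
  obtain T where T: "T \<ge> 0"
      "\<And>\<mu> B. inEp \<kappa> \<mu> \<Longrightarrow> emeasure \<mu> UNIV < \<infinity> \<Longrightarrow> energy \<mu> \<mu> \<le> R \<Longrightarrow> B \<in> sets borel \<Longrightarrow> B \<subseteq> A \<Longrightarrow>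
     (\<integral>\<^sup>+x\<in>B. ennreal (g x) \<partial>\<mu>) \<le> ennreal T * emeasure \<mu> B + ennreal (e/2)"
    using weight_uniformly_integrable[OF A g growth, of "e/2" R] e by auto
  define q where "q = e / (2 * (T + 1))"
  have q: "q > 0" "T * q \<le> e / 2" using e T(1) by (auto simp: q_def field_simps)
  define d where "d = q\<^sup>2 / (max R 0 + 1)"
  have d: "d > 0" using q(1) by (simp add: d_def)
  obtain K where K: "compact K"
      "\<And>\<mu>. inEp \<kappa> \<mu> \<Longrightarrow> emeasure \<mu> UNIV < \<infinity> \<Longrightarrow> (measure \<mu> (A - K))\<^sup>2 \<le> d * energy \<mu> \<mu>"
    using capacity_tail[OF assms(1) A d] by metis
  have borel: "A - K \<in> sets borel" using A K(1) by (auto intro: borel_compact)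
  have "(\<integral>\<^sup>+x\<in>A - K. ennreal (g x) \<partial>\<mu>) \<le> ennreal e"
    if \<mu>: "inEp \<kappa> \<mu>" "emeasure \<mu> UNIV < \<infinity>" "energy \<mu> \<mu> \<le> R" for \<mu>
  proof -
    let ?m = "measure \<mu> (A - K)"
    have "?m\<^sup>2 \<le> d * energy \<mu> \<mu>" using K(2) \<mu> by blast
    also have "\<dots> \<le> d * (max R 0 + 1)" using \<mu>(3) d by (intro mult_left_mono) auto
    also have "\<dots> = q\<^sup>2" by (simp add: d_def)
    finally have "?m \<le> q" by (rule power2_le_imp_le) (use q in simp)
    then have "T * ?m \<le> T * q" using T(1) by (rule mult_left_mono)
    then have "T * ?m + e / 2 \<le> e" using q(2) by simp
    then have "ennreal (T * ?m + e / 2) \<le> ennreal e" by (rule ennreal_leI)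
    moreover have "emeasure \<mu> (A - K) \<le> emeasure \<mu> UNIV"
      using inEp_sets[OF \<mu>(1)] by (intro emeasure_mono) auto
    then have "emeasure \<mu> (A - K) = ennreal ?m" using \<mu>(2) by (intro emeasure_eq_ennreal_measure) auto
    then have "(\<integral>\<^sup>+x\<in>A - K. ennreal (g x) \<partial>\<mu>) \<le> ennreal (T * ?m + e / 2)"
      using T(2)[OF \<mu> borel Diff_subset] T(1) e by (simp add: ennreal_mult)
    ultimately show ?thesis by (rule order_trans[rotated])
  qed
  then show ?thesis using that K(1) by blast
qed

end

lemma lsc_extend_top:
  assumes A: "closed A" and h: "continuous_on A h"
  shows "lsc (\<lambda>x. if x \<in> A then ennreal (h x) else top)"
  unfolding lsc_def
proof
  fix c :: ennreal
  show "open {x. c < (if x \<in> A then ennreal (h x) else top)}"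
  proof (cases "c = top")
    case False
    have "continuous_on A (\<lambda>x. ennreal (h x))" by (intro continuous_on_ennreal h)
    then obtain T where T: "open T" "T \<inter> A = (\<lambda>x. ennreal (h x)) -` {c<..} \<inter> A"
      using continuous_on_open_invariant[of A "\<lambda>x. ennreal (h x)"] open_greaterThan by metis
    have "{x. c < (if x \<in> A then ennreal (h x) else top)} = - A \<union> T"
      using T False by (auto simp: less_top split: if_splits)
    then show ?thesis using T A by auto
  qed simp
qed

lemma vague_limit_weight_le:
  fixes \<nu> :: "'a::t2_space measure"
  assumes lc: "locally_compact_space (euclidean :: 'a topology)" and \<nu>: "radon \<nu>"
    and A: "closed A" and g: "continuous_on A g" and G: "G \<noteq> bot"
    and M: "\<forall>\<^sub>F v in G. radon (M v) \<and> emeasure (M v) (UNIV - A) = 0 \<and> (\<integral>\<^sup>+x\<in>A. ennreal (g x) \<partial>M v)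
        \<le> ennreal b"
    and vague: "vaguely_tendsto M \<nu> G"
  shows "emeasure \<nu> (UNIV - A) = 0" "(\<integral>\<^sup>+x\<in>A. ennreal (g x) \<partial>\<nu>) \<le> ennreal b"
proof -
  let ?f = "\<lambda>x. if x \<in> A then ennreal (g x) else top"
  have weight: "(\<integral>\<^sup>+ x. ?f x \<partial>\<mu>) = (\<integral>\<^sup>+x\<in>A. ennreal (g x) \<partial>\<mu>)" if "AE x in \<mu>. x \<in> A" for \<mu>
    using that by (intro nn_integral_cong_AE) (auto elim: eventually_mono)
  have lsc: "lsc ?f" by (rule lsc_extend_top[OF A g])
  have "\<forall>\<^sub>F v in G. radon (M v) \<and> (\<integral>\<^sup>+ x. ?f x \<partial>M v) \<le> ennreal b"
    using M by eventually_elim (simp add: weight AE_carrier A sets_radon)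
  from vague_limit_lsc_le[OF lc \<nu> lsc G this vague] have bound: "(\<integral>\<^sup>+ x. ?f x \<partial>\<nu>) \<le> ennreal b" .
  then have "(\<integral>\<^sup>+ x. ?f x \<partial>\<nu>) \<noteq> \<infinity>" by (auto simp: top_unique)
  then have "AE x in \<nu>. ?f x \<noteq> \<infinity>"
    using borel_measurable_radon[OF \<nu> borel_measurable_lsc[OF lsc]] by (rule nn_integral_PInf_AE[rotated])
  then have carried: "AE x in \<nu>. x \<in> A" by eventually_elim (auto split: if_splits)
  then show "(\<integral>\<^sup>+x\<in>A. ennreal (g x) \<partial>\<nu>) \<le> ennreal b" using bound by (simp add: weight)
  have "UNIV - A \<in> sets \<nu>" using A by (simp add: sets_radon[OF \<nu>])
  then show "emeasure \<nu> (UNIV - A) = 0"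
    using carried space_radon[OF \<nu>] by (simp add: AE_iff_measurable[OF _ refl] Diff_eq Collect_neg_eq)
qed

lemma Cc_extension_of_product:
  fixes \<phi> g :: "'a::t2_space \<Rightarrow> real"
  assumes lc: "locally_compact_space (euclidean :: 'a topology)"
    and \<phi>: "\<phi> \<in> Cc" and A: "closed A" and g: "continuous_on A g"
  shows "\<exists>f\<in>Cc. \<forall>x\<in>A. f x = \<phi> x * g x"
proof -
  obtain K where K: "compact K" "\<And>x. x \<notin> K \<Longrightarrow> \<phi> x = 0" using Cc_E[OF \<phi>] by metis
  have "compact (K \<inter> A)" using K(1) A by (rule compact_Int_closed)
  moreover have "continuous_on (K \<inter> A) g" using g by (rule continuous_on_subset) auto
  ultimately obtain h where h: "continuous_on UNIV h" "\<And>x. x \<in> K \<inter> A \<Longrightarrow> h x = g x"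
    using Tietze_extension_completely_regular[OF completely_regular_locally_compact_t2[OF lc],
        of "K \<inter> A" UNIV g]
    by auto
  show ?thesis
  proof (rule bexI[OF _ Cc_mult_continuous[OF \<phi> h(1)]])
    show "\<forall>x\<in>A. \<phi> x * h x = \<phi> x * g x" using h(2) K(2) by auto
  qed
qed

lemma nn_integral_Cc_on_carrier:
  fixes \<mu> :: "'a::t2_space measure"
  assumes \<mu>: "radon \<mu>" "emeasure \<mu> (UNIV - A) = 0" and A: "closed A" and f: "f \<in> Cc" "\<And>x. x \<in> A \<Longrightarrow> 0 \<le> f x"
  shows "(\<integral>\<^sup>+x\<in>A. ennreal (f x) \<partial>\<mu>) = ennreal (integral\<^sup>L \<mu> f)"
proof -
  have carried: "AE x in \<mu>. x \<in> A" using \<mu> A by (intro AE_carrier) (auto simp: sets_radon)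
  then have "(\<integral>\<^sup>+x\<in>A. ennreal (f x) \<partial>\<mu>) = (\<integral>\<^sup>+ x. ennreal (f x) \<partial>\<mu>)"
    by (intro nn_integral_cong_AE) (auto elim: eventually_mono)
  also have "\<dots> = ennreal (integral\<^sup>L \<mu> f)"
    using carried f(2)
    by (intro nn_integral_eq_integral integrable_Cc[OF \<mu>(1) f(1)]) (auto elim: eventually_mono)
  finally show ?thesis .
qed

context consistent_kernel
begin

text \<open>No weight escapes to infinity, and by Tietze's theorem \<open>\<phi> g\<close> with a cut-off function \<open>\<phi>\<close> extends from
  the plate to a test function for vague convergence.\<close>

lemma vague_limit_weight_ge:
  assumes \<nu>: "radon \<nu>" "emeasure \<nu> (UNIV - A) = 0" and A: "closed A" "cap \<kappa> A \<noteq> \<infinity>"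
    and g: "continuous_on A g" "\<And>x. x \<in> A \<Longrightarrow> 0 < g x" "growth_condition \<kappa> A g" and G: "G \<noteq> bot"
    and M: "\<forall>\<^sub>F v in G. inEp \<kappa> (M v) \<and> emeasure (M v) UNIV < \<infinity> \<and> energy (M v) (M v) \<le> R \<and>
       emeasure (M v) (UNIV - A) = 0 \<and> (\<integral>\<^sup>+x\<in>A. ennreal (g x) \<partial>M v) = ennreal b"
    and vague: "vaguely_tendsto M \<nu> G"
  shows "ennreal b \<le> (\<integral>\<^sup>+x\<in>A. ennreal (g x) \<partial>\<nu>)"
proof (rule ennreal_le_epsilon)
  fix e :: real assume e: "0 < e"
  obtain K where K: "compact K" "\<And>\<mu>. inEp \<kappa> \<mu> \<Longrightarrow> emeasure \<mu> UNIV < \<infinity> \<Longrightarrow> energy \<mu> \<mu> \<le> R \<Longrightarrow>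
        (\<integral>\<^sup>+x\<in>A - K. ennreal (g x) \<partial>\<mu>) \<le> ennreal e"
    using weight_tail[OF A(2,1) g e] by metis
  obtain \<phi> where \<phi>: "\<phi> \<in> Cc" "\<And>x. 0 \<le> \<phi> x" "\<And>x. \<phi> x \<le> 1" "\<And>x. x \<in> K \<Longrightarrow> \<phi> x = 1"
    by (rule urysohn_compact[OF lc K(1) open_UNIV subset_UNIV]) (rule that)
  obtain f where f_Cc: "f \<in> Cc" and f_eq: "\<forall>x\<in>A. f x = \<phi> x * g x"
    using Cc_extension_of_product[OF lc \<phi>(1) A(1) g(1)] ..
  have f_nonneg: "0 \<le> f x" if "x \<in> A" for x using \<phi>(2)[of x] g(2)[OF that] f_eq that by simp
  have cut_off: "(\<integral>\<^sup>+x\<in>A. ennreal (f x) \<partial>\<mu>) = ennreal (integral\<^sup>L \<mu> f)"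
    if "radon \<mu>" "emeasure \<mu> (UNIV - A) = 0" for \<mu>
    using that A(1) f_Cc f_nonneg by (rule nn_integral_Cc_on_carrier)
  have "\<forall>\<^sub>F v in G. ennreal b \<le> ennreal (integral\<^sup>L (M v) f) + ennreal e"
    using M
  proof eventually_elim
    case (elim v)
    then have radon: "radon (M v)" by (simp add: inEp_def)
    have [measurable]: "(\<lambda>x. ennreal (f x) * indicator A x) \<in> borel_measurable (M v)"
      "(\<lambda>x. ennreal (g x) * indicator (A - K) x) \<in> borel_measurable (M v)"
      using A(1) g(1) K(1) continuous_on_subset[OF Cc_cont[OF f_Cc]]
      by (auto intro!: borel_measurable_radon[OF radon] borel_measurable_weight[OF A(1)]
          intro: borel_compact)
    have "(\<integral>\<^sup>+x\<in>A. ennreal (g x) \<partial>M v)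
        \<le> (\<integral>\<^sup>+ x. ennreal (f x) * indicator A x + ennreal (g x) * indicator (A - K) x \<partial>M v)"
      using \<phi>(4) f_eq by (intro nn_integral_mono) (auto simp: indicator_def)
    also have "\<dots> = ennreal (integral\<^sup>L (M v) f) + (\<integral>\<^sup>+x\<in>A - K. ennreal (g x) \<partial>M v)"
      using elim radon by (simp add: nn_integral_add cut_off)
    also have "\<dots> \<le> ennreal (integral\<^sup>L (M v) f) + ennreal e" using K(2) elim by (intro add_left_mono) auto
    finally show ?case using elim by simp
  qed
  moreover have "((\<lambda>v. ennreal (integral\<^sup>L (M v) f) + ennreal e) \<longlongrightarrow> ennreal (integral\<^sup>L \<nu> f) + ennreal e) G"
    by (intro tendsto_add tendsto_ennrealI tendsto_const vaguely_tendstoD[OF vague f_Cc])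
  ultimately have "ennreal b \<le> ennreal (integral\<^sup>L \<nu> f) + ennreal e" using G tendsto_lowerbound by blast
  also have "ennreal (integral\<^sup>L \<nu> f) \<le> (\<integral>\<^sup>+x\<in>A. ennreal (g x) \<partial>\<nu>)"
    unfolding cut_off[OF \<nu>, symmetric] using f_eq \<phi>(2,3) g(2)
    by (intro nn_integral_mono)
      (auto simp: indicator_def mult_left_le_one_le less_imp_le intro!: ennreal_leI)
  finally show "ennreal b \<le> (\<integral>\<^sup>+x\<in>A. ennreal (g x) \<partial>\<nu>) + ennreal e" by (simp add: add_right_mono)
qed

end

subsection \<open>The Gauss problem on a condenser\<close>

locale condenser_problem = consistent_kernel \<kappa> for \<kappa> :: "'a::t2_space kernel" +
  fixes Ip In :: "'i set" and A :: "'i \<Rightarrow> 'a set" and ch :: "'a smeasure" and g :: "'a \<Rightarrow> real"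
    and a :: "'i \<Rightarrow> real" and l :: 'i
  assumes condenser: "condenser \<kappa> Ip In A" and external_field: "ext_field \<kappa> Ip In A ch"
    and g_ok: "g_ok \<kappa> (Ip \<union> In) A g" and l_in_In: "l \<in> In"
    and disjoint_from_A_l: "\<And>i. i \<in> Ip \<union> In \<Longrightarrow> i \<noteq> l \<Longrightarrow> A i \<inter> A l = {}"
    and cap_A_l: "cap \<kappa> (A l) = \<infinity>"
    and cap_finite: "\<And>i. i \<in> Ip \<union> In \<Longrightarrow> i \<noteq> l \<Longrightarrow> cap \<kappa> (A i) \<noteq> \<infinity>"
    and a_pos: "\<And>i. i \<in> Ip \<union> In \<Longrightarrow> a i > 0" and a_summable: "a summable_on (Ip \<union> In)"
begin

abbreviation I :: "'i set" where "I \<equiv> Ip \<union> In"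

abbreviation weight :: "'i \<Rightarrow> 'a measure \<Rightarrow> ennreal" where
  "weight i \<mu> \<equiv> (\<integral>\<^sup>+x\<in>A i. ennreal (g x) \<partial>\<mu>)"

abbreviation R :: "('i \<Rightarrow> 'a measure) \<Rightarrow> 'a smeasure" where
  "R \<equiv> Rm Ip In"

abbreviation finite_energy :: "('i \<Rightarrow> 'a measure) \<Rightarrow> bool" where
  "finite_energy \<equiv> EA \<kappa> Ip In A"

abbreviation feasible :: "'i set \<Rightarrow> ('i \<Rightarrow> 'a measure) \<Rightarrow> bool" where
  "feasible \<equiv> EAag \<kappa> Ip In A a g"

abbreviation minimizes :: "'i set \<Rightarrow> ('i \<Rightarrow> 'a measure) \<Rightarrow> bool" where
  "minimizes \<equiv> solves \<kappa> Ip In A a g ch"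

lemma l_in_I: "l \<in> I" and l_notin_Ip: "l \<notin> Ip"
  using l_in_In condenser by (auto simp: condenser_def)

lemma countable_I: "countable I"
  using condenser by (auto simp: condenser_def)

lemma closed_plate: "i \<in> I \<Longrightarrow> closed (A i)"
  using condenser by (auto simp: condenser_def)

lemma loc_finite_plates: "S \<subseteq> I \<Longrightarrow> loc_finite S A"
proof (rule loc_finite_subset)
  show "loc_finite I A" using condenser unfolding condenser_def loc_finite_def by blast
qed auto

lemma opposite_plates_disjoint: "i \<in> Ip \<Longrightarrow> j \<in> In \<Longrightarrow> A i \<inter> A j = {}"
  using condenser unfolding condenser_def by blast

lemma continuous_on_plate: "i \<in> I \<Longrightarrow> continuous_on (A i) g"
  using g_ok unfolding g_ok_def by (meson UN_upper continuous_on_subset)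

definition g_inf :: real where "g_inf = (INF x\<in>(\<Union>i\<in>I. A i). g x)"

lemma g_inf_pos: "0 < g_inf" and g_inf_le: "i \<in> I \<Longrightarrow> x \<in> A i \<Longrightarrow> g_inf \<le> g x"
proof -
  obtain c where c: "0 < c" "\<forall>x\<in>(\<Union>i\<in>I. A i). c \<le> g x" using g_ok unfolding g_ok_def by blast
  have "A l \<noteq> {}" using condenser l_in_In by (simp add: condenser_def)
  then have "c \<le> g_inf" unfolding g_inf_def using c(2) l_in_In by (intro cINF_greatest) blast+
  then show "0 < g_inf" using c(1) by simp
  show "g_inf \<le> g x" if "i \<in> I" "x \<in> A i"
    unfolding g_inf_def using c(2) that by (intro cINF_lower bdd_belowI2[of _ c]) blast+
qed

lemma g_pos: "i \<in> I \<Longrightarrow> x \<in> A i \<Longrightarrow> 0 < g x"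
  using g_inf_pos g_inf_le less_le_trans by blast

lemma borel_measurable_plate_weight:
    "i \<in> I \<Longrightarrow> (\<lambda>x. ennreal (g x) * indicator (A i) x) \<in> borel_measurable borel"
  by (intro borel_measurable_weight[OF closed_plate continuous_on_plate]) (auto simp: closed_plate)

definition plate_measures :: "'i \<Rightarrow> 'a measure set" where
  "plate_measures i = {\<mu>. radon \<mu> \<and> emeasure \<mu> (UNIV - A i) = 0}"

lemma plate_measures_sets: "\<mu> \<in> plate_measures i \<Longrightarrow> sets \<mu> = sets borel"
  by (simp add: plate_measures_def sets_radon)

lemma plate_measures_scale: "\<mu> \<in> plate_measures i \<Longrightarrow> 0 \<le> t \<Longrightarrow> scale_measure (ennreal t) \<mu> \<in> plate_measures i"
  by (simp add: plate_measures_def radon_scale)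

lemma plate_measures_madd: "\<mu> \<in> plate_measures i \<Longrightarrow> \<nu> \<in> plate_measures i \<Longrightarrow> madd \<mu> \<nu> \<in> plate_measures i"
  by (simp add: plate_measures_def radon_madd emeasure_madd sets_radon)

lemma plate_measures_restr:
  assumes "\<mu> \<in> plate_measures i" "inEp \<kappa> \<mu>" "B \<in> sets borel" "i \<in> I"
  shows "restr B \<mu> \<in> plate_measures i"
proof -
  have "emeasure (restr B \<mu>) (UNIV - A i) \<le> emeasure \<mu> (UNIV - A i)"
    using assms closed_plate[of i] by (intro emeasure_restr_le) (auto simp: plate_measures_sets)
  then show ?thesis using assms inEp_restr[OF assms(2,3)] by (simp add: plate_measures_def inEp_radon)
qed

lemma conc_iff_plate_measures:
  assumes "i \<in> I" "radon \<mu>" shows "conc \<mu> (A i) \<longleftrightarrow> \<mu> \<in> plate_measures i"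
  using assms conc_closed_iff[OF closed_plate[OF assms(1)] sets_radon[OF assms(2)]]
  by (simp add: plate_measures_def)

lemma weight_scale:
  assumes "i \<in> I" "\<mu> \<in> plate_measures i" shows "weight i (scale_measure c \<mu>) = c * weight i \<mu>"
  by (rule nn_integral_scale_measure)
    (rule borel_measurable_cong_sets[OF
      plate_measures_sets[OF assms(2)] borel_measurable_plate_weight[OF assms(1)]])

lemma weight_madd:
  assumes "i \<in> I" "\<mu> \<in> plate_measures i" "\<nu> \<in> plate_measures i"
  shows "weight i (madd \<mu> \<nu>) = weight i \<mu> + weight i \<nu>"
  using assms by (intro nn_integral_madd borel_measurable_plate_weight plate_measures_sets)

lemma mass_le_weight:
  assumes i: "i \<in> I" and \<mu>: "\<mu> \<in> plate_measures i"
  shows "ennreal g_inf * emeasure \<mu> UNIV \<le> weight i \<mu>"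
proof -
  have A: "A i \<in> sets \<mu>" using closed_plate[OF i] by (simp add: plate_measures_sets[OF \<mu>])
  have "emeasure \<mu> (A i) = emeasure \<mu> UNIV"
    using emeasure_Int_carrier[of \<mu> "A i" UNIV] \<mu> closed_plate[OF i]
    by (simp add: plate_measures_def sets_radon)
  then have "ennreal g_inf * emeasure \<mu> UNIV = (\<integral>\<^sup>+x\<in>A i. ennreal g_inf \<partial>\<mu>)"
    by (simp add: nn_integral_cmult_indicator[OF A])
  also have "\<dots> \<le> weight i \<mu>"
    using g_inf_le[OF i] by (intro nn_integral_mono) (auto simp: indicator_def intro!: ennreal_leI)
  finally show ?thesis .
qed

lemma mass_le:
  assumes i: "i \<in> I" and \<mu>: "\<mu> \<in> plate_measures i" and b: "weight i \<mu> \<le> ennreal b" "0 \<le> b"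
  shows "emeasure \<mu> UNIV \<le> ennreal (b / g_inf)"
proof -
  have bound: "ennreal g_inf * emeasure \<mu> UNIV \<le> ennreal b"
    using mass_le_weight[OF i \<mu>] b(1) by (rule order_trans)
  then have "emeasure \<mu> UNIV \<noteq> top" using g_inf_pos by (auto simp: ennreal_mult_top top_unique)
  then obtain m where m: "emeasure \<mu> UNIV = ennreal m" "0 \<le> m" by (cases "emeasure \<mu> UNIV") auto
  then have "g_inf * m \<le> b"
    using bound g_inf_pos b(2) by (simp add: ennreal_mult'[symmetric] ennreal_le_iff)
  then show ?thesis unfolding m(1) using g_inf_pos by (intro ennreal_leI) (simp add: field_simps)
qed

definition plate_family :: "('i \<Rightarrow> 'a measure) \<Rightarrow> bool" where
  "plate_family \<mu> \<longleftrightarrow> (\<forall>i\<in>I. \<mu> i \<in> plate_measures i)"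

lemma plate_familyD: "plate_family \<mu> \<Longrightarrow> i \<in> I \<Longrightarrow> \<mu> i \<in> plate_measures i"
  by (simp add: plate_family_def)

lemma plate_family_sets: "plate_family \<mu> \<Longrightarrow> i \<in> I \<Longrightarrow> sets (\<mu> i) = sets borel"
  using plate_familyD plate_measures_sets by blast

lemma plate_subfamily:
  assumes "plate_family \<mu>" "S \<subseteq> I" shows "loc_finite_radon_family S A \<mu>"
proof
  show "countable S" using countable_subset[OF assms(2) countable_I] .
  show "loc_finite S A" by (rule loc_finite_plates[OF assms(2)])
  show "closed (A i)" "radon (\<mu> i)" "emeasure (\<mu> i) (UNIV - A i) = 0" if "i \<in> S" for i
    using that assms closed_plate plate_familyD[OF assms(1), of i] by (auto simp: plate_measures_def)
qed

lemmas radon_msum_plates = loc_finite_radon_family.radon_msum[OF plate_subfamily]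

lemma closed_UN_plates: "S \<subseteq> I \<Longrightarrow> closed (\<Union>i\<in>S. A i)"
  using closed_plate by (intro loc_finite_closed_UN loc_finite_plates) auto

lemma msingular_plates:
  assumes \<mu>: "plate_family \<mu>" shows "msingular (msum Ip \<mu>) (msum In \<mu>)"
proof -
  interpret positive: loc_finite_radon_family Ip A \<mu> by (rule plate_subfamily[OF \<mu>]) simp
  interpret negative: loc_finite_radon_family In A \<mu> by (rule plate_subfamily[OF \<mu>]) simp
  have "emeasure (msum In \<mu>) (\<Union>i\<in>Ip. A i) = 0"
    using opposite_plates_disjoint by (intro negative.emeasure_msum_disjoint) auto
  then show ?thesis
    unfolding msingular_def using positive.emeasure_msum_carrier closed_UN_plates[of Ip]
    by (intro bexI[of _ "\<Union>i\<in>Ip. A i"]) auto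
qed

lemma msum_In_remove: "plate_family \<mu> \<Longrightarrow> msum In \<mu> = madd (msum (In - {l}) \<mu>) (\<mu> l)"
  using l_in_In by (intro msum_remove plate_family_sets) auto

lemma emeasure_msum_off_A_l:
  assumes \<mu>: "plate_family \<mu>" and S: "S \<subseteq> I - {l}" shows "emeasure (msum S \<mu>) (B \<inter> A l) = 0"
proof -
  interpret loc_finite_radon_family S A \<mu> using S by (intro plate_subfamily \<mu>) auto
  show ?thesis using S disjoint_from_A_l by (intro emeasure_msum_disjoint) blast
qed

lemma emeasure_msum_In_A_l:
  assumes \<mu>: "plate_family \<mu>" and B: "B \<in> sets borel"
  shows "emeasure (msum In \<mu>) (B \<inter> A l) = emeasure (\<mu> l) B"
proof -
  have "emeasure (msum In \<mu>) (B \<inter> A l) = emeasure (\<mu> l) (B \<inter> A l)"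
    using emeasure_msum_off_A_l[OF \<mu>, of "In - {l}" B] plate_family_sets[OF \<mu> l_in_I]
    by (simp add: msum_In_remove[OF \<mu>] emeasure_madd Diff_mono)
  also have "\<dots> = emeasure (\<mu> l) B"
    using plate_familyD[OF \<mu> l_in_I] closed_plate[OF l_in_I] B
    by (intro emeasure_Int_carrier) (auto simp: plate_measures_def sets_radon)
  finally show ?thesis .
qed

lemma finite_energy_iff: "finite_energy \<mu> \<longleftrightarrow> plate_family \<mu> \<and> energy_pair (R \<mu>)"
proof -
  have "(\<forall>i\<in>I. radon (\<mu> i) \<and> conc (\<mu> i) (A i)) \<longleftrightarrow> plate_family \<mu>"
    unfolding plate_family_def using conc_iff_plate_measures by (auto simp: plate_measures_def)
  moreover have "inE \<kappa> (R \<mu>) \<longleftrightarrow> energy_pair (R \<mu>)" if "plate_family \<mu>"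
    using that msingular_plates kint_finite[of "msum Ip \<mu>" "msum In \<mu>"]
      kint_finite[of "msum In \<mu>" "msum Ip \<mu>"]
    by (auto simp: energy_pair_def Rm_def inE_def finen_def inEp_def)
  ultimately show ?thesis unfolding EA_def by blast
qed

lemma finite_energyD: "finite_energy \<mu> \<Longrightarrow> plate_family \<mu>" "finite_energy \<mu> \<Longrightarrow> energy_pair (R \<mu>)"
  by (simp_all add: finite_energy_iff)

lemma feasible_finite_energy: "feasible J \<mu> \<Longrightarrow> finite_energy \<mu>"
  by (simp add: EAag_def)

lemma feasible_weight: "feasible J \<mu> \<Longrightarrow> i \<in> J \<Longrightarrow> weight i (\<mu> i) = ennreal (a i)"
  by (simp add: EAag_def)

lemma feasibleI: "finite_energy \<mu> \<Longrightarrow> (\<And>i. i \<in> J \<Longrightarrow> weight i (\<mu> i) = ennreal (a i)) \<Longrightarrow> feasible J \<mu>"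
  by (simp add: EAag_def)

lemma energy_pair_ch: "energy_pair ch"
  using external_field by (simp add: ext_field_def inE_def finen_def energy_pair_def inEp_def)

definition gauss :: "'a smeasure \<Rightarrow> real" where
  "gauss z = ip \<kappa> z z + 2 * ip \<kappa> ch z"

lemma gauss_eq_nrm: "energy_pair z \<Longrightarrow> gauss z = (nrm \<kappa> (padd z ch))\<^sup>2 - ip \<kappa> ch ch"
  using energy_pair_ch ip_sym[of z ch] by (simp add: gauss_def nrm_sq ip_linear)

lemma gauss_ge: "energy_pair z \<Longrightarrow> - ip \<kappa> ch ch \<le> gauss z"
  by (simp add: gauss_eq_nrm)

lemma gauss_pconv:
  assumes "energy_pair z" "energy_pair w" "0 \<le> t" "t \<le> 1"
  shows "gauss (pconv t z w) = (1 - t) * gauss z + t * gauss w - t * (1 - t) * (nrm \<kappa> (pdiff z w))\<^sup>2"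
  unfolding gauss_def ip_pconv[OF assms]
  using assms energy_pair_ch by (simp add: pconv_def ip_linear algebra_simps)

lemma gauss_pconv_le:
  assumes "energy_pair z" "energy_pair w" "0 \<le> t" "t \<le> 1"
  shows "gauss (pconv t z w) \<le> (1 - t) * gauss z + t * gauss w"
  using assms by (simp add: gauss_pconv)

lemma abs_gauss_diff_le:
  assumes z: "energy_pair z" and w: "energy_pair w"
  shows "\<bar>gauss w - gauss z\<bar> \<le> nrm \<kappa> (pdiff w z) * (2 * nrm \<kappa> (padd z ch) + nrm \<kappa> (pdiff w z))"
proof -
  let ?d = "pdiff w z"
  have d: "energy_pair ?d" by (rule energy_pair_pdiff[OF w z])
  have "gauss w - gauss z = 2 * ip \<kappa> (padd z ch) ?d + (nrm \<kappa> ?d)\<^sup>2"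
    unfolding nrm_sq[OF d] gauss_def unfolding pdiff_def using z w energy_pair_ch ip_sym[OF z w]
    by (simp add: ip_linear algebra_simps)
  then have "\<bar>gauss w - gauss z\<bar> \<le> 2 * (nrm \<kappa> (padd z ch) * nrm \<kappa> ?d) + (nrm \<kappa> ?d)\<^sup>2"
    using ip_cauchy_schwarz[OF energy_pair_padd[OF z energy_pair_ch] d] zero_le_power2[of "nrm \<kappa> ?d"]
    by linarith
  then show ?thesis by (simp add: power2_eq_square algebra_simps)
qed

lemma gauss_continuous:
  assumes z: "energy_pair z" and e: "0 < e"
  obtains d where "0 < d" "\<And>w. energy_pair w \<Longrightarrow> nrm \<kappa> (pdiff w z) \<le> d \<Longrightarrow> \<bar>gauss w - gauss z\<bar> \<le> e"
proof -
  define N where "N = nrm \<kappa> (padd z ch)"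
  have N: "0 \<le> N" unfolding N_def by (intro nrm_nonneg energy_pair_padd z energy_pair_ch)
  define d where "d = min 1 (e / (2 * N + 1))"
  have d: "0 < d" "d \<le> 1" using e N by (auto simp: d_def)
  have "d \<le> e / (2 * N + 1)" by (simp add: d_def)
  then have d_le: "d * (2 * N + 1) \<le> e" using N by (simp add: pos_le_divide_eq)
  have "\<bar>gauss w - gauss z\<bar> \<le> e" if w: "energy_pair w" "nrm \<kappa> (pdiff w z) \<le> d" for w
  proof -
    have "0 \<le> nrm \<kappa> (pdiff w z)" by (intro nrm_nonneg energy_pair_pdiff w z)
    then have "nrm \<kappa> (pdiff w z) * (2 * N + nrm \<kappa> (pdiff w z)) \<le> d * (2 * N + 1)"
      using w(2) d N by (intro mult_mono) auto
    then show ?thesis using abs_gauss_diff_le[OF z w(1)] d_le unfolding N_def by linarith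
  qed
  then show ?thesis using that d(1) by blast
qed

lemma minimizes_iff:
  "minimizes J \<mu> \<longleftrightarrow> feasible J \<mu> \<and> (\<forall>\<nu>. feasible J \<nu> \<longrightarrow> gauss (R \<mu>) \<le> gauss (R \<nu>))"
proof -
  have Gchi: "Gchi \<kappa> Ip In ch \<nu> = gauss (R \<nu>)" if "feasible J \<nu>" for \<nu>
    using feasible_finite_energy[OF that] by (simp add: Gchi_def gauss_def nrm_sq finite_energyD)
  have "ereal (Gchi \<kappa> Ip In ch \<mu>) = Ginf \<kappa> Ip In A a g ch J
      \<longleftrightarrow> (\<forall>\<nu>. feasible J \<nu> \<longrightarrow> gauss (R \<mu>) \<le> gauss (R \<nu>))" if \<mu>: "feasible J \<mu>"
  proof -
    have "Ginf \<kappa> Ip In A a g ch J \<le> ereal (Gchi \<kappa> Ip In ch \<mu>)"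
      unfolding Ginf_def using \<mu> by (auto intro: INF_lower)
    then have "ereal (Gchi \<kappa> Ip In ch \<mu>) = Ginf \<kappa> Ip In A a g ch J
        \<longleftrightarrow> ereal (Gchi \<kappa> Ip In ch \<mu>) \<le> Ginf \<kappa> Ip In A a g ch J" by auto
    then show ?thesis using \<mu> by (simp add: Ginf_def le_INF_iff Gchi)
  qed
  then show ?thesis unfolding solves_def by blast
qed

lemma
  assumes "minimizes J \<mu>"
  shows minimizes_feasible: "feasible J \<mu>"
    and minimizes_le: "feasible J \<nu> \<Longrightarrow> gauss (R \<mu>) \<le> gauss (R \<nu>)"
  using assms by (auto simp: minimizes_iff)

definition vconv :: "real \<Rightarrow> ('i \<Rightarrow> 'a measure) \<Rightarrow> ('i \<Rightarrow> 'a measure) \<Rightarrow> 'i \<Rightarrow> 'a measure" where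
  "vconv t \<mu> \<nu> i = mconv t (\<mu> i) (\<nu> i)"

lemma msum_vconv:
  assumes "plate_family \<mu>" "plate_family \<nu>" "S \<subseteq> I"
  shows "msum S (vconv t \<mu> \<nu>) = mconv t (msum S \<mu>) (msum S \<nu>)"
  unfolding vconv_def[abs_def] using assms by (intro msum_mconv plate_family_sets) auto

lemma R_vconv: "plate_family \<mu> \<Longrightarrow> plate_family \<nu> \<Longrightarrow> R (vconv t \<mu> \<nu>) = pconv t (R \<mu>) (R \<nu>)"
  by (simp add: Rm_def msum_vconv mconv_def pconv_def padd_def pscale_def)

lemma finite_energy_vconv:
  assumes \<mu>: "finite_energy \<mu>" and \<nu>: "finite_energy \<nu>" and t: "0 \<le> t" "t \<le> 1"
  shows "finite_energy (vconv t \<mu> \<nu>)"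
proof -
  have "plate_family (vconv t \<mu> \<nu>)"
    using \<mu> \<nu> t
    by (simp add: plate_family_def vconv_def mconv_def finite_energy_iff
        plate_measures_madd plate_measures_scale)
  then show ?thesis
    using \<mu> \<nu> t by (simp add: finite_energy_iff R_vconv energy_pair_pconv)
qed

lemma weight_vconv:
  assumes "plate_family \<mu>" "plate_family \<nu>" "i \<in> I" "0 \<le> t" "t \<le> 1"
  shows "weight i (vconv t \<mu> \<nu> i) = ennreal (1 - t) * weight i (\<mu> i) + ennreal t * weight i (\<nu> i)"
  unfolding vconv_def using assms
  by (intro nn_integral_mconv plate_family_sets borel_measurable_plate_weight)

lemma feasible_vconv:
  assumes \<mu>: "feasible J \<mu>" and \<nu>: "feasible J \<nu>" and t: "0 \<le> t" "t \<le> 1" and J: "J \<subseteq> I"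
  shows "feasible J (vconv t \<mu> \<nu>)"
proof (rule feasibleI)
  have energy: "finite_energy \<mu>" "finite_energy \<nu>" using \<mu> \<nu> by (auto intro: feasible_finite_energy)
  then show "finite_energy (vconv t \<mu> \<nu>)" by (rule finite_energy_vconv[OF _ _ t])
  fix i assume i: "i \<in> J"
  then have "weight i (vconv t \<mu> \<nu> i) = ennreal (1 - t) * ennreal (a i) + ennreal t * ennreal (a i)"
    using energy t J
    by (subst weight_vconv) (auto simp: finite_energyD feasible_weight[OF \<mu>] feasible_weight[OF \<nu>])
  also have "\<dots> = ennreal (a i)"
    using t by (simp add: distrib_right[symmetric] flip: ennreal_plus)
  finally show "weight i (vconv t \<mu> \<nu> i) = ennreal (a i)" .
qed

text \<open>The strict convexity of the energy determines \<open>R \<mu>\<close>, and \<open>\<mu> l\<close> is its restriction to \<open>A l\<close>.\<close>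

lemma minimizers_agree:
  assumes \<mu>: "minimizes J \<mu>" and \<nu>: "minimizes J \<nu>" and J: "J \<subseteq> I"
  shows "\<mu> l = \<nu> l"
proof -
  have feasible: "feasible J \<mu>" "feasible J \<nu>" using \<mu> \<nu> by (auto intro: minimizes_feasible)
  then have plates: "plate_family \<mu>" "plate_family \<nu>" and pairs: "energy_pair (R \<mu>)" "energy_pair (R \<nu>)"
    by (auto intro: finite_energyD feasible_finite_energy)
  let ?d = "pdiff (R \<mu>) (R \<nu>)"
  have "gauss (R \<mu>) \<le> gauss (pconv (1/2) (R \<mu>) (R \<nu>))"
    using minimizes_le[OF \<mu> feasible_vconv[OF feasible _ _ J, of "1/2"]] by (simp add: R_vconv[OF plates])
  moreover have "gauss (R \<nu>) = gauss (R \<mu>)"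
    using minimizes_le[OF \<mu> feasible(2)] minimizes_le[OF \<nu> feasible(1)] by simp
  ultimately have "(nrm \<kappa> ?d)\<^sup>2 \<le> 0" using gauss_pconv[OF pairs, of "1/2"] by simp
  then have "ip \<kappa> ?d ?d = 0" by (simp add: nrm_def)
  then have "fst ?d = snd ?d" by (rule ip_zero_imp_eq[OF energy_pair_pdiff[OF pairs]])
  then have sums_eq: "madd (msum Ip \<mu>) (msum In \<nu>) = madd (msum In \<mu>) (msum Ip \<nu>)"
    by (simp add: pdiff_def padd_def pneg_def Rm_def)
  have off: "emeasure (msum Ip \<rho>) (B \<inter> A l) = 0" if "plate_family \<rho>" for \<rho> B
    using l_notin_Ip by (intro emeasure_msum_off_A_l that) auto
  show ?thesis
  proof (rule measure_eqI)
    show "sets (\<mu> l) = sets (\<nu> l)" using plates l_in_I by (simp add: plate_family_sets)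
    fix B assume "B \<in> sets (\<mu> l)"
    then have B: "B \<in> sets borel" by (simp add: plate_family_sets[OF plates(1) l_in_I])
    have "emeasure (\<nu> l) B = emeasure (madd (msum Ip \<mu>) (msum In \<nu>)) (B \<inter> A l)"
      by (simp add: emeasure_madd emeasure_msum_In_A_l off plates B)
    also have "\<dots> = emeasure (\<mu> l) B"
      unfolding sums_eq by (simp add: emeasure_madd emeasure_msum_In_A_l off plates B)
    finally show "emeasure (\<mu> l) B = emeasure (\<nu> l) B" ..
  qed
qed

lemma finite_energy_parts:
  assumes "finite_energy \<mu>"
  shows "inEp \<kappa> (msum Ip \<mu>)" "inEp \<kappa> (msum In \<mu>)" "inEp \<kappa> (msum (In - {l}) \<mu>)" "inEp \<kappa> (\<mu> l)"
      "\<mu> l \<in> plate_measures l"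
proof -
  have plates: "plate_family \<mu>" and parts: "inEp \<kappa> (msum Ip \<mu>)" "inEp \<kappa> (msum In \<mu>)"
    using assms by (auto simp: finite_energy_iff energy_pair_def Rm_def)
  show "inEp \<kappa> (msum Ip \<mu>)" "inEp \<kappa> (msum In \<mu>)" by (rule parts)+
  show l: "\<mu> l \<in> plate_measures l" by (rule plate_familyD[OF plates l_in_I])
  have "radon (msum (In - {l}) \<mu>)" by (rule radon_msum_plates[OF plates]) auto
  then show "inEp \<kappa> (msum (In - {l}) \<mu>)" "inEp \<kappa> (\<mu> l)"
    using inEp_maddD[of "msum (In - {l}) \<mu>" "\<mu> l"] l parts(2)
    by (auto simp: msum_In_remove[OF plates] plate_measures_def)
qed

lemma
  assumes \<mu>: "finite_energy \<mu>" and \<omega>: "inEp \<kappa> \<omega>" "\<omega> \<in> plate_measures l"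
  shows finite_energy_update: "finite_energy (\<mu>(l := \<omega>))"
    and R_update: "R (\<mu>(l := \<omega>)) = (msum Ip \<mu>, madd (msum (In - {l}) \<mu>) \<omega>)"
proof -
  have plates: "plate_family \<mu>" by (rule finite_energyD[OF \<mu>])
  have "msum In (\<mu>(l := \<omega>)) = madd (msum (In - {l}) \<mu>) \<omega>"
    using l_in_In \<omega> by (intro msum_update plate_family_sets[OF plates]) (auto simp: inEp_sets)
  moreover have "msum Ip (\<mu>(l := \<omega>)) = msum Ip \<mu>" using l_notin_Ip by (intro msum_cong) auto
  ultimately show R: "R (\<mu>(l := \<omega>)) = (msum Ip \<mu>, madd (msum (In - {l}) \<mu>) \<omega>)" by (simp add: Rm_def)
  have "plate_family (\<mu>(l := \<omega>))" using plates \<omega> by (auto simp: plate_family_def)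
  then show "finite_energy (\<mu>(l := \<omega>))"
    using finite_energy_parts[OF \<mu>] \<omega> unfolding finite_energy_iff R by (simp add: energy_pair_def inEp_madd)
qed

lemma feasible_update:
  assumes "feasible (I - {l}) \<mu>" "inEp \<kappa> \<omega>" "\<omega> \<in> plate_measures l"
  shows "feasible (I - {l}) (\<mu>(l := \<omega>))"
  using assms finite_energy_update unfolding EAag_def by auto

lemma nrm_update_diff:
  assumes \<mu>: "finite_energy \<mu>"
    and \<omega>: "inEp \<kappa> \<omega>" "\<omega> \<in> plate_measures l" and \<rho>: "inEp \<kappa> \<rho>" "\<rho> \<in> plate_measures l"
  shows "nrm \<kappa> (pdiff (R (\<mu>(l := \<omega>))) (R (\<mu>(l := \<rho>)))) = nrm \<kappa> (\<omega>, \<rho>)"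
proof -
  let ?P = "msum Ip \<mu>" and ?N = "msum (In - {l}) \<mu>"
  note parts = finite_energy_parts[OF \<mu>]
  have "nrm \<kappa> (pdiff (R (\<mu>(l := \<omega>))) (R (\<mu>(l := \<rho>)))) = nrm \<kappa> (madd (madd \<rho> ?N) ?P, madd (madd \<omega> ?N) ?P)"
    by (simp add: R_update[OF \<mu> \<omega>] R_update[OF \<mu> \<rho>] pdiff_def padd_def pneg_def madd_commute)
  also have "\<dots> = nrm \<kappa> (\<rho>, \<omega>)" using parts \<omega> \<rho> by (simp add: nrm_madd_cancel inEp_madd)
  finally show ?thesis by (simp add: nrm_swap)
qed

lemma gauss_update_le:
  assumes \<mu>: "feasible J \<mu>" and e: "0 < e"
  obtains d where "0 < d" "\<And>\<omega>. inEp \<kappa> \<omega> \<Longrightarrow> \<omega> \<in> plate_measures l \<Longrightarrow> nrm \<kappa> (\<omega>, \<mu> l) \<le> d \<Longrightarrow>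
    gauss (R (\<mu>(l := \<omega>))) \<le> gauss (R \<mu>) + e"
proof -
  have energy: "finite_energy \<mu>" by (rule feasible_finite_energy[OF \<mu>])
  obtain d where d: "0 < d" "\<And>w. energy_pair w \<Longrightarrow> nrm \<kappa> (pdiff w (R \<mu>)) \<le> d \<Longrightarrow> \<bar>gauss w - gauss (R \<mu>)\<bar> \<le> e"
    using gauss_continuous[OF finite_energyD(2)[OF energy] e] by blast
  show ?thesis
  proof (rule that[OF d(1)])
    fix \<omega> assume \<omega>: "inEp \<kappa> \<omega>" "\<omega> \<in> plate_measures l" "nrm \<kappa> (\<omega>, \<mu> l) \<le> d"
    have "nrm \<kappa> (pdiff (R (\<mu>(l := \<omega>))) (R \<mu>)) = nrm \<kappa> (\<omega>, \<mu> l)"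
      using nrm_update_diff[OF energy \<omega>(1,2) finite_energy_parts(4,5)[OF energy]] by simp
    then show "gauss (R (\<mu>(l := \<omega>))) \<le> gauss (R \<mu>) + e"
      using d(2)[OF finite_energyD(2)[OF finite_energy_update[OF energy \<omega>(1,2)]]] \<omega>(3) by simp
  qed
qed

lemma weight_restr_compact_finite:
  assumes i: "i \<in> I" and \<mu>: "radon \<mu>" and K: "compact K"
  shows "weight i (restr K \<mu>) < \<infinity>"
proof -
  have K_borel: "K \<in> sets borel" by (rule borel_compact[OF K])
  have sets: "sets \<mu> = sets borel" by (rule sets_radon[OF \<mu>])
  have "compact (g ` (K \<inter> A i))"
    using K closed_plate[OF i] continuous_on_plate[OF i]
    by (intro compact_continuous_image compact_Int_closed) (auto intro: continuous_on_subset)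
  then obtain m where m: "\<And>x. x \<in> K \<inter> A i \<Longrightarrow> g x \<le> m"
    using compact_imp_bounded bounded_iff by (metis abs_le_D1 image_eqI real_norm_def)
  have "weight i (restr K \<mu>) = (\<integral>\<^sup>+ x. indicator K x * (ennreal (g x) * indicator (A i) x) \<partial>\<mu>)"
    by (rule nn_integral_restr[OF sets K_borel borel_measurable_plate_weight[OF i]])
  also have "\<dots> \<le> (\<integral>\<^sup>+ x. ennreal m * indicator K x \<partial>\<mu>)"
    using m by (intro nn_integral_mono) (auto simp: indicator_def intro!: ennreal_leI)
  also have "\<dots> = ennreal m * emeasure \<mu> K" using K_borel sets by (simp add: nn_integral_cmult_indicator)
  also have "\<dots> < \<infinity>" using emeasure_radon_compact[OF \<mu> K] by (simp add: ennreal_mult_less_top)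
  finally show ?thesis .
qed

text \<open>This is where \<open>cap \<kappa> (A l) = \<infinity>\<close> enters: weight can be placed on \<open>A l\<close> at no cost.\<close>

lemma cheap_weight:
  assumes e: "0 < e"
  obtains \<nu> w where "inEp \<kappa> \<nu>" "\<nu> \<in> plate_measures l" "weight l \<nu> = ennreal w" "g_inf / 2 \<le> w"
      "energy \<nu> \<nu> \<le> e"
proof -
  have "least_energy (A l) = 0"
    using cap_A_l by (simp add: cap_eq_inverse_least_energy ennreal_inverse_eq_top_iff)
  then have "least_energy (A l) < ennreal e" using e by simp
  then obtain \<nu> where \<nu>: "\<nu> \<in> unit_measures (A l)" "kint \<kappa> \<nu> \<nu> < ennreal e"
    unfolding least_energy_def INF_less_iff by blast
  have energy: "inEp \<kappa> \<nu>" and mass: "emeasure \<nu> UNIV = 1" and "conc \<nu> (A l)"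
    using \<nu>(1) by (auto simp: unit_measures_def)
  then have plate: "\<nu> \<in> plate_measures l" using conc_iff_plate_measures[OF l_in_I] inEp_radon by blast
  have "ennreal (1/2) < emeasure \<nu> UNIV"
    unfolding mass by (simp add: ennreal_less_one_iff del: ennreal_half)
  then obtain K where K: "compact K" "ennreal (1/2) < emeasure \<nu> K"
    unfolding radon_inner_regular[OF inEp_radon[OF energy] open_UNIV]
    by (auto simp: less_SUP_iff simp del: ennreal_half)
  have K_borel: "K \<in> sets borel" by (rule borel_compact[OF K(1)])
  let ?\<nu> = "restr K \<nu>"
  have restr: "inEp \<kappa> ?\<nu>" "?\<nu> \<in> plate_measures l"
    by (rule inEp_restr[OF energy K_borel], rule plate_measures_restr[OF plate energy K_borel l_in_I])
  obtain w where w: "weight l ?\<nu> = ennreal w" "0 \<le> w"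
    using weight_restr_compact_finite[OF l_in_I inEp_radon[OF energy] K(1)] by (cases "weight l ?\<nu>") auto
  have "ennreal (g_inf * (1/2)) = ennreal g_inf * ennreal (1/2)"
    using g_inf_pos by (intro ennreal_mult) auto
  also have "\<dots> \<le> ennreal g_inf * emeasure ?\<nu> UNIV"
    using K(2)
    by (intro mult_left_mono)
      (auto simp: emeasure_restr[OF inEp_sets[OF energy] K_borel] simp del: ennreal_half)
  also have "\<dots> \<le> ennreal w" unfolding w(1)[symmetric] by (rule mass_le_weight[OF l_in_I restr(2)])
  finally have "g_inf / 2 \<le> w" using w(2) by (simp add: ennreal_le_iff)
  moreover have "energy \<nu> \<nu> \<le> e" using \<nu>(2) e by (intro enn2real_leI) auto
  then have "energy ?\<nu> ?\<nu> \<le> e" using energy_restr_le[OF energy K_borel] by (rule order_trans[rotated])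
  ultimately show ?thesis using that[OF restr w(1)] by blast
qed

lemma cheap_unit_weight:
  assumes d: "0 < d"
  obtains \<nu> where "inEp \<kappa> \<nu>" "\<nu> \<in> plate_measures l" "weight l \<nu> = 1" "energy \<nu> \<nu> \<le> d"
proof -
  have "0 < d * (g_inf / 2)\<^sup>2" using d g_inf_pos by simp
  then obtain \<nu> w where \<nu>: "inEp \<kappa> \<nu>" "\<nu> \<in> plate_measures l" "weight l \<nu> = ennreal w"
    and w: "g_inf / 2 \<le> w" and energy: "energy \<nu> \<nu> \<le> d * (g_inf / 2)\<^sup>2"
    by (rule cheap_weight)
  have w_pos: "0 < w" using w g_inf_pos by simp
  let ?\<nu> = "scale_measure (ennreal (1 / w)) \<nu>"
  have "energy \<nu> \<nu> \<le> d * w\<^sup>2"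
    using energy w g_inf_pos d by (elim order_trans) (intro mult_left_mono power_mono, auto)
  then have "energy ?\<nu> ?\<nu> \<le> d" using \<nu>(1) w_pos by (simp add: energy_scale field_simps)
  moreover have "weight l ?\<nu> = 1"
    unfolding weight_scale[OF l_in_I \<nu>(2)] \<nu>(3) using w_pos by (simp flip: ennreal_mult')
  ultimately show ?thesis
    using that[of ?\<nu>] inEp_scale[OF \<nu>(1)] plate_measures_scale[OF \<nu>(2)] w_pos by simp
qed

lemma fill_up_weight:
  assumes \<mu>: "feasible (I - {l}) \<mu>" and weight_le: "weight l (\<mu> l) \<le> ennreal (a l)" and e: "0 < e"
  obtains \<nu> where "feasible I \<nu>" "gauss (R \<nu>) \<le> gauss (R \<mu>) + e"
proof -
  obtain w where w: "weight l (\<mu> l) = ennreal w" "0 \<le> w" "w \<le> a l"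
    using weight_le a_pos[OF l_in_I] by (cases "weight l (\<mu> l)") (auto simp: ennreal_le_iff top_unique)
  define t where "t = a l - w"
  have t: "0 \<le> t" using w by (simp add: t_def)
  obtain d where d: "0 < d" "\<And>\<omega>. inEp \<kappa> \<omega> \<Longrightarrow> \<omega> \<in> plate_measures l \<Longrightarrow> nrm \<kappa> (\<omega>, \<mu> l) \<le> d \<Longrightarrow>
      gauss (R (\<mu>(l := \<omega>))) \<le> gauss (R \<mu>) + e"
    using gauss_update_le[OF \<mu> e] by blast
  have "0 < (d / (t + 1))\<^sup>2" using d(1) t by simp
  then obtain \<nu> where \<nu>: "inEp \<kappa> \<nu>" "\<nu> \<in> plate_measures l" "weight l \<nu> = 1" "energy \<nu> \<nu> \<le> (d / (t + 1))\<^sup>2"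
    by (rule cheap_unit_weight)
  have \<mu>_l: "inEp \<kappa> (\<mu> l)" "\<mu> l \<in> plate_measures l"
    by (rule finite_energy_parts[OF feasible_finite_energy[OF \<mu>]])+
  let ?\<rho> = "scale_measure (ennreal t) \<nu>" and ?\<omega> = "madd (\<mu> l) (scale_measure (ennreal t) \<nu>)"
  have \<rho>: "inEp \<kappa> ?\<rho>" "?\<rho> \<in> plate_measures l" using \<nu> t by (auto intro: inEp_scale plate_measures_scale)
  have \<omega>: "inEp \<kappa> ?\<omega>" "?\<omega> \<in> plate_measures l" using \<mu>_l \<rho> by (auto intro: inEp_madd plate_measures_madd)
  have "nrm \<kappa> (?\<omega>, \<mu> l) = t * sqrt (energy \<nu> \<nu>)"
    using nrm_madd_self[OF \<mu>_l(1) \<rho>(1)] \<nu>(1) t by (simp add: nrm_swap[of ?\<omega>] energy_scale real_sqrt_mult)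
  also have "\<dots> \<le> t * (d / (t + 1))" using \<nu>(4) t d(1) by (intro mult_left_mono real_le_lsqrt) auto
  also have "\<dots> \<le> d" using t d(1) by (simp add: field_simps)
  finally have "gauss (R (\<mu>(l := ?\<omega>))) \<le> gauss (R \<mu>) + e" by (rule d(2)[OF \<omega>])
  moreover have "weight l ?\<omega> = ennreal (a l)"
    unfolding weight_madd[OF l_in_I \<mu>_l(2) \<rho>(2)] weight_scale[OF l_in_I \<nu>(2)] w(1) \<nu>(3)
    using w t by (simp add: t_def flip: ennreal_plus)
  then have "feasible I (\<mu>(l := ?\<omega>))" using feasible_update[OF \<mu> \<omega>] by (auto simp: EAag_def)
  ultimately show ?thesis using that by blast
qed

lemma gauss_ge_of_weight_le:
  assumes c: "\<And>\<nu>. feasible I \<nu> \<Longrightarrow> c \<le> gauss (R \<nu>)"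
    and \<mu>: "feasible (I - {l}) \<mu>" "weight l (\<mu> l) \<le> ennreal (a l)"
  shows "c \<le> gauss (R \<mu>)"
proof (rule field_le_epsilon)
  fix e :: real assume "0 < e"
  then obtain \<nu> where "feasible I \<nu>" "gauss (R \<nu>) \<le> gauss (R \<mu>) + e" using fill_up_weight[OF \<mu>] by blast
  then show "c \<le> gauss (R \<mu>) + e" using c[of \<nu>] by simp
qed

lemma finite_weight_approx:
  assumes \<mu>: "feasible (I - {l}) \<mu>" and e: "0 < e"
  obtains \<nu> where "feasible (I - {l}) \<nu>" "weight l (\<nu> l) < \<infinity>" "gauss (R \<nu>) \<le> gauss (R \<mu>) + e"
proof -
  have \<mu>_l: "inEp \<kappa> (\<mu> l)" "\<mu> l \<in> plate_measures l"
    by (rule finite_energy_parts[OF feasible_finite_energy[OF \<mu>]])+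
  obtain d where d: "0 < d" "\<And>\<omega>. inEp \<kappa> \<omega> \<Longrightarrow> \<omega> \<in> plate_measures l \<Longrightarrow> nrm \<kappa> (\<omega>, \<mu> l) \<le> d \<Longrightarrow>
      gauss (R (\<mu>(l := \<omega>))) \<le> gauss (R \<mu>) + e"
    using gauss_update_le[OF \<mu> e] by blast
  obtain K where K: "compact K" "nrm \<kappa> (restr K (\<mu> l), \<mu> l) \<le> d"
    using compact_restr_approx[OF \<mu>_l(1) d(1)] by blast
  have restr: "inEp \<kappa> (restr K (\<mu> l))" "restr K (\<mu> l) \<in> plate_measures l"
    using \<mu>_l K(1) l_in_I by (auto intro: inEp_restr plate_measures_restr borel_compact)
  show ?thesis
  proof (rule that[of "\<mu>(l := restr K (\<mu> l))"])
    show "feasible (I - {l}) (\<mu>(l := restr K (\<mu> l)))" by (rule feasible_update[OF \<mu> restr])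
    show "weight l ((\<mu>(l := restr K (\<mu> l))) l) < \<infinity>"
      using weight_restr_compact_finite[OF l_in_I inEp_radon[OF \<mu>_l(1)] K(1)] by simp
    show "gauss (R (\<mu>(l := restr K (\<mu> l)))) \<le> gauss (R \<mu>) + e" by (rule d(2)[OF restr K(2)])
  qed
qed

text \<open>A small convex combination of \<open>lam\<close> and \<open>\<nu>\<close> still has weight at most \<open>a l\<close> on \<open>A l\<close>.\<close>

lemma slack_minimizer_le:
  assumes lam: "feasible (I - {l}) lam" and slack: "weight l (lam l) < ennreal (a l)"
    and min: "\<And>\<nu>. feasible I \<nu> \<Longrightarrow> gauss (R lam) \<le> gauss (R \<nu>)"
    and \<nu>: "feasible (I - {l}) \<nu>" "weight l (\<nu> l) < \<infinity>"
  shows "gauss (R lam) \<le> gauss (R \<nu>)"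
proof -
  have plates: "plate_family lam" "plate_family \<nu>" and pairs: "energy_pair (R lam)" "energy_pair (R \<nu>)"
    using lam \<nu>(1) by (auto intro: finite_energyD feasible_finite_energy)
  obtain w where w: "weight l (lam l) = ennreal w" "0 \<le> w" "w < a l"
    using slack by (cases "weight l (lam l)") (auto simp: ennreal_less_iff)
  obtain v where v: "weight l (\<nu> l) = ennreal v" "0 \<le> v" using \<nu>(2) by (cases "weight l (\<nu> l)") auto
  define t where "t = min 1 ((a l - w) / (v + 1))"
  have t: "0 < t" "t \<le> 1" using w v by (auto simp: t_def)
  have "t * v \<le> (a l - w) / (v + 1) * (v + 1)" using w v by (intro mult_mono) (auto simp: t_def)
  then have "t * v \<le> a l - w" using v by simp
  moreover have "(1 - t) * w \<le> w" using t w by (intro mult_left_le_one_le) auto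
  ultimately have "(1 - t) * w + t * v \<le> a l" by linarith
  moreover have "weight l (vconv t lam \<nu> l) = ennreal ((1 - t) * w + t * v)"
    using t w v by (subst weight_vconv[OF plates l_in_I]) (auto simp: ennreal_mult ennreal_plus)
  ultimately have "weight l (vconv t lam \<nu> l) \<le> ennreal (a l)" by (simp add: ennreal_leI)
  moreover have "feasible (I - {l}) (vconv t lam \<nu>)" using t by (intro feasible_vconv lam \<nu>(1)) auto
  ultimately have "gauss (R lam) \<le> gauss (pconv t (R lam) (R \<nu>))"
    using gauss_ge_of_weight_le[OF min, of "vconv t lam \<nu>"] by (simp add: R_vconv[OF plates])
  also have "\<dots> \<le> (1 - t) * gauss (R lam) + t * gauss (R \<nu>)" using t by (intro gauss_pconv_le pairs) auto
  finally have "t * gauss (R lam) \<le> t * gauss (R \<nu>)" by (simp add: algebra_simps)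
  then show ?thesis using t(1) by simp
qed

lemma slack_minimizer_solves:
  assumes lam: "feasible (I - {l}) lam" and slack: "weight l (lam l) < ennreal (a l)"
    and min: "\<And>\<nu>. feasible I \<nu> \<Longrightarrow> gauss (R lam) \<le> gauss (R \<nu>)"
  shows "minimizes (I - {l}) lam"
  unfolding minimizes_iff
proof (intro conjI allI impI lam)
  fix \<mu> assume \<mu>: "feasible (I - {l}) \<mu>"
  show "gauss (R lam) \<le> gauss (R \<mu>)"
  proof (rule field_le_epsilon)
    fix e :: real assume "0 < e"
    then obtain \<nu> where \<nu>: "feasible (I - {l}) \<nu>" "weight l (\<nu> l) < \<infinity>" "gauss (R \<nu>) \<le> gauss (R \<mu>) + e"
      by (rule finite_weight_approx[OF \<mu>])
    then show "gauss (R lam) \<le> gauss (R \<mu>) + e" using slack_minimizer_le[OF lam slack min] by force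
  qed
qed

lemma nrm_residual:
  assumes \<mu>: "finite_energy \<mu>" and \<omega>: "inEp \<kappa> \<omega>" "\<omega> \<in> plate_measures l"
  shows "nrm \<kappa> (madd (fst ch) (msum Ip \<mu>), madd (madd (snd ch) (msum (In - {l}) \<mu>)) \<omega>)
    = sqrt (gauss (R (\<mu>(l := \<omega>))) + ip \<kappa> ch ch)"
proof -
  let ?z = "R (\<mu>(l := \<omega>))"
  have z: "energy_pair ?z" by (intro finite_energyD finite_energy_update \<mu> \<omega>)
  have "sets (snd ch) = sets borel" using energy_pair_ch by (simp add: energy_pair_def inEp_sets)
  then have "padd ch ?z = (madd (fst ch) (msum Ip \<mu>), madd (madd (snd ch) (msum (In - {l}) \<mu>)) \<omega>)"
    by (simp add: R_update[OF \<mu> \<omega>] padd_def madd_assoc inEp_sets[OF \<omega>(1)])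
  moreover have "padd ch ?z = padd ?z ch" by (simp add: padd_def madd_commute)
  moreover have "nrm \<kappa> (padd ?z ch) = sqrt ((nrm \<kappa> (padd ?z ch))\<^sup>2)"
    using nrm_nonneg[OF energy_pair_padd[OF z energy_pair_ch]] by simp
  ultimately show ?thesis by (simp add: gauss_eq_nrm[OF z])
qed

lemma proj_eq_minimizer:
  assumes lam: "minimizes (I - {l}) lam"
  shows "proj \<kappa> (A l) (madd (fst ch) (msum Ip lam), madd (snd ch) (msum (In - {l}) lam)) = lam l"
proof -
  have feasible: "feasible (I - {l}) lam" by (rule minimizes_feasible[OF lam])
  have energy: "finite_energy lam" by (rule feasible_finite_energy[OF feasible])
  let ?dist = "\<lambda>\<omega>. nrm \<kappa> (madd (fst ch) (msum Ip lam), madd (madd (snd ch) (msum (In - {l}) lam)) \<omega>)"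
  have plate: "inEp \<kappa> \<omega> \<and> conc \<omega> (A l) \<longleftrightarrow> inEp \<kappa> \<omega> \<and> \<omega> \<in> plate_measures l" for \<omega>
    using conc_iff_plate_measures[OF l_in_I] inEp_radon by blast
  have dist_le_iff: "?dist \<omega> \<le> ?dist \<rho> \<longleftrightarrow> gauss (R (lam(l := \<omega>))) \<le> gauss (R (lam(l := \<rho>)))"
    if "inEp \<kappa> \<omega>" "\<omega> \<in> plate_measures l" "inEp \<kappa> \<rho>" "\<rho> \<in> plate_measures l" for \<omega> \<rho>
    using that by (simp add: nrm_residual[OF energy])
  have lam_l: "inEp \<kappa> (lam l)" "lam l \<in> plate_measures l" by (rule finite_energy_parts[OF energy])+
  have closest: "?dist (lam l) \<le> ?dist \<omega>" if "inEp \<kappa> \<omega>" "\<omega> \<in> plate_measures l" for \<omega>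
    using minimizes_le[OF lam feasible_update[OF feasible that]] by (simp add: dist_le_iff lam_l that)
  have unique: "\<omega> = lam l" if \<omega>: "inEp \<kappa> \<omega>" "\<omega> \<in> plate_measures l" and closer: "?dist \<omega> \<le> ?dist (lam l)" for \<omega>
  proof -
    have "gauss (R (lam(l := \<omega>))) \<le> gauss (R lam)" using closer by (simp add: dist_le_iff \<omega> lam_l)
    then have "minimizes (I - {l}) (lam(l := \<omega>))"
      unfolding minimizes_iff using feasible_update[OF feasible \<omega>] minimizes_le[OF lam] order_trans by blast
    from minimizers_agree[OF this lam] show ?thesis by auto
  qed
  show ?thesis
    unfolding proj_def fst_conv snd_conv
  proof (rule the_equality)
    show "inEp \<kappa> (lam l) \<and> conc (lam l) (A l) \<and> (\<forall>\<omega>. inEp \<kappa> \<omega> \<and> conc \<omega> (A l) \<longrightarrow> ?dist (lam l) \<le> ?dist \<omega>)"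
      using plate closest lam_l by blast
    show "\<omega> = lam l" if "inEp \<kappa> \<omega> \<and> conc \<omega> (A l) \<and> (\<forall>\<rho>. inEp \<kappa> \<rho> \<and> conc \<rho> (A l) \<longrightarrow> ?dist \<omega> \<le> ?dist \<rho>)" for \<omega>
      using that plate unique lam_l by blast
  qed
qed

end

subsection \<open>Minimizers with a relaxed constraint on the plate of infinite capacity\<close>

lemma nested_near_minimizers:
  fixes L :: "nat \<Rightarrow> 'v set" and N :: "'v \<Rightarrow> real"
  assumes L: "\<And>n. L n \<noteq> {}" "decseq L" and N: "N ` L 0 \<subseteq> {0..B}"
  obtains x where "\<And>n. x n \<in> L n" "\<And>e. 0 < e \<Longrightarrow> \<exists>k. \<forall>n\<ge>k. \<forall>y\<in>L k. N (x n) < N y + e"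
proof -
  define d where "d n = Inf (N ` L n)" for n
  have "L n \<subseteq> L 0" for n by (rule decseqD[OF L(2)]) simp
  then have N_bounds: "0 \<le> N y" "N y \<le> B" if "y \<in> L n" for n y using N that by force+
  have bdd: "bdd_below (N ` L n)" for n using N_bounds(1) by (rule bdd_belowI2)
  have d_le: "d n \<le> N y" if "y \<in> L n" for n y unfolding d_def using bdd that by (intro cINF_lower)
  have "incseq d"
    unfolding incseq_def d_def using L(1) decseqD[OF L(2)] bdd
    by (intro allI impI cInf_superset_mono image_mono) auto
  moreover have "d n \<le> B" for n using L(1)[of n] d_le N_bounds(2) order_trans by blast
  ultimately obtain s where s: "d \<longlonglongrightarrow> s" "\<And>n. d n \<le> s" using incseq_convergent by metis
  have "\<exists>y\<in>L n. N y < d n + inverse (real (Suc n))" for n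
    using cInf_lessD[of "N ` L n" "d n + inverse (real (Suc n))"] L(1) by (auto simp: d_def)
  then obtain x where x: "\<And>n. x n \<in> L n" "\<And>n. N (x n) < d n + inverse (real (Suc n))" by metis
  have "\<exists>k. \<forall>n\<ge>k. \<forall>y\<in>L k. N (x n) < N y + e" if e: "0 < e" for e
  proof -
    have "\<forall>\<^sub>F n in sequentially. s - e / 2 < d n" using e by (intro order_tendstoD(1)[OF s(1)]) simp
    moreover have "\<forall>\<^sub>F n in sequentially. inverse (real (Suc n)) < e / 2"
      using e by (intro order_tendstoD(2)[OF LIMSEQ_inverse_real_of_nat]) simp
    ultimately have "\<forall>\<^sub>F n in sequentially. s - e / 2 < d n \<and> inverse (real (Suc n)) < e / 2"
      by (rule eventually_conj)
    then obtain k where k: "\<And>n. k \<le> n \<Longrightarrow> s - e / 2 < d n \<and> inverse (real (Suc n)) < e / 2"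
      by (auto simp: eventually_sequentially)
    have "N (x n) < N y + e" if "k \<le> n" "y \<in> L k" for n y
      using x(2)[of n] s(2)[of n] k[OF that(1)] k[OF order_refl] d_le[OF that(2)] by linarith
    then show ?thesis by blast
  qed
  then show ?thesis using that x(1) by blast
qed

text \<open>Consistency is available only for nonnegative measures, so a minimizing sequence is needed whose
  positive and negative parts are Cauchy separately. It is obtained by minimizing \<open>N\<close>, the sum of the
  energies of the two parts, within the sublevel sets of \<open>F\<close>.\<close>

lemma two_level_minimizing_sequence:
  fixes C :: "'v set" and F N :: "'v \<Rightarrow> real" and mid :: "'v \<Rightarrow> 'v \<Rightarrow> 'v" and D :: "'v \<Rightarrow> 'v \<Rightarrow> real"
  assumes C: "C \<noteq> {}" and N: "\<And>x. x \<in> C \<Longrightarrow> 0 \<le> N x" "\<And>x. x \<in> C \<Longrightarrow> F x \<le> Inf (F ` C) + 1 \<Longrightarrow> N x \<le> B"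
    and mid: "\<And>x y. x \<in> C \<Longrightarrow> y \<in> C \<Longrightarrow> mid x y \<in> C"
      "\<And>x y. x \<in> C \<Longrightarrow> y \<in> C \<Longrightarrow> F (mid x y) \<le> (F x + F y) / 2"
      "\<And>x y. x \<in> C \<Longrightarrow> y \<in> C \<Longrightarrow> N (mid x y) = (N x + N y) / 2 - D x y / 4"
  obtains x :: "nat \<Rightarrow> 'v" where "\<And>n. x n \<in> C" "\<And>n. F (x n) \<le> Inf (F ` C) + inverse (real (Suc n))"
    "\<And>e. e > 0 \<Longrightarrow> \<exists>k. \<forall>n\<ge>k. \<forall>m\<ge>k. D (x n) (x m) < e"
proof -
  define L where "L n = {x\<in>C. F x \<le> Inf (F ` C) + inverse (real (Suc n))}" for n
  have L_nonempty: "L n \<noteq> {}" for n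
    using cInf_lessD[of "F ` C" "Inf (F ` C) + inverse (real (Suc n))"] C
    by (auto simp: L_def intro: less_imp_le)
  have inverse_le: "inverse (real (Suc n)) \<le> inverse (real (Suc m))" if "m \<le> n" for m n
    using that by (intro le_imp_inverse_le) auto
  have L_decseq: "decseq L"
    unfolding decseq_def L_def
    by (intro allI impI Collect_mono) (meson add_left_mono inverse_le order_trans)
  have N_L_0: "N ` L 0 \<subseteq> {0..B}" using N by (auto simp: L_def)
  obtain x where x: "\<And>n. x n \<in> L n" and near: "\<And>e. 0 < e \<Longrightarrow> \<exists>k. \<forall>n\<ge>k. \<forall>y\<in>L k. N (x n) < N y + e"
    by (rule nested_near_minimizers[OF L_nonempty L_decseq N_L_0]) (rule that)
  have x_C: "x n \<in> C" for n using x by (auto simp: L_def)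
  have "\<exists>k. \<forall>n\<ge>k. \<forall>m\<ge>k. D (x n) (x m) < e" if e: "e > 0" for e
  proof -
    obtain k where k: "\<And>n y. k \<le> n \<Longrightarrow> y \<in> L k \<Longrightarrow> N (x n) < N y + e / 4" using near[of "e / 4"] e by auto
    have "D (x n) (x m) < e" if "k \<le> n" "k \<le> m" for n m
    proof -
      have "x n \<in> L k" "x m \<in> L k" using x decseqD[OF L_decseq] that by blast+
      then have "mid (x n) (x m) \<in> L k" using mid(1,2)[OF x_C[of n] x_C[of m]] by (auto simp: L_def)
      from k[OF that(1) this] k[OF that(2) this] show ?thesis using mid(3)[OF x_C[of n] x_C[of m]] by argo
    qed
    then show ?thesis by blast
  qed
  then show ?thesis using that[of x] x by (auto simp: L_def)
qed

lemma (in loc_finite_radon_family) integral_Cc_msum: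
  assumes \<phi>: "\<phi> \<in> Cc" and K: "compact K" "\<And>x. x \<notin> K \<Longrightarrow> \<phi> x = 0"
  shows "integral\<^sup>L (msum I \<mu>) \<phi> = (\<Sum>i\<in>{i\<in>I. A i \<inter> K \<noteq> {}}. integral\<^sup>L (\<mu> i) \<phi>)"
proof -
  let ?F = "{i\<in>I. A i \<inter> K \<noteq> {}}"
  have finite: "finite ?F" by (rule loc_finite_compact[OF loc_finite K(1)])
  have nonneg: "integral\<^sup>L (msum I \<mu>) f = (\<Sum>i\<in>?F. integral\<^sup>L (\<mu> i) f)"
    if f: "f \<in> Cc" "\<And>x. 0 \<le> f x" "\<And>x. \<phi> x = 0 \<Longrightarrow> f x = 0" for f
  proof -
    have off: "(\<integral>\<^sup>+ x. ennreal (f x) \<partial>\<mu> i) = 0" if i: "i \<in> I - ?F" for i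
    proof -
      have "AE x in \<mu> i. x \<in> A i" using i by (intro AE_carrier carrier closed sets_family) auto
      moreover have "f x = 0" if "x \<in> A i" for x using i K(2)[of x] f(3)[of x] that by blast
      ultimately have "AE x in \<mu> i. ennreal (f x) = 0" by (auto elim: eventually_mono)
      then show ?thesis by (simp cong: nn_integral_cong_AE)
    qed
    have "ennreal (integral\<^sup>L (msum I \<mu>) f) = (\<Sum>\<^sub>\<infinity>i\<in>I. \<integral>\<^sup>+ x. ennreal (f x) \<partial>\<mu> i)"
      unfolding nn_integral_Cc[OF radon_msum f(1,2), symmetric]
      by (intro nn_integral_msum sets_family measurable_compose[OF borel_measurable_Cc[OF f(1)]]) auto
    also have "\<dots> = (\<Sum>i\<in>?F. \<integral>\<^sup>+ x. ennreal (f x) \<partial>\<mu> i)"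
      by (rule infsum_finite_support[OF finite _ off]) auto
    also have "\<dots> = ennreal (\<Sum>i\<in>?F. integral\<^sup>L (\<mu> i) f)"
      using f(2) by (simp add: nn_integral_Cc[OF radon f(1,2)] sum_ennreal)
    finally show ?thesis using f(2) by (simp add: sum_nonneg)
  qed
  obtain p n where pn: "p \<in> Cc" "n \<in> Cc" "\<And>x. 0 \<le> p x" "\<And>x. 0 \<le> n x" "\<And>x. \<phi> x = p x - n x"
    "\<And>x. \<phi> x = 0 \<Longrightarrow> p x = 0" "\<And>x. \<phi> x = 0 \<Longrightarrow> n x = 0"
    using Cc_pos_neg_parts[OF \<phi>] by metis
  have diff: "integral\<^sup>L \<nu> \<phi> = integral\<^sup>L \<nu> p - integral\<^sup>L \<nu> n" if "radon \<nu>" for \<nu>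
    unfolding ext[of \<phi>, OF pn(5)] by (intro Bochner_Integration.integral_diff integrable_Cc that pn(1,2))
  show ?thesis
    using nonneg[OF pn(1,3,6)] nonneg[OF pn(2,4,7)] by (simp add: diff radon radon_msum sum_subtractf)
qed

lemma vaguely_tendsto_msum:
  fixes \<nu> :: "'i \<Rightarrow> 'a::t2_space measure"
  assumes M: "\<And>v. loc_finite_radon_family S A (M v)" and \<nu>: "loc_finite_radon_family S A \<nu>"
    and lim: "\<And>i. i \<in> S \<Longrightarrow> vaguely_tendsto (\<lambda>v. M v i) (\<nu> i) G"
  shows "vaguely_tendsto (\<lambda>v. msum S (M v)) (msum S \<nu>) G"
  unfolding vaguely_tendsto_def
proof
  fix \<phi> :: "'a \<Rightarrow> real" assume \<phi>: "\<phi> \<in> Cc"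
  obtain K where K: "compact K" "\<And>x. x \<notin> K \<Longrightarrow> \<phi> x = 0" using Cc_E[OF \<phi>] by metis
  have "((\<lambda>v. \<Sum>i\<in>{i\<in>S. A i \<inter> K \<noteq> {}}. integral\<^sup>L (M v i) \<phi>)
      \<longlongrightarrow> (\<Sum>i\<in>{i\<in>S. A i \<inter> K \<noteq> {}}. integral\<^sup>L (\<nu> i) \<phi>)) G"
    using lim \<phi> by (intro tendsto_sum vaguely_tendstoD) auto
  then show "((\<lambda>v. integral\<^sup>L (msum S (M v)) \<phi>) \<longlongrightarrow> integral\<^sup>L (msum S \<nu>) \<phi>) G"
    using loc_finite_radon_family.integral_Cc_msum[OF M \<phi> K]
      loc_finite_radon_family.integral_Cc_msum[OF \<nu> \<phi> K]
    by simp
qed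

lemma vague_cluster_filtermap:
  fixes \<nu> :: "'a::topological_space measure"
  assumes lim: "vaguely_tendsto M \<nu> G" and G: "G \<noteq> bot"
  shows "vague_cluster (filtermap M G) \<nu>"
  unfolding vague_cluster_def frequently_filtermap
proof (intro allI impI)
  fix \<Phi> :: "('a \<Rightarrow> real) set" and e :: real assume \<Phi>: "finite \<Phi> \<and> \<Phi> \<subseteq> Cc \<and> e > 0"
  have "\<forall>\<^sub>F v in G. \<bar>integral\<^sup>L (M v) \<phi> - integral\<^sup>L \<nu> \<phi>\<bar> < e" if "\<phi> \<in> \<Phi>" for \<phi>
    using tendstoD[OF vaguely_tendstoD[OF lim, of \<phi>], of e] \<Phi> that by (auto simp: dist_real_def)
  then have "\<forall>\<^sub>F v in G. \<forall>\<phi>\<in>\<Phi>. \<bar>integral\<^sup>L (M v) \<phi> - integral\<^sup>L \<nu> \<phi>\<bar> < e"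
    using \<Phi> by (intro eventually_ball_finite) auto
  then show "\<exists>\<^sub>F v in G. \<forall>\<phi>\<in>\<Phi>. \<bar>integral\<^sup>L (M v) \<phi> - integral\<^sup>L \<nu> \<phi>\<bar> < e"
    by (rule eventually_frequently[OF G])
qed

context consistent_kernel
begin

lemma strong_limit_of_Cauchy_sequence:
  fixes x :: "nat \<Rightarrow> 'a measure"
  assumes x: "\<And>n. inEp \<kappa> (x n)" "\<And>e. e > 0 \<Longrightarrow> \<exists>k. \<forall>n\<ge>k. \<forall>m\<ge>k. nrm \<kappa> (x n, x m) < e"
    and \<nu>: "radon \<nu>" "vaguely_tendsto x \<nu> G" and G: "G \<le> sequentially" "G \<noteq> bot"
  shows "inEp \<kappa> \<nu>" "\<And>e. e > 0 \<Longrightarrow> \<forall>\<^sub>F n in G. nrm \<kappa> (x n, \<nu>) < e"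
proof -
  let ?H = "filtermap x G"
  have "\<forall>\<^sub>F \<mu> in ?H. inEp \<kappa> \<mu>" using x(1) by (simp add: eventually_filtermap)
  moreover have "\<forall>\<^sub>F z in ?H \<times>\<^sub>F ?H. nrm \<kappa> (fst z, snd z) < e" if "e > 0" for e
  proof -
    obtain k where k: "\<forall>n\<ge>k. \<forall>m\<ge>k. nrm \<kappa> (x n, x m) < e" using x(2)[OF \<open>e > 0\<close>] by blast
    have "\<forall>\<^sub>F n in G. k \<le> n" by (rule filter_leD[OF G(1) eventually_ge_at_top])
    then have "\<forall>\<^sub>F \<mu> in ?H. \<mu> \<in> x ` {k..}" unfolding eventually_filtermap by eventually_elim auto
    then show ?thesis
      using k unfolding eventually_prod_filter by (intro exI[of _ "\<lambda>\<mu>. \<mu> \<in> x ` {k..}"]) auto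
  qed
  ultimately have "inEp \<kappa> \<nu> \<and> (\<forall>e>0. \<forall>\<^sub>F \<mu> in ?H. nrm \<kappa> (\<mu>, \<nu>) < e)"
    using consistent \<nu>(1) vague_cluster_filtermap[OF \<nu>(2) G(2)] unfolding kernel_consistent_def by blast
  then show "inEp \<kappa> \<nu>" "\<And>e. e > 0 \<Longrightarrow> \<forall>\<^sub>F n in G. nrm \<kappa> (x n, \<nu>) < e"
    by (auto simp: eventually_filtermap)
qed

end

context condenser_problem
begin

lemma total_mass_le:
  assumes \<mu>: "feasible I \<mu>" and S: "S \<subseteq> I"
  shows "emeasure (msum S \<mu>) UNIV \<le> ennreal (infsum a I / g_inf)"
proof -
  have plates: "plate_family \<mu>" by (rule finite_energyD[OF feasible_finite_energy[OF \<mu>]])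
  have mass: "emeasure (\<mu> i) UNIV \<le> ennreal (a i / g_inf)" if "i \<in> I" for i
    using feasible_weight[OF \<mu> that] a_pos[OF that]
    by (intro mass_le[OF that plate_familyD[OF plates that]]) auto
  have summable: "(\<lambda>i. a i / g_inf) summable_on I"
    using summable_on_cmult_left[OF a_summable, of "1 / g_inf"] by simp
  have "emeasure (msum S \<mu>) UNIV = (\<Sum>\<^sub>\<infinity>i\<in>S. emeasure (\<mu> i) UNIV)"
    using S by (intro emeasure_msum plate_family_sets[OF plates]) auto
  also have "\<dots> \<le> (\<Sum>\<^sub>\<infinity>i\<in>I. emeasure (\<mu> i) UNIV)"
    using S by (intro infsum_mono_neutral nonneg_summable_on_complete) auto
  also have "\<dots> \<le> (\<Sum>\<^sub>\<infinity>i\<in>I. ennreal (a i / g_inf))"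
    using mass by (intro infsum_mono nonneg_summable_on_complete) auto
  also have "\<dots> = ennreal (\<Sum>\<^sub>\<infinity>i\<in>I. a i / g_inf)"
    using summable a_pos g_inf_pos
    by (subst infsum_nonneg_is_SUPREMUM_ennreal)
       (auto simp: infsum_ennreal_SUP less_imp_le intro!: SUP_cong sum_ennreal)
  also have "(\<Sum>\<^sub>\<infinity>i\<in>I. a i / g_inf) = infsum a I / g_inf"
    using infsum_cmult_left'[of a "1 / g_inf" I] by simp
  finally show ?thesis .
qed

lemma cross_energy_bound:
  obtains M where "\<And>\<mu>. feasible I \<mu> \<Longrightarrow> energy (msum Ip \<mu>) (msum In \<mu>) \<le> M"
proof -
  obtain M :: real where M: "\<forall>x\<in>(\<Union>i\<in>Ip. A i). \<forall>y\<in>(\<Union>j\<in>In. A j). \<kappa> x y \<le> ennreal M"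
    using condenser unfolding condenser_def by (elim conjE exE)
  define m where "m = infsum a I / g_inf"
  have "energy (msum Ip \<mu>) (msum In \<mu>) \<le> enn2real (ennreal M * ennreal m * ennreal m)"
    if \<mu>: "feasible I \<mu>" for \<mu>
  proof (rule enn2real_mono)
    have plates: "plate_family \<mu>" by (rule finite_energyD[OF feasible_finite_energy[OF \<mu>]])
    have carried: "AE x in msum S \<mu>. x \<in> (\<Union>i\<in>S. A i)" if "S \<subseteq> I" for S
      by (intro AE_carrier loc_finite_radon_family.emeasure_msum_carrier[OF plate_subfamily[OF plates that]]
          closed_UN_plates[OF that] sets_msum)
    have "kint \<kappa> (msum Ip \<mu>) (msum In \<mu>)
        \<le> ennreal M * emeasure (msum In \<mu>) (space (msum In \<mu>)) * emeasure (msum Ip \<mu>) (space (msum Ip \<mu>))"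
      using M by (intro kint_le_of_bounded_kernel[OF carried carried]) auto
    also have "\<dots> \<le> ennreal M * ennreal m * ennreal m"
      using total_mass_le[OF \<mu>] unfolding m_def
      by (intro mult_mono) (auto simp: sets_eq_imp_space_eq[OF sets_msum])
    finally show "kint \<kappa> (msum Ip \<mu>) (msum In \<mu>) \<le> ennreal M * ennreal m * ennreal m" .
  qed (simp add: ennreal_mult_less_top)
  then show ?thesis using that by blast
qed

definition parts_energy :: "('i \<Rightarrow> 'a measure) \<Rightarrow> real" where
  "parts_energy \<mu> = energy (msum Ip \<mu>) (msum Ip \<mu>) + energy (msum In \<mu>) (msum In \<mu>)"

definition parts_dist_sq :: "('i \<Rightarrow> 'a measure) \<Rightarrow> ('i \<Rightarrow> 'a measure) \<Rightarrow> real" where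
  "parts_dist_sq \<mu> \<nu> = (nrm \<kappa> (msum Ip \<mu>, msum Ip \<nu>))\<^sup>2 + (nrm \<kappa> (msum In \<mu>, msum In \<nu>))\<^sup>2"

lemma parts_energy_bound:
  obtains B where "\<And>\<mu>. feasible I \<mu> \<Longrightarrow> gauss (R \<mu>) \<le> c \<Longrightarrow> parts_energy \<mu> \<le> B"
proof -
  obtain M where M: "\<And>\<mu>. feasible I \<mu> \<Longrightarrow> energy (msum Ip \<mu>) (msum In \<mu>) \<le> M"
    using cross_energy_bound by blast
  have "parts_energy \<mu> \<le> 2 * (c + ip \<kappa> ch ch) + 2 * ip \<kappa> ch ch + 2 * M"
    if \<mu>: "feasible I \<mu>" "gauss (R \<mu>) \<le> c" for \<mu>
  proof -
    let ?z = "R \<mu>"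
    note energy = feasible_finite_energy[OF \<mu>(1)]
    have z: "energy_pair ?z" by (rule finite_energyD[OF energy])
    have "0 \<le> ip \<kappa> (padd ?z (pscale 2 ch)) (padd ?z (pscale 2 ch))"
      by (intro ip_nonneg energy_pair_padd z energy_pair_pscale energy_pair_ch) simp
    then have "0 \<le> ip \<kappa> ?z ?z + 4 * ip \<kappa> ch ?z + 4 * ip \<kappa> ch ch"
      using z energy_pair_ch ip_sym[OF z energy_pair_ch] by (simp add: ip_linear)
    then have "ip \<kappa> ?z ?z \<le> 2 * (c + ip \<kappa> ch ch) + 2 * ip \<kappa> ch ch" using \<mu>(2) unfolding gauss_def by argo
    moreover have "ip \<kappa> ?z ?z = parts_energy \<mu> - 2 * energy (msum Ip \<mu>) (msum In \<mu>)"
      using energy_sym[OF finite_energy_parts(2,1)[OF energy]] by (simp add: ip_def Rm_def parts_energy_def)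
    ultimately show ?thesis using M[OF \<mu>(1)] by argo
  qed
  then show ?thesis using that by blast
qed

lemma parts_energy_midpoint:
  assumes \<mu>: "finite_energy \<mu>" and \<nu>: "finite_energy \<nu>"
  shows "parts_energy (vconv (1/2) \<mu> \<nu>) = (parts_energy \<mu> + parts_energy \<nu>) / 2 - parts_dist_sq \<mu> \<nu> / 4"
  using finite_energy_parts(1,2)[OF \<mu>] finite_energy_parts(1,2)[OF \<nu>] finite_energyD(1)[OF \<mu>]
    finite_energyD(1)[OF \<nu>]
  by (simp add: parts_energy_def parts_dist_sq_def msum_vconv energy_mconv field_simps)

lemma component_energy_le:
  assumes \<mu>: "plate_family \<mu>" and S: "S \<subseteq> I" "i \<in> S" and energy: "inEp \<kappa> (msum S \<mu>)"
  shows "inEp \<kappa> (\<mu> i)" "energy (\<mu> i) (\<mu> i) \<le> energy (msum S \<mu>) (msum S \<mu>)"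
proof -
  have split: "msum S \<mu> = madd (msum (S - {i}) \<mu>) (\<mu> i)"
    using S by (intro msum_remove plate_family_sets[OF \<mu>]) auto
  have radon: "radon (msum (S - {i}) \<mu>)" "radon (\<mu> i)"
    using S plate_familyD[OF \<mu>, of i] radon_msum_plates[OF \<mu>, of "S - {i}"]
    by (auto simp: plate_measures_def)
  show "inEp \<kappa> (\<mu> i)" "energy (\<mu> i) (\<mu> i) \<le> energy (msum S \<mu>) (msum S \<mu>)"
    using inEp_maddD(2)[OF radon] energy_le_madd[OF radon] energy by (simp_all add: split)
qed

lemma component_energy_le_parts:
  assumes \<mu>: "finite_energy \<mu>" and i: "i \<in> I"
  shows "inEp \<kappa> (\<mu> i)" "energy (\<mu> i) (\<mu> i) \<le> parts_energy \<mu>"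
proof -
  note plates = finite_energyD(1)[OF \<mu>] and parts = finite_energy_parts(1,2)[OF \<mu>]
  consider (positive) "i \<in> Ip" | (negative) "i \<in> In" using i by blast
  then have "inEp \<kappa> (\<mu> i) \<and> energy (\<mu> i) (\<mu> i) \<le> parts_energy \<mu>"
  proof cases
    case positive
    then show ?thesis
      using component_energy_le[OF plates _ positive parts(1)] unfolding parts_energy_def
      by (auto intro: add_increasing2)
  next
    case negative
    then show ?thesis
      using component_energy_le[OF plates _ negative parts(2)] unfolding parts_energy_def
      by (auto intro: add_increasing)
  qed
  then show "inEp \<kappa> (\<mu> i)" "energy (\<mu> i) (\<mu> i) \<le> parts_energy \<mu>" by auto
qed

definition gauss_inf :: real where
  "gauss_inf = (INF \<mu>\<in>{\<mu>. feasible I \<mu>}. gauss (R \<mu>))"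

lemma gauss_inf_le:
  assumes "feasible I \<mu>" shows "gauss_inf \<le> gauss (R \<mu>)"
  unfolding gauss_inf_def using assms
  by (intro cINF_lower bdd_belowI2[of _ "- ip \<kappa> ch ch"] gauss_ge finite_energyD(2)
      feasible_finite_energy) auto

lemma minimizing_sequence:
  assumes nonempty: "\<exists>\<mu>. feasible I \<mu>"
  obtains x B where "\<And>n. feasible I (x n)" "\<And>n. gauss (R (x n)) \<le> gauss_inf + inverse (real (Suc n))"
    "\<And>n. parts_energy (x n) \<le> B" "\<And>e. e > 0 \<Longrightarrow> \<exists>k. \<forall>n\<ge>k. \<forall>m\<ge>k. parts_dist_sq (x n) (x m) < e"
proof -
  let ?C = "{\<mu>. feasible I \<mu>}" and ?F = "\<lambda>\<mu>. gauss (R \<mu>)"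
  obtain B where B: "\<And>\<mu>. feasible I \<mu> \<Longrightarrow> gauss (R \<mu>) \<le> gauss_inf + 1 \<Longrightarrow> parts_energy \<mu> \<le> B"
    using parts_energy_bound[of "gauss_inf + 1"] by blast
  obtain x :: "nat \<Rightarrow> 'i \<Rightarrow> 'a measure" where x: "\<And>n. x n \<in> ?C"
      "\<And>n. ?F (x n) \<le> Inf (?F ` ?C) + inverse (real (Suc n))"
    "\<And>e. e > 0 \<Longrightarrow> \<exists>k. \<forall>n\<ge>k. \<forall>m\<ge>k. parts_dist_sq (x n) (x m) < e"
  proof (rule two_level_minimizing_sequence[of ?C parts_energy ?F B "vconv (1/2)" parts_dist_sq])
    show "?C \<noteq> {}" using nonempty by blast
    show "0 \<le> parts_energy \<mu>" for \<mu> by (simp add: parts_energy_def)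
    show "parts_energy \<mu> \<le> B" if "\<mu> \<in> ?C" "?F \<mu> \<le> Inf (?F ` ?C) + 1" for \<mu>
      using that B by (simp add: gauss_inf_def)
    fix \<mu> \<nu> assume "\<mu> \<in> ?C" "\<nu> \<in> ?C"
    then have feasible: "feasible I \<mu>" "feasible I \<nu>" by auto
    then have energy: "finite_energy \<mu>" "finite_energy \<nu>" by (auto intro: feasible_finite_energy)
    show "vconv (1/2) \<mu> \<nu> \<in> ?C" using feasible by (simp add: feasible_vconv)
    show "?F (vconv (1/2) \<mu> \<nu>) \<le> (?F \<mu> + ?F \<nu>) / 2"
      using gauss_pconv_le[of "R \<mu>" "R \<nu>" "1/2"] energy by (simp add: R_vconv finite_energyD field_simps)
    show "parts_energy (vconv (1/2) \<mu> \<nu>) = (parts_energy \<mu> + parts_energy \<nu>) / 2 - parts_dist_sq \<mu> \<nu> / 4"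
      by (rule parts_energy_midpoint[OF energy])
  qed (rule that)
  have "parts_energy (x n) \<le> B" for n
  proof (rule B)
    show "feasible I (x n)" using x(1) by simp
    have "inverse (real (Suc n)) \<le> 1" by (simp add: inverse_le_1_iff)
    then show "?F (x n) \<le> gauss_inf + 1" using x(2)[of n] unfolding gauss_inf_def by linarith
  qed
  then show ?thesis using that[of x B] x by (simp add: gauss_inf_def)
qed

lemma vague_limit_of_feasible:
  assumes x: "\<And>n :: nat. feasible I (x n)"
  obtains G lam where "G \<le> sequentially" "G \<noteq> bot" "plate_family lam"
    "\<And>i. i \<in> I \<Longrightarrow> weight i (lam i) \<le> ennreal (a i)" "\<And>i. i \<in> I \<Longrightarrow> vaguely_tendsto (\<lambda>n. x n i) (lam i) G"
proof -
  have plate: "x n i \<in> plate_measures i" if "i \<in> I" for n i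
    using x that by (intro plate_familyD finite_energyD(1) feasible_finite_energy)
  have "\<forall>\<^sub>F n in sequentially. \<forall>i\<in>I. radon (x n i) \<and> emeasure (x n i) UNIV \<le> ennreal (a i / g_inf)"
  proof (intro always_eventually allI ballI conjI)
    fix n i assume i: "i \<in> I"
    show "radon (x n i)" using plate[OF i] by (simp add: plate_measures_def)
    show "emeasure (x n i) UNIV \<le> ennreal (a i / g_inf)"
      using feasible_weight[OF x i] a_pos[OF i] by (intro mass_le[OF i plate[OF i]]) auto
  qed
  moreover have "0 \<le> a i / g_inf" if "i \<in> I" for i using a_pos[OF that] g_inf_pos by simp
  ultimately obtain G lam where G: "G \<le> sequentially" "G \<noteq> bot" and radon: "\<And>i. i \<in> I \<Longrightarrow> radon (lam i)"
    and lim: "\<And>i. i \<in> I \<Longrightarrow> vaguely_tendsto (\<lambda>n. x n i) (lam i) G"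
    using vague_cluster_family[OF lc sequentially_bot, of I "\<lambda>i. a i / g_inf" x] by blast
  have "emeasure (lam i) (UNIV - A i) = 0 \<and> weight i (lam i) \<le> ennreal (a i)" if i: "i \<in> I" for i
  proof -
    have "\<forall>\<^sub>F n in G. radon (x n i) \<and> emeasure (x n i) (UNIV - A i) = 0 \<and> weight i (x n i) \<le> ennreal (a i)"
      using plate[OF i] feasible_weight[OF x i]
      by (intro always_eventually allI) (auto simp: plate_measures_def)
    from vague_limit_weight_le[OF lc radon[OF i] closed_plate[OF i] continuous_on_plate[OF i] G(2)
        this lim[OF i]]
    show ?thesis by blast
  qed
  then show ?thesis using radon lim by (intro that[OF G]) (auto simp: plate_family_def plate_measures_def)
qed

lemma weight_vague_limit_ge:
  assumes i: "i \<in> I" "i \<noteq> l" and x: "\<And>n. feasible I (x n)" "\<And>n. parts_energy (x n) \<le> B"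
    and \<nu>: "\<nu> \<in> plate_measures i" "vaguely_tendsto (\<lambda>n. x n i) \<nu> G" and G: "G \<noteq> bot"
  shows "ennreal (a i) \<le> weight i \<nu>"
proof (rule vague_limit_weight_ge)
  show "growth_condition \<kappa> (A i) g" using g_ok i(1) unfolding g_ok_def growth_condition_def by blast
  show "\<forall>\<^sub>F n in G. inEp \<kappa> (x n i) \<and> emeasure (x n i) UNIV < \<infinity> \<and> energy (x n i) (x n i) \<le> B \<and>
      emeasure (x n i) (UNIV - A i) = 0 \<and> weight i (x n i) = ennreal (a i)"
  proof (intro always_eventually allI)
    fix n
    note energy = feasible_finite_energy[OF x(1)[of n]]
    have plate: "x n i \<in> plate_measures i" by (rule plate_familyD[OF finite_energyD(1)[OF energy] i(1)])
    have "emeasure (x n i) UNIV \<le> ennreal (a i / g_inf)"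
      using feasible_weight[OF x(1) i(1)] a_pos[OF i(1)] by (intro mass_le[OF i(1) plate]) auto
    then show "inEp \<kappa> (x n i) \<and> emeasure (x n i) UNIV < \<infinity> \<and> energy (x n i) (x n i) \<le> B \<and>
        emeasure (x n i) (UNIV - A i) = 0 \<and> weight i (x n i) = ennreal (a i)"
      using component_energy_le_parts[OF energy i(1)] x(2)[of n] feasible_weight[OF x(1) i(1)] plate
      by (auto simp: plate_measures_def intro: le_less_trans)
  qed
qed (use i \<nu> G closed_plate continuous_on_plate g_pos cap_finite in \<open>auto simp: plate_measures_def\<close>)

lemma part_strong_limit:
  fixes x :: "nat \<Rightarrow> 'i \<Rightarrow> 'a measure"
  assumes S: "S \<subseteq> I" and x: "\<And>n. plate_family (x n)" "\<And>n. inEp \<kappa> (msum S (x n))"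
    and cauchy: "\<And>e. e > 0 \<Longrightarrow> \<exists>k. \<forall>n\<ge>k. \<forall>m\<ge>k. (nrm \<kappa> (msum S (x n), msum S (x m)))\<^sup>2 < e"
    and lam: "plate_family lam" "\<And>i. i \<in> I \<Longrightarrow> vaguely_tendsto (\<lambda>n. x n i) (lam i) G"
    and G: "G \<le> sequentially" "G \<noteq> bot"
  shows "inEp \<kappa> (msum S lam)" "\<And>e. e > 0 \<Longrightarrow> \<forall>\<^sub>F n in G. nrm \<kappa> (msum S (x n), msum S lam) < e"
proof -
  have vague: "vaguely_tendsto (\<lambda>n. msum S (x n)) (msum S lam) G"
    using S
    by (intro vaguely_tendsto_msum[OF plate_subfamily[OF x(1) S] plate_subfamily[OF lam(1) S]] lam(2)) auto
  have "\<exists>k. \<forall>n\<ge>k. \<forall>m\<ge>k. nrm \<kappa> (msum S (x n), msum S (x m)) < e" if "e > 0" for e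
    using cauchy[of "e\<^sup>2"] that power2_less_imp_less[of _ e] by (meson less_imp_le zero_less_power)
  from strong_limit_of_Cauchy_sequence[OF x(2) this radon_msum_plates[OF lam(1) S] vague G]
  show "inEp \<kappa> (msum S lam)" "\<And>e. e > 0 \<Longrightarrow> \<forall>\<^sub>F n in G. nrm \<kappa> (msum S (x n), msum S lam) < e" by blast+
qed

lemma nrm_R_diff_le:
  assumes "finite_energy \<mu>" "finite_energy \<nu>"
  shows "nrm \<kappa> (pdiff (R \<mu>) (R \<nu>)) \<le> nrm \<kappa> (msum Ip \<mu>, msum Ip \<nu>) + nrm \<kappa> (msum In \<mu>, msum In \<nu>)"
proof -
  let ?p = "(msum Ip \<mu>, msum Ip \<nu>)" and ?n = "(msum In \<mu>, msum In \<nu>)"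
  have "pdiff (R \<mu>) (R \<nu>) = padd ?p (pneg ?n)"
    by (simp add: pdiff_def padd_def pneg_def Rm_def madd_commute)
  moreover have "energy_pair ?p" "energy_pair ?n"
    using assms by (simp_all add: energy_pair_def finite_energy_parts)
  ultimately show ?thesis using nrm_triangle[of ?p "pneg ?n"] by (simp add: energy_pair_pneg nrm_pneg)
qed

lemma gauss_strong_limit_le:
  assumes x: "\<And>n. finite_energy (x n)" "\<And>n :: nat. gauss (R (x n)) \<le> c + inverse (real (Suc n))"
    and lam: "finite_energy lam" and G: "G \<le> sequentially" "G \<noteq> bot"
    and lim: "\<And>e. e > 0 \<Longrightarrow> \<forall>\<^sub>F n in G. nrm \<kappa> (msum Ip (x n), msum Ip lam) < e"
      "\<And>e. e > 0 \<Longrightarrow> \<forall>\<^sub>F n in G. nrm \<kappa> (msum In (x n), msum In lam) < e"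
  shows "gauss (R lam) \<le> c"
proof (rule field_le_epsilon)
  fix e :: real assume e: "0 < e"
  obtain d where d: "0 < d"
      "\<And>w. energy_pair w \<Longrightarrow> nrm \<kappa> (pdiff w (R lam)) \<le> d \<Longrightarrow> \<bar>gauss w - gauss (R lam)\<bar> \<le> e / 2"
    using gauss_continuous[OF finite_energyD(2)[OF lam], of "e / 2"] e by auto
  have small: "\<forall>\<^sub>F n in G. inverse (real (Suc n)) < e / 2"
    using e by (intro filter_leD[OF G(1)] order_tendstoD(2)[OF LIMSEQ_inverse_real_of_nat]) simp
  have "\<forall>\<^sub>F n in G. gauss (R lam) \<le> c + e"
    using small lim(1)[OF half_gt_zero[OF d(1)]] lim(2)[OF half_gt_zero[OF d(1)]]
  proof eventually_elim
    case (elim n)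
    have "nrm \<kappa> (pdiff (R (x n)) (R lam)) \<le> d" using nrm_R_diff_le[OF x(1)[of n] lam] elim by linarith
    then have "\<bar>gauss (R (x n)) - gauss (R lam)\<bar> \<le> e / 2" by (rule d(2)[OF finite_energyD(2)[OF x(1)]])
    then show ?case using x(2)[of n] elim(1) by linarith
  qed
  then show "gauss (R lam) \<le> c + e" using eventually_happens'[OF G(2)] by blast
qed

lemma relaxed_minimizer:
  assumes nonempty: "\<exists>\<mu>. feasible I \<mu>"
  obtains lam where "feasible (I - {l}) lam" "weight l (lam l) \<le> ennreal (a l)"
    "\<And>\<nu>. feasible I \<nu> \<Longrightarrow> gauss (R lam) \<le> gauss (R \<nu>)"
proof -
  obtain x B where x: "\<And>n. feasible I (x n)" "\<And>n. gauss (R (x n)) \<le> gauss_inf + inverse (real (Suc n))"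
      "\<And>n. parts_energy (x n) \<le> B"
    and cauchy: "\<And>e. e > 0 \<Longrightarrow> \<exists>k. \<forall>n\<ge>k. \<forall>m\<ge>k. parts_dist_sq (x n) (x m) < e"
    using minimizing_sequence[OF nonempty] by blast
  obtain G lam where G: "G \<le> sequentially" "G \<noteq> bot" and lam: "plate_family lam"
    and weight_le: "\<And>i. i \<in> I \<Longrightarrow> weight i (lam i) \<le> ennreal (a i)"
    and vague: "\<And>i. i \<in> I \<Longrightarrow> vaguely_tendsto (\<lambda>n. x n i) (lam i) G"
    by (rule vague_limit_of_feasible[OF x(1)]) (rule that)
  have energy: "finite_energy (x n)" for n by (rule feasible_finite_energy[OF x(1)])
  have plates: "plate_family (x n)" for n by (rule finite_energyD(1)[OF energy])
  have part_le: "(nrm \<kappa> (msum Ip \<mu>, msum Ip \<nu>))\<^sup>2 \<le> parts_dist_sq \<mu> \<nu>"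
      "(nrm \<kappa> (msum In \<mu>, msum In \<nu>))\<^sup>2 \<le> parts_dist_sq \<mu> \<nu>"
    for \<mu> \<nu> by (simp_all add: parts_dist_sq_def)
  have cauchy_parts: "\<exists>k. \<forall>n\<ge>k. \<forall>m\<ge>k. (nrm \<kappa> (msum Ip (x n), msum Ip (x m)))\<^sup>2 < e"
    "\<exists>k. \<forall>n\<ge>k. \<forall>m\<ge>k. (nrm \<kappa> (msum In (x n), msum In (x m)))\<^sup>2 < e" if "e > 0" for e
    using cauchy[OF that] part_le le_less_trans by blast+
  have limit_p: "inEp \<kappa> (msum Ip lam)" "\<And>e. e > 0 \<Longrightarrow> \<forall>\<^sub>F n in G. nrm \<kappa> (msum Ip (x n), msum Ip lam) < e"
    by (rule part_strong_limit[OF Un_upper1 plates finite_energy_parts(1)[OF energy]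
          cauchy_parts(1) lam vague G]; assumption)+
  have limit_n: "inEp \<kappa> (msum In lam)" "\<And>e. e > 0 \<Longrightarrow> \<forall>\<^sub>F n in G. nrm \<kappa> (msum In (x n), msum In lam) < e"
    by (rule part_strong_limit[OF Un_upper2 plates finite_energy_parts(2)[OF energy]
          cauchy_parts(2) lam vague G]; assumption)+
  have energy_lam: "finite_energy lam"
    using lam limit_p(1) limit_n(1) by (simp add: finite_energy_iff energy_pair_def Rm_def)
  show ?thesis
  proof (rule that[of lam])
    have "weight i (lam i) = ennreal (a i)" if "i \<in> I - {l}" for i
    proof (rule antisym)
      show "weight i (lam i) \<le> ennreal (a i)" using weight_le that by simp
      show "ennreal (a i) \<le> weight i (lam i)"
        using that by (intro weight_vague_limit_ge[OF _ _ x(1,3) plate_familyD[OF lam] vague G(2)]) auto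
    qed
    then show "feasible (I - {l}) lam" by (rule feasibleI[OF energy_lam])
    show "weight l (lam l) \<le> ennreal (a l)" by (rule weight_le[OF l_in_I])
    show "gauss (R lam) \<le> gauss (R \<nu>)" if "feasible I \<nu>" for \<nu>
      using gauss_strong_limit_le[OF energy x(2) energy_lam G limit_p(2) limit_n(2)] gauss_inf_le[OF that]
      by simp
  qed
qed

lemma solvable_imp_weight_ge:
  assumes \<mu>: "minimizes I \<mu>" and lam: "minimizes (I - {l}) lam"
  shows "ennreal (a l) \<le> weight l (lam l)"
proof (rule ccontr)
  assume less: "\<not> ?thesis"
  have \<mu>_feasible: "feasible I \<mu>" by (rule minimizes_feasible[OF \<mu>])
  have "gauss (R \<mu>) \<le> gauss (R lam)"
    using less by (intro gauss_ge_of_weight_le[OF minimizes_le[OF \<mu>] minimizes_feasible[OF lam]]) auto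
  then have "minimizes (I - {l}) \<mu>"
    using \<mu>_feasible minimizes_le[OF lam] order_trans unfolding minimizes_iff EAag_def by blast
  then have "\<mu> l = lam l" using lam by (rule minimizers_agree) auto
  then show False using less feasible_weight[OF \<mu>_feasible l_in_I] by simp
qed

lemma weight_ge_imp_solvable:
  assumes nonempty: "\<exists>\<mu>. feasible I \<mu>" and lam: "minimizes (I - {l}) lam"
    and weight_ge: "ennreal (a l) \<le> weight l (lam l)"
  shows "\<exists>\<mu>. minimizes I \<mu>"
proof -
  obtain \<mu> where \<mu>: "feasible (I - {l}) \<mu>" and weight_le: "weight l (\<mu> l) \<le> ennreal (a l)"
    and min: "\<And>\<nu>. feasible I \<nu> \<Longrightarrow> gauss (R \<mu>) \<le> gauss (R \<nu>)"
    using relaxed_minimizer[OF nonempty] by blast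
  have "weight l (\<mu> l) = ennreal (a l)"
  proof (rule ccontr)
    assume "weight l (\<mu> l) \<noteq> ennreal (a l)"
    then have slack: "weight l (\<mu> l) < ennreal (a l)" using weight_le by simp
    have "\<mu> l = lam l" using slack_minimizer_solves[OF \<mu> slack min] lam by (rule minimizers_agree) auto
    then show False using slack weight_ge by simp
  qed
  then have "feasible I \<mu>" using \<mu> by (auto simp: EAag_def)
  then show ?thesis using min by (auto simp: minimizes_iff)
qed

end

theorem theorem7p3:
  fixes \<kappa> :: "'a::t2_space kernel" and h :: real
    and Ip In :: "'i set" and A :: "'i \<Rightarrow> 'a set"
    and ch :: "'a smeasure" and g :: "'a \<Rightarrow> real"
    and a :: "'i \<Rightarrow> real" and l :: 'i and lam :: "'i \<Rightarrow> 'a measure"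
  assumes X: "locally_compact_space (euclidean :: 'a topology)" "\<not> compact (UNIV :: 'a set)"
    and K: "kernel_basic \<kappa>" "kernel_spd \<kappa>" "kernel_consistent \<kappa>" "kernel_offdiag \<kappa>"
       "kernel_vanishing \<kappa>" "h \<ge> 1" "kernel_gmp \<kappa> h"
    and cond: "condenser \<kappa> Ip In A"
    and chi: "ext_field \<kappa> Ip In A ch"
    and g: "g_ok \<kappa> (Ip \<union> In) A g"
    and L: "{i\<in>Ip \<union> In. cap \<kappa> (A i) = \<infinity>} = {l}"
    and ell: "l \<in> In"
    and disj: "\<forall>i\<in>Ip \<union> In. i \<noteq> l \<longrightarrow> A i \<inter> A l = {}"
    and adm: "admissible \<kappa> Ip In A g ch a"
    and sol: "solves \<kappa> Ip In A a g ch (Ip \<union> In - {l}) lam"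
  shows "((\<exists>\<mu>. solves \<kappa> Ip In A a g ch (Ip \<union> In) \<mu>) \<longleftrightarrow>
            ennreal (a l) \<le> (\<integral>\<^sup>+ x. ennreal (g x) * indicator (A l) x \<partial>(lam l)))
       \<and> ((\<exists>\<mu>. solves \<kappa> Ip In A a g ch (Ip \<union> In) \<mu>) \<longleftrightarrow>
            ennreal (a l) \<le> (\<integral>\<^sup>+ x. ennreal (g x) * indicator (A l) x
               \<partial>(proj \<kappa> (A l) (madd (fst ch) (msum Ip lam), madd (snd ch) (msum (In - {l}) lam)))))"
proof -
  interpret condenser_problem \<kappa> Ip In A ch g a l
  proof
    show "cap \<kappa> (A l) = \<infinity>" using L by blast
    show "cap \<kappa> (A i) \<noteq> \<infinity>" if "i \<in> Ip \<union> In" "i \<noteq> l" for i using L that by blast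
  qed (use X K cond chi g ell disj adm in \<open>auto simp: admissible_def\<close>)
  have "\<exists>\<mu>. feasible I \<mu>"
  proof (rule ccontr)
    assume "\<not> ?thesis"
    then have "Ginf \<kappa> Ip In A a g ch I = \<infinity>" by (simp add: Ginf_def top_ereal_def)
    then show False using adm by (simp add: admissible_def)
  qed
  then have "(\<exists>\<mu>. minimizes I \<mu>) \<longleftrightarrow> ennreal (a l) \<le> weight l (lam l)"
    using solvable_imp_weight_ge weight_ge_imp_solvable sol by blast
  then show ?thesis by (simp only: proj_eq_minimizer[OF sol] conj_absorb)
qed

end
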